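(* Let $V_\rho$ be an irreducible unitary representation of $SO(n)$ or $Spin(n)$ with highest weight $\rho$, and let $V_\rho\otimes\mathbb C^n=\bigoplus_\lambda V_\lambda$ be its irreducible decomposition; all sums over $\lambda$ run over the highest weights occurring there. Let $\xi,\eta\in\mathbb R^n$. Then the Clifford homomorphisms $\{p^\rho_\lambda\}_\lambda$ satisfy, as endomorphisms of $V_\rho$ (scalars meaning multiples of the identity), $$\sum_\lambda\big(p^\rho_\lambda(\xi)^*p^\rho_\lambda(\eta)+p^\rho_\lambda(\eta)^*p^\rho_\lambda(\xi)\big)=2\langle\xi,\eta\rangle,$$ $$\sum_\lambda\Big\{\sum_{p=0}^{2q-1}(-\hat w(\rho;\lambda))^p\,\pi_\rho(\hat c_{2q-1-p})\Big\}\big(p^\rho_\lambda(\xi)^*p^\rho_\lambda(\eta)+p^\rho_\lambda(\eta)^*p^\rho_\lambda(\xi)\big)=0\qquad(q=1,2,\dots),$$ and, for $n=2m$, $$\sum_\lambda\pi_\lambda(\mathrm{pf})\big(p^\rho_\lambda(\xi)^*p^\rho_\lambda(\eta)+p^\rho_\lambda(\eta)^*p^\rho_\lambda(\xi)\big)=2\pi_\rho(\mathrm{pf})\langle\xi,\eta\rangle,$$ $$\sum_\lambda\pi_\lambda(\mathrm{pf})\,(w(\rho;\lambda)-1)\big(p^\rho_\lambda(\xi)^*p^\rho_\lambda(\eta)+p^\rho_\lambda(\eta)^*p^\rho_\lambda(\xi)\big)=0.$$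
   Context: Let $n\ge2$, $m=[n/2]$, $\{e_i\}$ the standard basis of $\mathbb R^n$. $\mathfrak{so}(n)$ is spanned by $e_{ij}:=e_i\wedge e_j$ acting by $e_{ij}(u)=\langle e_i,u\rangle e_j-\langle e_j,u\rangle e_i$. Cartan subalgebra: span of $e_{2i-1,2i}$, $1\le i\le m$; $\{\mu_i\}$ is the basis of weights with $\mu_i(-\sqrt{-1}\,e_{2j-1,2j})=\delta_{ij}$, made orthonormal by $\langle\mu_i,\mu_j\rangle=\delta_{ij}$. Weights are written $\rho=(\rho^1,\dots,\rho^m)=\sum\rho^i\mu_i\in\mathbb Z^m\cup(\mathbb Z+1/2)^m$; highest weights are taken in lexicographic order and are the $\rho$ with $\rho^1\ge\dots\ge\rho^{m-1}\ge|\rho^m|$ ($n=2m$), resp. $\rho^1\ge\dots\ge\rho^m\ge0$ ($n=2m+1$). $(\pi_\rho,V_\rho)$ is the irreducible unitary representation with highest weight $\rho$, extended to $U(\mathfrak{so}(n,\mathbb C))$. Central elements act by scalars, and $\pi_\rho(z)$ also denotes that scalar. $\delta=(m-1,\dots,1,0)$ for $n=2m$ and $\delta=(m-\frac12,\dots,\frac32,\frac12)$ for $n=2m+1$. $\mathbb C^n=V_{\mu_1}$ is the natural representation. $V_\rho\otimes\mathbb C^n=\bigoplus_\lambda V_\lambda$ is multiplicity free and orthogonal for the tensor inner product (each $V_\lambda$ has the induced inner product); $\Pi^\rho_\lambda$ is the orthogonal projection onto $V_\lambda$. The Clifford homomorphism is $p^\rho_\lambda(\xi):V_\rho\to V_\lambda$,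 $p^\rho_\lambda(\xi)\phi:=\Pi^\rho_\lambda(\phi\otimes\xi)$ for $\xi\in\mathbb C^n$, with adjoint $p^\rho_\lambda(\xi)^*:V_\lambda\to V_\rho$. Conformal weight: $w(\rho;\lambda):=\frac12(\langle\delta+\lambda,\delta+\lambda\rangle-\langle\delta+\rho,\delta+\rho\rangle-n+1)$, and $\hat w(\rho;\lambda):=w(\rho;\lambda)+\frac{n-1}2$. In $U(\mathfrak{so}(n,\mathbb C))$: $\hat e_{ij}:=e_{ij}+\frac{n-1}{2}\delta_{ij}$, $\hat e_{ij}^0:=\delta_{ij}$, $\hat e_{ij}^q:=\sum_{i_1,\dots,i_{q-1}}\hat e_{ii_1}\hat e_{i_1i_2}\cdots\hat e_{i_{q-1}j}$ for $q\ge1$, and $\hat c_q:=\sum_i\hat e_{ii}^q$ (central). For $n=2m$ the Pfaffian element is the central element $\mathrm{pf}:=\frac{1}{(\sqrt{-1})^m2^mm!}\sum_{\sigma\in\mathfrak S_{2m}}\mathrm{sgn}(\sigma)e_{\sigma(1)\sigma(2)}\cdots e_{\sigma(2m-1)\sigma(2m)}$; it acts on $V_\rho$ by the scalar $\pi_\rho(\mathrm{pf})=(\rho^1+m-1)(\rho^2+m-2)\cdots(\rho^{m-1}+1)\rho^m$. *)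

theory Defs
  imports "Jordan_Normal_Form.Schur_Decomposition" "HOL-Combinatorics.Permutations"
begin

text \<open>
  Conventions.  Indices are 0-based: the basis vector written \<open>e\<^sub>i\<close> with \<open>1 \<le> i \<le> n\<close> is
  \<open>unit_vec n (i - 1)\<close> here.  A finite-dimensional Hermitian space is presented in an orthonormal
  basis, i.e. as \<open>carrier_vec d\<close> with the inner product \<open>v \<bullet>c w\<close> (conjugate linear in \<open>w\<close>); operators
  are matrices.

  A unitary representation of \<open>SO(n)\<close> or \<open>Spin(n)\<close> enters through its differential, a representation
  of \<open>so(n)\<close> by skew-Hermitian matrices.  The irreducible representations of \<open>so(n)\<close> obtained in this
  way are exactly those whose highest weight lies in the lattice union in \<open>spin_highest_weight\<close> below
  (for \<open>n = 2\<close> this integrality is a genuine condition).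
\<close>

subsection \<open>Sums and tensor products of matrices\<close>

abbreviation msum :: "nat \<Rightarrow> nat \<Rightarrow> ('i \<Rightarrow> complex mat) \<Rightarrow> 'i set \<Rightarrow> complex mat" where
  "msum r c \<equiv> finsum (module_mat TYPE(complex) r c)"

text \<open>The vector \<open>e\<^sub>i \<otimes> e\<^sub>j\<close> of \<open>\<complex>\<^sup>a \<otimes> \<complex>\<^sup>b\<close> is the standard basis vector of \<open>\<complex>\<^sup>a\<^sup>b\<close> with index
  \<open>i * b + j\<close>, so the tensor inner product is the standard one on \<open>\<complex>\<^sup>a\<^sup>b\<close>.\<close>

definition tensor_vec :: "complex vec \<Rightarrow> complex vec \<Rightarrow> complex vec" where
  "tensor_vec v w = vec (dim_vec v * dim_vec w)
     (\<lambda>k. v $ (k div dim_vec w) * w $ (k mod dim_vec w))"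

definition tensor_mat :: "complex mat \<Rightarrow> complex mat \<Rightarrow> complex mat" where
  "tensor_mat A B = mat (dim_row A * dim_row B) (dim_col A * dim_col B)
     (\<lambda>(k, l). A $$ (k div dim_row B, l div dim_col B) * B $$ (k mod dim_row B, l mod dim_col B))"

lemma sum_div_mod:
  fixes f :: "nat \<Rightarrow> nat \<Rightarrow> 'a :: comm_monoid_add"
  shows "(\<Sum>k = 0..<a * b. f (k div b) (k mod b)) = (\<Sum>i = 0..<a. \<Sum>j = 0..<b. f i j)"
proof (induction a)
  case 0
  then show ?case by simp
next
  case (Suc a)
  have "(\<Sum>k = 0..<Suc a * b. f (k div b) (k mod b))
      = (\<Sum>k = 0..<a * b. f (k div b) (k mod b)) + (\<Sum>k = a * b..<a * b + b. f (k div b) (k mod b))"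
    by (subst sum.atLeastLessThan_concat) (auto simp: add.commute)
  also have "(\<Sum>k = a * b..<a * b + b. f (k div b) (k mod b))
      = (\<Sum>j = 0..<b. f ((a * b + j) div b) ((a * b + j) mod b))"
    using sum.shift_bounds_nat_ivl[of "\<lambda>k. f (k div b) (k mod b)" 0 "a * b" b]
    by (simp add: add.commute)
  also have "\<dots> = (\<Sum>j = 0..<b. f a j)"
    by (rule sum.cong) auto
  finally show ?case using Suc.IH by simp
qed

lemma tensor_mat_mult_tensor_vec:
  assumes "v \<in> carrier_vec (dim_col A)" and "w \<in> carrier_vec (dim_col B)"
  shows "tensor_mat A B *\<^sub>v tensor_vec v w = tensor_vec (A *\<^sub>v v) (B *\<^sub>v w)" (is "?l = ?r")
proof (rule eq_vecI)
  show "dim_vec ?l = dim_vec ?r"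
    by (simp add: tensor_mat_def tensor_vec_def)
  fix k assume "k < dim_vec ?r"
  then have k: "k < dim_row A * dim_row B"
    by (simp add: tensor_vec_def)
  then have pos: "0 < dim_row B" by (cases "dim_row B") auto
  have kd: "k div dim_row B < dim_row A" "k mod dim_row B < dim_row B"
    using k pos by (auto simp: less_mult_imp_div_less)
  have "?l $ k = (\<Sum>l = 0..<dim_col A * dim_col B.
      (A $$ (k div dim_row B, l div dim_col B) * B $$ (k mod dim_row B, l mod dim_col B))
        * (v $ (l div dim_col B) * w $ (l mod dim_col B)))"
    using k assms by (simp add: tensor_mat_def tensor_vec_def scalar_prod_def)
  also have "\<dots> = (\<Sum>i = 0..<dim_col A. \<Sum>j = 0..<dim_col B.
      (A $$ (k div dim_row B, i) * B $$ (k mod dim_row B, j)) * (v $ i * w $ j))"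
    by (rule sum_div_mod)
  also have "\<dots> = (\<Sum>i = 0..<dim_col A. A $$ (k div dim_row B, i) * v $ i)
      * (\<Sum>j = 0..<dim_col B. B $$ (k mod dim_row B, j) * w $ j)"
    by (simp add: sum_product mult.assoc mult.left_commute)
  also have "\<dots> = ?r $ k"
    using k kd assms by (simp add: tensor_vec_def scalar_prod_def)
  finally show "?l $ k = ?r $ k" .
qed

subsection \<open>Representations of \<open>so(n)\<close>\<close>

definition so :: "nat \<Rightarrow> real mat set" where
  "so n = {X \<in> carrier_mat n n. transpose_mat X = - X}"

text \<open>\<open>e\<^sub>i \<and> e\<^sub>j\<close>, as the endomorphism \<open>u \<mapsto> \<langle>e\<^sub>i, u\<rangle> e\<^sub>j - \<langle>e\<^sub>j, u\<rangle> e\<^sub>i\<close>.\<close>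

definition so_basis :: "nat \<Rightarrow> nat \<Rightarrow> nat \<Rightarrow> real mat" where
  "so_basis n i j = mat n n (\<lambda>(k, l). (if l = i \<and> k = j then 1 else 0)
                                     - (if l = j \<and> k = i then 1 else 0))"

lemma so_basis_in_so: "so_basis n i j \<in> so n"
proof -
  have C: "so_basis n i j \<in> carrier_mat n n" by (simp add: so_basis_def)
  have "transpose_mat (so_basis n i j) = - so_basis n i j"
  proof (rule eq_matI)
    fix k l assume "k < dim_row (- so_basis n i j)" "l < dim_col (- so_basis n i j)"
    then have kl: "k < n" "l < n" using C by simp_all
    then have "transpose_mat (so_basis n i j) $$ (k, l) = so_basis n i j $$ (l, k)"
      and "(- so_basis n i j) $$ (k, l) = - so_basis n i j $$ (k, l)"
      using C by simp_all
    then show "transpose_mat (so_basis n i j) $$ (k, l) = (- so_basis n i j) $$ (k, l)"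
      using kl by (simp only: so_basis_def index_mat prod.case minus_diff_eq conj_commute)
  qed (use C in simp_all)
  then show ?thesis using C by (simp add: so_def)
qed

lemma so_basis_mult_vec:
  assumes i: "i < n" and j: "j < n" and u: "u \<in> carrier_vec n"
  shows "so_basis n i j *\<^sub>v u
    = (unit_vec n i \<bullet> u) \<cdot>\<^sub>v unit_vec n j - (unit_vec n j \<bullet> u) \<cdot>\<^sub>v unit_vec n i" (is "?l = ?r")
proof (rule eq_vecI)
  have C: "so_basis n i j \<in> carrier_mat n n" by (simp add: so_basis_def)
  show "dim_vec ?l = dim_vec ?r" using C by simp
  fix k assume "k < dim_vec ?r"
  then have k: "k < n" by simp
  have "?l $ k = (\<Sum>l = 0..<n. so_basis n i j $$ (k, l) * u $ l)"
    using C k u by (simp add: scalar_prod_def)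
  also have "\<dots> = (\<Sum>l = 0..<n. (if l = i then (if k = j then u $ l else 0) else 0)
                              - (if l = j then (if k = i then u $ l else 0) else 0))"
  proof (rule sum.cong)
    fix l assume "l \<in> {0..<n}"
    then have "so_basis n i j $$ (k, l) = (if l = i \<and> k = j then 1 else 0) - (if l = j \<and> k = i then 1 else 0)"
      using k by (simp only: so_basis_def index_mat prod.case atLeastLessThan_iff)
    then show "so_basis n i j $$ (k, l) * u $ l = (if l = i then (if k = j then u $ l else 0) else 0)
                              - (if l = j then (if k = i then u $ l else 0) else 0)"
      by (cases "l = i"; cases "k = j"; cases "l = j"; cases "k = i") (simp_all only: if_True if_False simp_thms diff_self diff_0 diff_0_right mult_zero_left mult_1 mult_minus_left)
  qed simp
  also have "\<dots> = (if k = j then u $ i else 0) - (if k = i then u $ j else 0)"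
    using i j by (simp only: sum_subtractf sum.delta finite_atLeastLessThan atLeastLessThan_iff le0 simp_thms if_True)
  also have "\<dots> = ?r $ k"
    using k i j u by simp
  finally show "?l $ k = ?r $ k" .
qed

definition unitary_so_rep :: "nat \<Rightarrow> nat \<Rightarrow> (real mat \<Rightarrow> complex mat) \<Rightarrow> bool" where
  "unitary_so_rep n d \<pi> \<longleftrightarrow>
     (\<forall>X \<in> so n. \<pi> X \<in> carrier_mat d d) \<and>
     (\<forall>X \<in> so n. \<forall>Y \<in> so n. \<pi> (X + Y) = \<pi> X + \<pi> Y) \<and>
     (\<forall>r. \<forall>X \<in> so n. \<pi> (r \<cdot>\<^sub>m X) = complex_of_real r \<cdot>\<^sub>m \<pi> X) \<and>
     (\<forall>X \<in> so n. \<forall>Y \<in> so n. \<pi> (X * Y - Y * X) = \<pi> X * \<pi> Y - \<pi> Y * \<pi> X) \<and>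
     (\<forall>X \<in> so n. mat_adjoint (\<pi> X) = - \<pi> X)"

definition so_invariant :: "nat \<Rightarrow> nat \<Rightarrow> (real mat \<Rightarrow> complex mat) \<Rightarrow> complex vec set \<Rightarrow> bool" where
  "so_invariant n N \<pi> W \<longleftrightarrow>
     VectorSpace.subspace class_ring W (module_vec TYPE(complex) N) \<and>
     (\<forall>X \<in> so n. \<forall>v \<in> W. \<pi> X *\<^sub>v v \<in> W)"

definition so_irreducible :: "nat \<Rightarrow> nat \<Rightarrow> (real mat \<Rightarrow> complex mat) \<Rightarrow> complex vec set \<Rightarrow> bool" where
  "so_irreducible n N \<pi> W \<longleftrightarrow>
     so_invariant n N \<pi> W \<and> W \<noteq> {0\<^sub>v N} \<and>
     (\<forall>U. so_invariant n N \<pi> U \<and> U \<subseteq> W \<longrightarrow> U = {0\<^sub>v N} \<or> U = W)"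

text \<open>The tuple \<open>\<mu>\<close> stands for \<open>\<Sum>\<^sub>j \<mu>\<^sup>j \<mu>\<^sub>j\<close>, where \<open>\<mu>\<^sub>j\<close> is dual to
  \<open>-\<surd>-1 e\<^bsub>2j-1,2j\<^esub>\<close> (1-based).\<close>

definition so_weights :: "nat \<Rightarrow> nat \<Rightarrow> (real mat \<Rightarrow> complex mat) \<Rightarrow> complex vec set \<Rightarrow> real vec set" where
  "so_weights n N \<pi> W = {\<mu> \<in> carrier_vec (n div 2). \<exists>v \<in> W. v \<noteq> 0\<^sub>v N \<and>
     (\<forall>j < n div 2. ((- \<i>) \<cdot>\<^sub>m \<pi> (so_basis n (2 * j) (2 * j + 1))) *\<^sub>v v
                      = complex_of_real (\<mu> $ j) \<cdot>\<^sub>v v)}"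

definition so_highest_weight ::
    "nat \<Rightarrow> nat \<Rightarrow> (real mat \<Rightarrow> complex mat) \<Rightarrow> complex vec set \<Rightarrow> real vec \<Rightarrow> bool" where
  "so_highest_weight n N \<pi> W \<nu> \<longleftrightarrow>
     \<nu> \<in> so_weights n N \<pi> W \<and>
     (\<forall>\<mu> \<in> so_weights n N \<pi> W.
        \<mu> = \<nu> \<or> (list_of_vec \<mu>, list_of_vec \<nu>) \<in> lexord {(x, y). x < y})"

definition spin_highest_weight :: "nat \<Rightarrow> real vec \<Rightarrow> bool" where
  "spin_highest_weight n \<rho> \<longleftrightarrow> (let m = n div 2 in
     \<rho> \<in> carrier_vec m \<and>
     ((\<forall>i < m. \<rho> $ i \<in> \<int>) \<or> (\<forall>i < m. \<rho> $ i - 1 / 2 \<in> \<int>)) \<and>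
     (if even n
      then (\<forall>i. i + 2 < m \<longrightarrow> \<rho> $ (i + 1) \<le> \<rho> $ i) \<and> (2 \<le> m \<longrightarrow> \<bar>\<rho> $ (m - 1)\<bar> \<le> \<rho> $ (m - 2))
      else (\<forall>i. i + 1 < m \<longrightarrow> \<rho> $ (i + 1) \<le> \<rho> $ i) \<and> 0 \<le> \<rho> $ (m - 1)))"

definition tensor_rep :: "nat \<Rightarrow> nat \<Rightarrow> (real mat \<Rightarrow> complex mat) \<Rightarrow> real mat \<Rightarrow> complex mat" where
  "tensor_rep n d \<pi> X =
     tensor_mat (\<pi> X) (1\<^sub>m n) + tensor_mat (1\<^sub>m d) (map_mat complex_of_real X)"

text \<open>The summands are indexed by their highest weights, i.e. the decomposition is multiplicity
  free.\<close>

definition irreducible_decomposition ::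
    "nat \<Rightarrow> nat \<Rightarrow> (real mat \<Rightarrow> complex mat) \<Rightarrow> real vec set \<Rightarrow> (real vec \<Rightarrow> complex vec set) \<Rightarrow> bool" where
  "irreducible_decomposition n N \<pi> L W \<longleftrightarrow>
     finite L \<and>
     (\<forall>\<nu> \<in> L. so_irreducible n N \<pi> (W \<nu>) \<and> so_highest_weight n N \<pi> (W \<nu>) \<nu>) \<and>
     (\<forall>\<mu> \<in> L. \<forall>\<nu> \<in> L. \<mu> \<noteq> \<nu> \<longrightarrow> (\<forall>v \<in> W \<mu>. \<forall>w \<in> W \<nu>. v \<bullet>c w = 0)) \<and>
     carrier_vec N = {finsum_vec TYPE(complex) N w L | w. \<forall>\<nu> \<in> L. w \<nu> \<in> W \<nu>}"

subsection \<open>Clifford homomorphisms\<close>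

definition orth_proj :: "nat \<Rightarrow> complex vec set \<Rightarrow> complex mat" where
  "orth_proj N W = (THE P. P \<in> carrier_mat N N \<and>
     (\<forall>v \<in> carrier_vec N. P *\<^sub>v v \<in> W \<and> (\<forall>w \<in> W. (v - P *\<^sub>v v) \<bullet>c w = 0)))"

text \<open>\<open>p(\<xi>)\<close>, written as a map into the whole of \<open>V \<otimes> \<complex>\<^sup>n\<close>.  As its image lies in \<open>W\<close>, the matrix
  \<open>mat_adjoint (p(\<xi>))\<close> restricted to \<open>W\<close> is the adjoint of \<open>p(\<xi>) : V \<rightarrow> W\<close>.\<close>

definition clifford_hom :: "nat \<Rightarrow> nat \<Rightarrow> complex vec set \<Rightarrow> complex vec \<Rightarrow> complex mat" where
  "clifford_hom n d W \<xi> =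
     orth_proj (d * n) W * mat_of_cols (d * n) (map (\<lambda>j. tensor_vec (unit_vec d j) \<xi>) [0..<d])"

lemma clifford_hom_mult_vec:
  assumes "orth_proj (d * n) W \<in> carrier_mat (d * n) (d * n)"
    and "\<xi> \<in> carrier_vec n" and "\<phi> \<in> carrier_vec d"
  shows "clifford_hom n d W \<xi> *\<^sub>v \<phi> = orth_proj (d * n) W *\<^sub>v tensor_vec \<phi> \<xi>"
proof -
  let ?M = "mat_of_cols (d * n) (map (\<lambda>j. tensor_vec (unit_vec d j) \<xi>) [0..<d])"
  have M: "?M \<in> carrier_mat (d * n) d" by (rule carrier_matI) auto
  have "?M *\<^sub>v \<phi> = tensor_vec \<phi> \<xi>"
  proof (rule eq_vecI)
    fix k assume "k < dim_vec (tensor_vec \<phi> \<xi>)"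
    then have k: "k < d * n" using assms by (simp add: tensor_vec_def)
    then have kd: "k div n < d" by (simp add: less_mult_imp_div_less)
    have "(?M *\<^sub>v \<phi>) $ k
        = (\<Sum>j = 0..<d. (if k div n = j then 1 else 0) * \<xi> $ (k mod n) * \<phi> $ j)"
      using k kd assms
      by (simp add: scalar_prod_def tensor_vec_def mat_of_cols_index unit_vec_def)
    also have "\<dots> = (\<Sum>j = 0..<d. (if k div n = j then \<phi> $ j * \<xi> $ (k mod n) else 0))"
      by (rule sum.cong) simp_all
    also have "\<dots> = tensor_vec \<phi> \<xi> $ k"
      using k kd assms by (simp add: tensor_vec_def sum.delta')
    finally show "(?M *\<^sub>v \<phi>) $ k = tensor_vec \<phi> \<xi> $ k" .
  qed (use assms in \<open>simp add: tensor_vec_def\<close>)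
  then show ?thesis
    unfolding clifford_hom_def using assoc_mult_mat_vec[OF assms(1) M assms(3)] by simp
qed

definition clifford_sym :: "nat \<Rightarrow> nat \<Rightarrow> complex vec set \<Rightarrow> real vec \<Rightarrow> real vec \<Rightarrow> complex mat" where
  "clifford_sym n d W \<xi> \<eta> =
     (let p = (\<lambda>\<zeta>. clifford_hom n d W (map_vec complex_of_real \<zeta>))
      in mat_adjoint (p \<xi>) * p \<eta> + mat_adjoint (p \<eta>) * p \<xi>)"

definition so_delta :: "nat \<Rightarrow> real vec" where
  "so_delta n = vec (n div 2)
     (\<lambda>i. if even n then real (n div 2) - 1 - real i else real (n div 2) - 1 / 2 - real i)"

definition conf_weight :: "nat \<Rightarrow> real vec \<Rightarrow> real vec \<Rightarrow> real" where
  "conf_weight n \<rho> \<nu> = 1 / 2 * ((so_delta n + \<nu>) \<bullet> (so_delta n + \<nu>)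
                            - (so_delta n + \<rho>) \<bullet> (so_delta n + \<rho>) - real n + 1)"

definition conf_weight_hat :: "nat \<Rightarrow> real vec \<Rightarrow> real vec \<Rightarrow> real" where
  "conf_weight_hat n \<rho> \<nu> = conf_weight n \<rho> \<nu> + (real n - 1) / 2"

subsection \<open>Central elements of the enveloping algebra\<close>

text \<open>For an element \<open>z\<close> of the enveloping algebra only its image \<open>\<pi>(z)\<close> under a representation \<open>\<pi>\<close>
  on \<open>\<complex>\<^sup>N\<close> is needed; these images are written out below.\<close>

definition e_hat :: "nat \<Rightarrow> nat \<Rightarrow> (real mat \<Rightarrow> complex mat) \<Rightarrow> nat \<Rightarrow> nat \<Rightarrow> complex mat" where
  "e_hat n N \<pi> i j =
     \<pi> (so_basis n i j) + (if i = j then (of_nat n - 1) / 2 else 0) \<cdot>\<^sub>m 1\<^sub>m N"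

primrec e_hat_pow ::
    "nat \<Rightarrow> nat \<Rightarrow> (real mat \<Rightarrow> complex mat) \<Rightarrow> nat \<Rightarrow> nat \<Rightarrow> nat \<Rightarrow> complex mat" where
  "e_hat_pow n N \<pi> 0 i j = (if i = j then 1 else 0) \<cdot>\<^sub>m 1\<^sub>m N"
| "e_hat_pow n N \<pi> (Suc q) i j = msum N N (\<lambda>k. e_hat n N \<pi> i k * e_hat_pow n N \<pi> q k j) {0..<n}"

definition c_hat :: "nat \<Rightarrow> nat \<Rightarrow> (real mat \<Rightarrow> complex mat) \<Rightarrow> nat \<Rightarrow> complex mat" where
  "c_hat n N \<pi> q = msum N N (\<lambda>i. e_hat_pow n N \<pi> q i i) {0..<n}"

text \<open>Intended for \<open>n = 2 m\<close>.\<close>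

definition pf :: "nat \<Rightarrow> nat \<Rightarrow> (real mat \<Rightarrow> complex mat) \<Rightarrow> complex mat" where
  "pf n N \<pi> = (let m = n div 2 in
     (1 / (\<i> ^ m * 2 ^ m * fact m)) \<cdot>\<^sub>m
       msum N N (\<lambda>\<sigma>. of_int (sign \<sigma>) \<cdot>\<^sub>m
           foldr (*) (map (\<lambda>k. \<pi> (so_basis n (\<sigma> (2 * k)) (\<sigma> (2 * k + 1)))) [0..<m]) (1\<^sub>m N))
         {\<sigma>. \<sigma> permutes {0..<n}})"

text \<open>The scalar by which an operator acts on \<open>W\<close> (meaningful if it does act by a scalar).\<close>

definition scalar_on :: "complex vec set \<Rightarrow> complex mat \<Rightarrow> complex" where
  "scalar_on W A = (THE c. \<forall>v \<in> W. A *\<^sub>v v = c \<cdot>\<^sub>v v)"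

end

theory Submission
  imports Defs
begin

text \<open>Write \<open>e\<^sub>i\<^sub>j\<close> for the image of \<open>e\<^sub>i \<and> e\<^sub>j\<close> under \<open>\<pi>\<close>.  An operator \<open>M\<close> on \<open>V \<otimes> \<complex>\<^sup>n\<close> is an \<open>n \<times> n\<close> matrix of
  operators \<open>M\<^sub>i\<^sub>j\<close> on \<open>V\<close>.  If \<open>M\<close> acts on every summand \<open>W\<^sub>\<nu>\<close> as a scalar \<open>f \<nu>\<close>, then \<open>M\<close> is the sum of
  the \<open>f \<nu> \<cdot> \<Pi>\<^sub>\<nu>\<close>, and since \<open>p\<^sub>\<nu>(\<xi>)\<^sup>* p\<^sub>\<nu>(\<eta>)\<close> is the form \<open>\<Sum> \<xi>\<^sub>i \<eta>\<^sub>j (\<Pi>\<^sub>\<nu>)\<^sub>i\<^sub>j\<close>, the sum over \<open>\<nu>\<close> of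
  \<open>f \<nu> \<cdot> (p\<^sub>\<nu>(\<xi>)\<^sup>* p\<^sub>\<nu>(\<eta>) + p\<^sub>\<nu>(\<eta>)\<^sup>* p\<^sub>\<nu>(\<xi>))\<close> equals \<open>\<Sum> \<xi>\<^sub>i \<eta>\<^sub>j (M\<^sub>i\<^sub>j + M\<^sub>j\<^sub>i)\<close>; this is \<open>clifford_sym_sum\<close>.
  Each of the four relations is therefore a statement about the symmetrised blocks of one suitable
  \<open>M\<close>.  The first is the case \<open>M = 1\<close>.

  For the second, the matrix \<open>B = (e\<^sub>i\<^sub>j)\<close> is the mixed term in the Casimir operator of \<open>V \<otimes> \<complex>\<^sup>n\<close>, which
  acts on \<open>W\<^sub>\<nu>\<close> by a scalar computed on a highest weight vector; hence \<open>B\<close> acts on \<open>W\<^sub>\<nu>\<close> as the conformal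
  weight (\<open>symbol_gen\<close>), and the powers of \<open>e\<^sub>i\<^sub>j\<close> shifted by \<open>(n - 1) / 2\<close> act as the powers of the
  shifted weight.  Commuting one factor past a power \<open>E\<^sup>q\<close> of the shifted matrix \<open>E\<close> gives
  \<open>(E\<^sup>q\<^sup>+\<^sup>1)\<^sup>t = - (E\<^sup>q)\<^sup>t E + tr E\<^sup>q - E\<^sup>q\<close>.  Iterating this \<open>2 q\<close> times, the terms \<open>\<plusminus> E\<^sup>2\<^sup>q\<^sup>-\<^sup>1\<close> cancel in
  pairs and the alternating sum of the second relation turns out to be \<open>(E\<^sup>2\<^sup>q)\<^sup>t - E\<^sup>2\<^sup>q\<close>, which is
  antisymmetric (\<open>ehat_pow_alternating_antisym\<close>).

  For the last two relations \<open>M\<close> is the Pfaffian of \<open>V \<otimes> \<complex>\<^sup>n\<close>, and the Pfaffian times \<open>B - 1\<close>.  Products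
  of two wedges with disjoint indices vanish on \<open>\<complex>\<^sup>n\<close>, so the blocks of the Pfaffian are
  \<open>pf \<cdot> \<delta>\<^sub>i\<^sub>j + D\<^sub>i\<^sub>j\<close>, where \<open>D\<close> is an antisymmetric matrix of sub-Pfaffians (\<open>pf_block_expand\<close>).
  Expanding along a row gives \<open>D B = pf - (m - 1) D\<close>; the first term is the classical expansion, the
  second one is the price for exchanging two entries of a row.  Both relations follow by
  symmetrising.

  The central elements act by scalars by Schur's lemma.  As the \<open>d \<times> d\<close> matrices form a ring only
  once \<open>d\<close> is fixed, the algebraic identities are proved for elements of an arbitrary real algebra
  and applied to the algebra of linear operators on sequences, into which the sequences of length
  \<open>d\<close> embed as an invariant subspace.\<close>

section \<open>Powers of the generator matrix\<close>

text \<open>The defining relations of the images of \<open>e\<^sub>i \<and> e\<^sub>j\<close> in an associative algebra.\<close>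

locale so_family =
  fixes n :: nat and e :: "nat \<Rightarrow> nat \<Rightarrow> 'r :: real_algebra_1"
  assumes anti: "\<lbrakk>i < n; j < n\<rbrakk> \<Longrightarrow> e j i = - e i j"
    and comm: "\<lbrakk>i < n; j < n; k < n; l < n\<rbrakk> \<Longrightarrow> e i j * e k l - e k l * e i j =
      (if i = k then e j l else 0) - (if j = k then e i l else 0)
      + (if i = l then e k j else 0) - (if j = l then e k i else 0)"
begin

text \<open>The entries of \<open>M\<close> transform under the bracket with \<open>e\<^sub>i\<^sub>j\<close> like the tensors \<open>e\<^sub>k \<otimes> e\<^sub>l\<close>.\<close>

definition equivariant :: "(nat \<Rightarrow> nat \<Rightarrow> 'r) \<Rightarrow> bool" where
  "equivariant M \<longleftrightarrow> (\<forall>i<n. \<forall>j<n. \<forall>k<n. \<forall>l<n. e i j * M k l - M k l * e i j =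
      (if i = k then M j l else 0) - (if j = k then M i l else 0)
      + (if i = l then M k j else 0) - (if j = l then M k i else 0))"

definition ehat :: "nat \<Rightarrow> nat \<Rightarrow> 'r" where
  "ehat i j = e i j + (if i = j then of_real ((real n - 1) / 2) else 0)"

primrec ehat_pow :: "nat \<Rightarrow> nat \<Rightarrow> nat \<Rightarrow> 'r" where
  "ehat_pow 0 i j = (if i = j then 1 else 0)"
| "ehat_pow (Suc q) i j = (\<Sum>k=0..<n. ehat i k * ehat_pow q k j)"

definition ehat_trace :: "nat \<Rightarrow> 'r" where
  "ehat_trace q = (\<Sum>i=0..<n. ehat_pow q i i)"

lemma equivariantD:
  "\<lbrakk>equivariant M; i < n; j < n; k < n; l < n\<rbrakk> \<Longrightarrow> e i j * M k l = M k l * e i j +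
      ((if i = k then M j l else 0) - (if j = k then M i l else 0)
      + (if i = l then M k j else 0) - (if j = l then M k i else 0))"
  unfolding equivariant_def by (metis add_diff_cancel_left' diff_add_cancel add.commute)

lemma equivariant_scalar: "equivariant (\<lambda>i j. if i = j then of_real c else 0)"
  unfolding equivariant_def by (auto simp: of_real_def)

lemma equivariant_e: "equivariant e"
  unfolding equivariant_def using comm by blast

lemma equivariant_add:
  assumes "equivariant M" "equivariant N" shows "equivariant (\<lambda>i j. M i j + N i j)"
  unfolding equivariant_def
  by (auto simp: algebra_simps equivariantD[OF assms(1)] equivariantD[OF assms(2)])

lemma equivariant_ehat: "equivariant ehat"
  using equivariant_add[OF equivariant_e equivariant_scalar] by (simp add: ehat_def[abs_def])

text \<open>The bracket is a derivation; the terms in which it hits the contracted index cancel, because the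
  contraction is invariant under rotations.\<close>

lemma equivariant_mult:
  assumes M: "equivariant M" and N: "equivariant N"
  shows "equivariant (\<lambda>i j. \<Sum>k=0..<n. M i k * N k j)"
  unfolding equivariant_def
proof (intro allI impI)
  fix i j k l assume b: "i < n" "j < n" "k < n" "l < n"
  have s: "e i j * (M k s * N s l) = M k s * N s l * e i j
      + ((if i = k then M j s * N s l else 0) - (if j = k then M i s * N s l else 0)
         + (if i = s then M k j * N s l else 0) - (if j = s then M k i * N s l else 0)
         + (if i = s then M k s * N j l else 0) - (if j = s then M k s * N i l else 0)
         + (if i = l then M k s * N s j else 0) - (if j = l then M k s * N s i else 0))"
    if "s \<in> {0..<n}" for s
  proof -
    have s: "s < n" using that by simp
    have "e i j * (M k s * N s l) = (e i j * M k s) * N s l" by (simp add: mult.assoc)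
    also have "\<dots> = M k s * (e i j * N s l) + ((if i = k then M j s else 0) - (if j = k then M i s else 0)
      + (if i = s then M k j else 0) - (if j = s then M k i else 0)) * N s l"
      unfolding equivariantD[OF M b(1-3) s] by (simp add: algebra_simps)
    also have "\<dots> = M k s * N s l * e i j
      + ((if i = k then M j s * N s l else 0) - (if j = k then M i s * N s l else 0)
         + (if i = s then M k j * N s l else 0) - (if j = s then M k i * N s l else 0)
         + (if i = s then M k s * N j l else 0) - (if j = s then M k s * N i l else 0)
         + (if i = l then M k s * N s j else 0) - (if j = l then M k s * N s i else 0))"
      unfolding equivariantD[OF N b(1,2) s b(4)] by (simp add: algebra_simps)
    finally show ?thesis .
  qed
  have d: "(\<Sum>s=0..<n. if a = s then F s else 0) = F a" if "a < n" for a and F :: "nat \<Rightarrow> 'r"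
    using that by (simp add: sum.delta)
  have c: "(\<Sum>s=0..<n. if P then F s else 0) = (if P then \<Sum>s=0..<n. F s else 0)" for P and F :: "nat \<Rightarrow> 'r"
    by simp
  have "e i j * (\<Sum>s=0..<n. M k s * N s l) - (\<Sum>s=0..<n. M k s * N s l) * e i j
      = (\<Sum>s=0..<n. e i j * (M k s * N s l)) - (\<Sum>s=0..<n. M k s * N s l) * e i j"
    by (simp add: sum_distrib_left)
  also have "(\<Sum>s=0..<n. e i j * (M k s * N s l)) = (\<Sum>s=0..<n. M k s * N s l * e i j
      + ((if i = k then M j s * N s l else 0) - (if j = k then M i s * N s l else 0)
         + (if i = s then M k j * N s l else 0) - (if j = s then M k i * N s l else 0)
         + (if i = s then M k s * N j l else 0) - (if j = s then M k s * N i l else 0)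
         + (if i = l then M k s * N s j else 0) - (if j = l then M k s * N s i else 0)))"
    by (rule sum.cong[OF refl s])
  also have "\<dots> - (\<Sum>s=0..<n. M k s * N s l) * e i j =
    (if i = k then (\<Sum>s=0..<n. M j s * N s l) else 0)
    - (if j = k then (\<Sum>s=0..<n. M i s * N s l) else 0)
      + (if i = l then (\<Sum>s=0..<n. M k s * N s j) else 0) - (if j = l then (\<Sum>s=0..<n. M k s * N s i) else 0)"
    unfolding sum.distrib sum_subtractf d[OF b(1)] d[OF b(2)] c sum_distrib_right[symmetric]
    by simp
  finally show "e i j * (\<Sum>s=0..<n. M k s * N s l) - (\<Sum>s=0..<n. M k s * N s l) * e i j = \<dots>" .
qed

lemma equivariant_ehat_pow: "equivariant (ehat_pow q)"
proof (induction q)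
  case 0
  show ?case using equivariant_scalar[of 1] by (simp add: equivariant_def)
next
  case (Suc q)
  show ?case using equivariant_mult[OF equivariant_ehat Suc] by (simp add: equivariant_def)
qed

lemma trace_central:
  assumes M: "equivariant M" and b: "i < n" "j < n"
  shows "e i j * (\<Sum>k=0..<n. M k k) = (\<Sum>k=0..<n. M k k) * e i j"
proof -
  have "e i j * (\<Sum>k=0..<n. M k k) = (\<Sum>k=0..<n. e i j * M k k)"
    by (rule sum_distrib_left)
  also have "\<dots> = (\<Sum>k=0..<n. M k k * e i j + ((if i = k then M j k else 0) - (if j = k then M i k else 0)
      + (if i = k then M k j else 0) - (if j = k then M k i else 0)))"
    by (rule sum.cong[OF refl], rule equivariantD[OF M b]) auto
  also have "\<dots> = (\<Sum>k=0..<n. M k k) * e i j"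
    using b by (simp add: sum.distrib sum_subtractf sum_distrib_right)
  finally show ?thesis .
qed

lemma ehat_trace_central: "\<lbrakk>i < n; j < n\<rbrakk> \<Longrightarrow> e i j * ehat_trace q = ehat_trace q * e i j"
  unfolding ehat_trace_def by (rule trace_central[OF equivariant_ehat_pow])

lemma e_diag: "i < n \<Longrightarrow> e i i = 0"
proof -
  assume "i < n"
  then have "e i i = - e i i" by (intro anti)
  then have "e i i + e i i = 0" by (metis add.right_inverse)
  then have "2 *\<^sub>R e i i = 0" by (simp only: scaleR_2)
  then show ?thesis by simp
qed

text \<open>The sum of the brackets of \<open>e\<^sub>j\<^sub>k\<close> with \<open>M\<^sub>k\<^sub>i\<close> over \<open>k\<close> is \<open>- (n - 1) M\<^sub>j\<^sub>i + \<delta>\<^sub>i\<^sub>j tr M - M\<^sub>i\<^sub>j\<close>.  The shift by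
  \<open>(n - 1) / 2\<close> on the diagonal is chosen so that the first of these terms is absorbed when the
  remaining factor \<open>e\<^sub>j\<^sub>k = - e\<^sub>k\<^sub>j\<close> is written on the right.\<close>

lemma transpose_step:
  assumes M: "equivariant M" and b: "i < n" "j < n"
  shows "(\<Sum>k=0..<n. ehat j k * M k i) = - (\<Sum>k=0..<n. M k i * ehat k j)
           + (if i = j then \<Sum>k=0..<n. M k k else 0) - M i j"
proof -
  let ?h = "of_real ((real n - 1) / 2) :: 'r"
  have hc: "?h * x = x * ?h" for x by (simp add: of_real_def)
  have t: "ehat j k * M k i = - (M k i * ehat k j) + (if k = j then M k i * of_real (real n - 1) else 0)
      + ((if j = k then M k i else 0) - M j i + (if j = i then M k k else 0) - (if k = i then M k j else 0))"
    if "k \<in> {0..<n}" for k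
  proof -
    have k: "k < n" using that by simp
    have "ehat j k * M k i = e j k * M k i + (if j = k then ?h * M k i else 0)"
      by (simp add: ehat_def algebra_simps)
    also have "e j k * M k i = M k i * e j k + ((if j = k then M k i else 0) - M j i + (if j = i then M k k else 0) - (if k = i then M k j else 0))"
      using equivariantD[OF M b(2) k k b(1)] by simp
    also have "e j k = - ehat k j + (if k = j then ?h else 0)"
      using anti[OF k b(2)] by (simp add: ehat_def)
    finally have "ehat j k * M k i = - (M k i * ehat k j) + (if k = j then M k i * ?h + M k i * ?h else 0)
      + ((if j = k then M k i else 0) - M j i + (if j = i then M k k else 0) - (if k = i then M k j else 0))"
      by (auto simp: hc algebra_simps)
    also have "M k i * ?h + M k i * ?h = M k i * of_real (real n - 1)"
      by (simp add: distrib_left[symmetric] of_real_add[symmetric] del: of_real_add)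
    finally show ?thesis .
  qed
  have d: "(\<Sum>k=0..<n. if k = a then F k else 0) = F a"
     "(\<Sum>k=0..<n. if a = k then F k else 0) = F a" if "a < n" for a and F :: "nat \<Rightarrow> 'r"
    using that by (simp_all add: sum.delta)
  have c: "(\<Sum>s=0..<n. if P then F s else 0) = (if P then \<Sum>s=0..<n. F s else 0)" for P and F :: "nat \<Rightarrow> 'r"
    by simp
  have "(\<Sum>k=0..<n. ehat j k * M k i) = (\<Sum>k=0..<n. - (M k i * ehat k j) + (if k = j then M k i * of_real (real n - 1) else 0)
      + ((if j = k then M k i else 0) - M j i + (if j = i then M k k else 0) - (if k = i then M k j else 0)))"
    by (rule sum.cong[OF refl t])
  also have "\<dots> = - (\<Sum>k=0..<n. M k i * ehat k j) + M j i * of_real (real n - 1)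
     + M j i - of_nat n * M j i + (if j = i then \<Sum>k=0..<n. M k k else 0) - M i j"
    unfolding sum.distrib sum_subtractf d[OF b(1)] d[OF b(2)] c
    by (simp add: sum_negf)
  finally have F: "(\<Sum>k=0..<n. ehat j k * M k i) = \<dots>" .
  have "M j i * of_real (real n - 1) + M j i = of_nat n * M j i"
  proof -
    have "M j i * of_real (real n - 1) + M j i = M j i * of_nat n" by (simp add: algebra_simps)
    also have "\<dots> = of_nat n * M j i" by (rule mult_of_nat_commute[symmetric])
    finally show ?thesis .
  qed
  then have E: "- (\<Sum>k=0..<n. M k i * ehat k j) + M j i * of_real (real n - 1)
     + M j i - of_nat n * M j i = - (\<Sum>k=0..<n. M k i * ehat k j)"
    by (simp add: algebra_simps)
  show ?thesis unfolding F E by auto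
qed

lemma ehat_pow_Suc_right: "\<lbrakk>i < n; j < n\<rbrakk> \<Longrightarrow> ehat_pow (Suc q) i j = (\<Sum>k=0..<n. ehat_pow q i k * ehat k j)"
proof (induction q arbitrary: i)
  case 0
  have d: "(\<Sum>k=0..<n. (if i = k then 1 else 0) * ehat k j) = (\<Sum>k=0..<n. if i = k then ehat k j else 0)"
    "(\<Sum>k=0..<n. ehat i k * (if k = j then 1 else 0)) = (\<Sum>k=0..<n. if k = j then ehat i k else 0)"
    by (rule sum.cong; simp)+
  show ?case unfolding ehat_pow.simps d using 0 by simp
next
  case (Suc q)
  have "ehat_pow (Suc (Suc q)) i j = (\<Sum>k=0..<n. ehat i k * (\<Sum>l=0..<n. ehat_pow q k l * ehat l j))"
    using Suc by (subst ehat_pow.simps, intro sum.cong) (auto simp del: ehat_pow.simps)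
  also have "\<dots> = (\<Sum>k=0..<n. \<Sum>l=0..<n. ehat i k * ehat_pow q k l * ehat l j)"
    by (simp add: sum_distrib_left mult.assoc)
  also have "\<dots> = (\<Sum>l=0..<n. \<Sum>k=0..<n. ehat i k * ehat_pow q k l * ehat l j)"
    by (rule sum.swap)
  also have "\<dots> = (\<Sum>l=0..<n. ehat_pow (Suc q) i l * ehat l j)"
    by (simp add: sum_distrib_right)
  finally show ?case .
qed

text \<open>The iteration of the previous step, with \<open>M\<close> running through the powers: every step multiplies
  the terms collected so far by \<open>- E\<close> from the right and adds \<open>tr E\<^sup>q - E\<^sup>q\<close>.\<close>

lemma ehat_pow_transpose:
  "\<lbrakk>i < n; j < n\<rbrakk> \<Longrightarrow> ehat_pow q j i = (- 1) ^ q * ehat_pow q i j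
     + (\<Sum>p<q. (- 1) ^ p * (ehat_trace (q - 1 - p) * ehat_pow p i j - ehat_pow (q - 1) i j))"
proof (induction q arbitrary: j)
  case 0
  then show ?case by auto
next
  case (Suc q)
  let ?t = "\<lambda>p j. (- 1) ^ p * (ehat_trace (q - 1 - p) * ehat_pow p i j - ehat_pow (q - 1) i j)"
  (* multiplying by E from the right turns each collected term into one of the next step *)
  have shift: "(\<Sum>k=0..<n. ?t p k * ehat k j) = (- 1) ^ p * (ehat_trace (q - 1 - p) * ehat_pow (Suc p) i j - ehat_pow q i j)"
    if "p < q" for p
  proof -
    have q: "Suc (q - 1) = q" using that by simp
    have "(\<Sum>k=0..<n. ?t p k * ehat k j) = (\<Sum>k=0..<n. (- 1) ^ p * (ehat_trace (q - 1 - p) * (ehat_pow p i k * ehat k j) - ehat_pow (q - 1) i k * ehat k j))"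
      by (intro sum.cong refl) (simp add: algebra_simps)
    also have "\<dots> = (- 1) ^ p * (ehat_trace (q - 1 - p) * (\<Sum>k=0..<n. ehat_pow p i k * ehat k j) - (\<Sum>k=0..<n. ehat_pow (q - 1) i k * ehat k j))"
      by (simp only: sum_distrib_left[symmetric] sum_subtractf)
    also have "\<dots> = (- 1) ^ p * (ehat_trace (q - 1 - p) * ehat_pow (Suc p) i j - ehat_pow (Suc (q - 1)) i j)"
      using Suc.prems by (simp only: ehat_pow_Suc_right)
    finally show ?thesis using q by simp
  qed
  have "(\<Sum>k=0..<n. ehat_pow q k i * ehat k j)
      = (\<Sum>k=0..<n. ((- 1) ^ q * ehat_pow q i k + (\<Sum>p<q. ?t p k)) * ehat k j)"
    using Suc.IH[OF Suc.prems(1)] by (intro sum.cong[OF refl] arg_cong[of _ _ "\<lambda>x. x * _"]) simp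
  also have "\<dots> = (\<Sum>k=0..<n. (- 1) ^ q * (ehat_pow q i k * ehat k j)) + (\<Sum>k=0..<n. \<Sum>p<q. ?t p k * ehat k j)"
    by (simp add: distrib_right sum.distrib sum_distrib_right mult.assoc)
  also have "(\<Sum>k=0..<n. \<Sum>p<q. ?t p k * ehat k j) = (\<Sum>p<q. \<Sum>k=0..<n. ?t p k * ehat k j)"
    by (rule sum.swap)
  also have "\<dots> = (\<Sum>p<q. (- 1) ^ p * (ehat_trace (q - 1 - p) * ehat_pow (Suc p) i j - ehat_pow q i j))"
    by (rule sum.cong[OF refl], rule shift) simp
  also have "(\<Sum>k=0..<n. (- 1) ^ q * (ehat_pow q i k * ehat k j)) = (- 1) ^ q * ehat_pow (Suc q) i j"
    using Suc.prems by (simp only: ehat_pow_Suc_right sum_distrib_left)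
  finally have 1: "(\<Sum>k=0..<n. ehat_pow q k i * ehat k j) = (- 1) ^ q * ehat_pow (Suc q) i j
     + (\<Sum>p<q. (- 1) ^ p * (ehat_trace (q - 1 - p) * ehat_pow (Suc p) i j - ehat_pow q i j))" .
  have 2: "ehat_pow (Suc q) j i = - (\<Sum>k=0..<n. ehat_pow q k i * ehat k j) + (if i = j then ehat_trace q else 0) - ehat_pow q i j"
    using transpose_step[OF equivariant_ehat_pow Suc.prems] by (simp add: ehat_trace_def)
  have 3: "(\<Sum>p<Suc q. (- 1) ^ p * (ehat_trace (Suc q - 1 - p) * ehat_pow p i j - ehat_pow (Suc q - 1) i j))
     = (ehat_trace q * ehat_pow 0 i j - ehat_pow q i j) - (\<Sum>p<q. (- 1) ^ p * (ehat_trace (q - 1 - p) * ehat_pow (Suc p) i j - ehat_pow q i j))"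
    by (subst sum.lessThan_Suc_shift) (simp add: sum_negf del: ehat_pow.simps)
  have 4: "- (P * E + S) + (if B then c else 0) - x = - 1 * P * E + ((c * (if B then 1 else 0) - x) - S)"
    for P E S c x :: 'r and B
    by (simp add: algebra_simps)
  show ?case unfolding 2 3 unfolding 1 ehat_pow.simps(1) power_Suc by (rule 4)
qed

text \<open>For an even exponent the terms \<open>\<plusminus> E\<^sup>2\<^sup>r\<^sup>-\<^sup>1\<close> cancel, and the alternating sum is the difference of a matrix
  and its transpose.\<close>

theorem ehat_pow_alternating_antisym:
  assumes b: "i < n" "j < n"
  shows "(\<Sum>p<2 * r. (- 1) ^ p * (ehat_trace (2 * r - 1 - p) * ehat_pow p i j))
       + (\<Sum>p<2 * r. (- 1) ^ p * (ehat_trace (2 * r - 1 - p) * ehat_pow p j i)) = 0"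
proof -
  have z: "(\<Sum>p<2 * r. (- 1) ^ p * x) = 0" for x :: 'r
    by (induction r) (simp_all add: numeral_2_eq_2)
  have "(\<Sum>p<2 * r. (- 1) ^ p * (ehat_trace (2 * r - 1 - p) * ehat_pow p i j)) = ehat_pow (2 * r) j i - ehat_pow (2 * r) i j"
    if "i < n" "j < n" for i j
    using ehat_pow_transpose[OF that, of "2 * r"] z
    by (simp add: right_diff_distrib sum_subtractf del: ehat_pow.simps)
  then show ?thesis using b by simp
qed

end

section \<open>Alternating sums and the Pfaffian\<close>

lemma prod_list_perm:
  fixes F :: "'a \<Rightarrow> 'b :: monoid_mult"
  assumes "mset xs = mset ys"
    and "\<And>x y. \<lbrakk>x \<in> set xs; y \<in> set xs\<rbrakk> \<Longrightarrow> F x * F y = F y * F x"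
  shows "prod_list (map F xs) = prod_list (map F ys)"
  using assms
proof (induction xs arbitrary: ys)
  case Nil
  then show ?case by simp
next
  case (Cons x xs)
  from Cons.prems(1) have "x \<in> set ys"
    by (metis list.set_intros(1) set_mset_mset)
  then obtain us vs where ys: "ys = us @ x # vs" by (meson split_list)
  have m: "mset xs = mset (us @ vs)" using Cons.prems(1) ys by simp
  have sub: "set us \<subseteq> set (x # xs)" using ys Cons.prems(1) by (metis mset_eq_setD set_append Un_upper1)
  have c: "F x * prod_list (map F us) = prod_list (map F us) * F x"
    using sub
  proof (induction us)
    case (Cons u us)
    have "F x * prod_list (map F (u # us)) = F u * (F x * prod_list (map F us))"
      using Cons.prems \<open>\<And>x y. \<lbrakk>x \<in> set (_ # xs); y \<in> set (_ # xs)\<rbrakk> \<Longrightarrow> F x * F y = F y * F x\<close>[of x u]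
      by (simp add: mult.assoc[symmetric])
    then show ?case using Cons by (simp add: mult.assoc)
  qed simp
  have "prod_list (map F xs) = prod_list (map F (us @ vs))"
    by (rule Cons.IH[OF m]) (use Cons.prems in simp)
  then have "prod_list (map F (x # xs)) = (F x * prod_list (map F us)) * prod_list (map F vs)"
    by (simp add: mult.assoc)
  then show ?case by (simp only: c) (simp add: ys mult.assoc)
qed

definition swap_pairs :: "nat \<Rightarrow> nat \<Rightarrow> nat \<Rightarrow> nat" where
  "swap_pairs a b = transpose (2 * a) (2 * b) \<circ> transpose (2 * a + 1) (2 * b + 1)"

lemma swap_pairs_even [simp]: "swap_pairs a b (2 * k) = 2 * transpose a b k"
  by (auto simp: swap_pairs_def transpose_def; presburger)

lemma swap_pairs_odd [simp]: "swap_pairs a b (Suc (2 * k)) = Suc (2 * transpose a b k)"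
  by (auto simp: swap_pairs_def transpose_def; presburger)

lemma swap_pairs_permutes: "\<lbrakk>a < m; b < m\<rbrakk> \<Longrightarrow> swap_pairs a b permutes {0..<2 * m}"
  unfolding swap_pairs_def by (intro permutes_compose permutes_swap_id) auto

lemma sign_swap_pairs: "sign (swap_pairs a b) = 1"
  unfolding swap_pairs_def
  by (subst sign_compose) (auto simp: sign_swap_id permutation_swap_id)

definition alt_sum :: "nat \<Rightarrow> ((nat \<Rightarrow> nat) \<Rightarrow> 'r :: ring_1) \<Rightarrow> 'r" where
  "alt_sum n \<Phi> = (\<Sum>\<sigma> | \<sigma> permutes {0..<n}. of_int (sign \<sigma>) * \<Phi> \<sigma>)"

lemma alt_sum_cong:
  "(\<And>\<sigma>. \<sigma> permutes {0..<n} \<Longrightarrow> \<Phi> \<sigma> = \<Psi> \<sigma>) \<Longrightarrow> alt_sum n \<Phi> = alt_sum n \<Psi>"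
  unfolding alt_sum_def by (rule sum.cong) auto

lemma alt_sum_add: "alt_sum n (\<lambda>\<sigma>. \<Phi> \<sigma> + \<Psi> \<sigma>) = alt_sum n \<Phi> + alt_sum n \<Psi>"
  unfolding alt_sum_def by (simp add: distrib_left sum.distrib)

lemma alt_sum_diff: "alt_sum n (\<lambda>\<sigma>. \<Phi> \<sigma> - \<Psi> \<sigma>) = alt_sum n \<Phi> - alt_sum n \<Psi>"
  unfolding alt_sum_def by (simp add: right_diff_distrib sum_subtractf)

lemma alt_sum_minus: "alt_sum n (\<lambda>\<sigma>. - \<Phi> \<sigma>) = - alt_sum n \<Phi>"
  unfolding alt_sum_def by (simp add: sum_negf)

lemma alt_sum_sum: "alt_sum n (\<lambda>\<sigma>. \<Sum>i\<in>A. \<Phi> i \<sigma>) = (\<Sum>i\<in>A. alt_sum n (\<Phi> i))"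
  unfolding alt_sum_def by (subst sum.swap) (simp add: sum_distrib_left)

lemma alt_sum_mult_right: "alt_sum n \<Phi> * x = alt_sum n (\<lambda>\<sigma>. \<Phi> \<sigma> * x)"
  unfolding alt_sum_def by (simp add: sum_distrib_right mult.assoc)

lemma alt_sum_mult_left: "x * alt_sum n \<Phi> = alt_sum n (\<lambda>\<sigma>. x * \<Phi> \<sigma>)"
proof -
  have "x * (of_int k * y) = of_int k * (x * y)" for k and y :: 'a
    by (metis mult.assoc mult_of_int_commute)
  then show ?thesis unfolding alt_sum_def by (simp add: sum_distrib_left)
qed

lemma alt_sum_permute:
  assumes "p permutes {0..<n}"
  shows "alt_sum n \<Phi> = of_int (sign p) * alt_sum n (\<lambda>\<sigma>. \<Phi> (\<sigma> \<circ> p))"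
proof -
  have "alt_sum n \<Phi> = (\<Sum>\<sigma> | \<sigma> permutes {0..<n}. of_int (sign (\<sigma> \<circ> p)) * \<Phi> (\<sigma> \<circ> p))"
    unfolding alt_sum_def by (rule sum_permutations_compose_right[OF assms])
  also have "\<dots> = (\<Sum>\<sigma> | \<sigma> permutes {0..<n}. of_int (sign p) * (of_int (sign \<sigma>) * \<Phi> (\<sigma> \<circ> p)))"
  proof (rule sum.cong[OF refl])
    fix \<sigma> assume "\<sigma> \<in> {\<sigma>. \<sigma> permutes {0..<n}}"
    then have "sign (\<sigma> \<circ> p) = sign p * sign \<sigma>"
      using assms by (subst sign_compose) (auto intro: permutation_permutes[THEN iffD2])
    then show "of_int (sign (\<sigma> \<circ> p)) * \<Phi> (\<sigma> \<circ> p) = of_int (sign p) * (of_int (sign \<sigma>) * \<Phi> (\<sigma> \<circ> p))"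
      by (simp add: mult.assoc)
  qed
  finally show ?thesis by (simp add: alt_sum_def sum_distrib_left)
qed

lemma alt_sum_transpose:
  assumes "a < n" "b < n" "a \<noteq> b"
  shows "alt_sum n \<Phi> = - alt_sum n (\<lambda>\<sigma>. \<Phi> (\<sigma> \<circ> transpose a b))"
  using alt_sum_permute[OF permutes_swap_id[of a "{0..<n}" b], of \<Phi>] assms
  by (simp add: sign_swap_id)

lemma alt_sum_swap_pairs:
  assumes "a < m" "b < m"
  shows "alt_sum (2 * m) \<Phi> = alt_sum (2 * m) (\<lambda>\<sigma>. \<Phi> (\<sigma> \<circ> swap_pairs a b))"
  using alt_sum_permute[OF swap_pairs_permutes[OF assms], of \<Phi>] by (simp add: sign_swap_pairs)

text \<open>Composing with a transposition from the left is a sign-reversing involution.\<close>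

lemma alt_sum_cancel:
  fixes \<Phi> :: "(nat \<Rightarrow> nat) \<Rightarrow> 'r :: real_algebra_1"
  assumes ab: "a < n" "b < n" "a \<noteq> b"
    and inv: "\<And>\<sigma>. \<sigma> permutes {0..<n} \<Longrightarrow> \<Phi> (transpose a b \<circ> \<sigma>) = \<Phi> \<sigma>"
  shows "alt_sum n \<Phi> = 0"
proof -
  have p: "transpose a b permutes {0..<n}" by (rule permutes_swap_id) (use ab in auto)
  have "alt_sum n \<Phi> = (\<Sum>\<sigma> | \<sigma> permutes {0..<n}. of_int (sign (transpose a b \<circ> \<sigma>)) * \<Phi> (transpose a b \<circ> \<sigma>))"
    unfolding alt_sum_def by (rule setum_permutations_compose_left[OF p])
  also have "\<dots> = (\<Sum>\<sigma> | \<sigma> permutes {0..<n}. - (of_int (sign \<sigma>) * \<Phi> \<sigma>))"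
  proof (rule sum.cong[OF refl])
    fix \<sigma> assume s: "\<sigma> \<in> {\<sigma>. \<sigma> permutes {0..<n}}"
    then have "sign (transpose a b \<circ> \<sigma>) = - sign \<sigma>"
      using p ab by (subst sign_compose) (auto intro: permutation_permutes[THEN iffD2] simp: sign_swap_id)
    then show "of_int (sign (transpose a b \<circ> \<sigma>)) * \<Phi> (transpose a b \<circ> \<sigma>) = - (of_int (sign \<sigma>) * \<Phi> \<sigma>)"
      using inv s by simp
  qed
  also have "\<dots> = - alt_sum n \<Phi>" by (simp add: alt_sum_def sum_negf)
  finally have "alt_sum n \<Phi> + alt_sum n \<Phi> = 0" by (metis add.right_inverse)
  then have "2 *\<^sub>R alt_sum n \<Phi> = 0" by (simp only: scaleR_2)
  then show ?thesis by simp
qed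

context so_family
begin

text \<open>The list records which pairs contribute and in which order, so that single factors can be removed
  and moved.\<close>

definition pair_prod :: "(nat \<Rightarrow> nat) \<Rightarrow> nat list \<Rightarrow> 'r" where
  "pair_prod \<kappa> ks = prod_list (map (\<lambda>k. e (\<kappa> (2 * k)) (\<kappa> (2 * k + 1))) ks)"

text \<open>The Pfaffian without its normalising constant.\<close>

definition pfaff :: "nat \<Rightarrow> 'r" where
  "pfaff m = alt_sum (2 * m) (\<lambda>\<sigma>. pair_prod \<sigma> [0..<m])"

lemma pair_prod_simps [simp]:
  "pair_prod \<kappa> [] = 1"
  "pair_prod \<kappa> (k # ks) = e (\<kappa> (2 * k)) (\<kappa> (2 * k + 1)) * pair_prod \<kappa> ks"
  "pair_prod \<kappa> (ks @ ks') = pair_prod \<kappa> ks * pair_prod \<kappa> ks'"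
  by (simp_all add: pair_prod_def)

lemma pair_prod_cong:
  "(\<And>k. k \<in> set ks \<Longrightarrow> \<kappa> (2 * k) = \<kappa>' (2 * k) \<and> \<kappa> (Suc (2 * k)) = \<kappa>' (Suc (2 * k)))
    \<Longrightarrow> pair_prod \<kappa> ks = pair_prod \<kappa>' ks"
  unfolding pair_prod_def by (intro arg_cong[of _ _ prod_list] map_cong) auto

text \<open>The Leibniz rule: the bracket with \<open>e\<^sub>a\<^sub>b\<close> replaces, one position at a time, an index \<open>a\<close> by \<open>b\<close>, minus the
  same with \<open>a\<close> and \<open>b\<close> exchanged.\<close>

lemma pair_prod_bracket:
  assumes ab: "a < n" "b < n" and \<kappa>: "\<And>p. p < 2 * m \<Longrightarrow> \<kappa> p < n"
  shows "e a b * pair_prod \<kappa> [0..<m] - pair_prod \<kappa> [0..<m] * e a b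
    = (\<Sum>p<2 * m. (if \<kappa> p = a then pair_prod (\<kappa>(p := b)) [0..<m] else 0)
                 - (if \<kappa> p = b then pair_prod (\<kappa>(p := a)) [0..<m] else 0))"
  using \<kappa>
proof (induction m)
  case 0
  then show ?case by simp
next
  case (Suc m)
  let ?P = "pair_prod \<kappa> [0..<m]" and ?c = "\<kappa> (2 * m)" and ?d = "\<kappa> (Suc (2 * m))"
  have cd: "?c < n" "?d < n" using Suc.prems by auto
  have last: "pair_prod \<kappa>' [0..<Suc m] = pair_prod \<kappa>' [0..<m] * e (\<kappa>' (2 * m)) (\<kappa>' (Suc (2 * m)))" for \<kappa>'
    by simp
  have old: "pair_prod (\<kappa>(2 * m := x)) [0..<m] = ?P" "pair_prod (\<kappa>(Suc (2 * m) := x)) [0..<m] = ?P" for x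
    by (auto intro!: pair_prod_cong)
  have low: "pair_prod (\<kappa>(p := x)) [0..<Suc m] = pair_prod (\<kappa>(p := x)) [0..<m] * e ?c ?d" if "p < 2 * m" for p x
    using that by simp
  have "e a b * (?P * e ?c ?d) - ?P * e ?c ?d * e a b
      = (e a b * ?P - ?P * e a b) * e ?c ?d + ?P * (e a b * e ?c ?d - e ?c ?d * e a b)"
    by (simp add: algebra_simps)
  also have "e a b * ?P - ?P * e a b = (\<Sum>p<2 * m. (if \<kappa> p = a then pair_prod (\<kappa>(p := b)) [0..<m] else 0)
                 - (if \<kappa> p = b then pair_prod (\<kappa>(p := a)) [0..<m] else 0))"
    by (rule Suc.IH) (use Suc.prems in simp)
  also have "\<dots> * e ?c ?d = (\<Sum>p<2 * m. (if \<kappa> p = a then pair_prod (\<kappa>(p := b)) [0..<Suc m] else 0)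
                 - (if \<kappa> p = b then pair_prod (\<kappa>(p := a)) [0..<Suc m] else 0))"
    unfolding sum_distrib_right
    by (rule sum.cong[OF refl]) (simp only: low lessThan_iff left_diff_distrib if_distrib[of "\<lambda>x. x * e ?c ?d"] mult_zero_left)
  also have "?P * (e a b * e ?c ?d - e ?c ?d * e a b)
    = (if ?c = a then pair_prod (\<kappa>(2 * m := b)) [0..<Suc m] else 0) - (if ?c = b then pair_prod (\<kappa>(2 * m := a)) [0..<Suc m] else 0)
     + (if ?d = a then pair_prod (\<kappa>(Suc (2 * m) := b)) [0..<Suc m] else 0) - (if ?d = b then pair_prod (\<kappa>(Suc (2 * m) := a)) [0..<Suc m] else 0)"
    unfolding comm[OF ab cd] last old by (auto simp: algebra_simps)
  finally show ?case unfolding last[of \<kappa>]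
    by (simp del: upt_Suc pair_prod_simps)
qed

text \<open>Every summand of the bracket with \<open>e\<^sub>a\<^sub>b\<close> depends on \<open>\<sigma>\<close> only through \<open>r \<circ> \<sigma>\<close>, where \<open>r\<close> maps \<open>a\<close> to \<open>b\<close> and
  fixes the rest (or the other way round).  Hence it does not distinguish \<open>\<sigma>\<close> from its composition
  with the transposition of \<open>a\<close> and \<open>b\<close>, and these two have opposite signs.\<close>

theorem pfaff_central:
  assumes n: "n = 2 * m" and ab: "a < n" "b < n"
  shows "e a b * pfaff m = pfaff m * e a b"
proof (cases "a = b")
  case True
  then show ?thesis using e_diag ab by simp
next
  case False
  (* the substitution that the bracket performs on the indices *)
  define r where "r x y = (\<lambda>z :: nat. if z = x then y else z)" for x y
  have bracket: "e a b * pair_prod \<sigma> [0..<m] - pair_prod \<sigma> [0..<m] * e a b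
      = pair_prod (r a b \<circ> \<sigma>) [0..<m] - pair_prod (r b a \<circ> \<sigma>) [0..<m]"
    if \<sigma>: "\<sigma> permutes {0..<2 * m}" for \<sigma>
  proof -
    have hit: "(\<Sum>p<2 * m. if \<sigma> p = x then pair_prod (\<sigma>(p := y)) [0..<m] else 0) = pair_prod (r x y \<circ> \<sigma>) [0..<m]"
      if "x < n" for x y
    proof -
      let ?p = "inv_into UNIV \<sigma> x"
      have p: "?p < 2 * m" "\<And>q. \<sigma> q = x \<longleftrightarrow> q = ?p"
        using \<sigma> that n permutes_in_image[OF permutes_inv[OF \<sigma>], of x]
        by (auto simp: permutes_inverses)
      have u: "\<sigma>(?p := y) = r x y \<circ> \<sigma>"
        by (rule ext) (use p(2) in \<open>auto simp: r_def\<close>)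
      show ?thesis using p(1) by (simp add: p(2) u)
    qed
    have "\<sigma> p < n" if "p < 2 * m" for p
      using permutes_in_image[OF \<sigma>, of p] that n by simp
    then show ?thesis
      using pair_prod_bracket[OF ab, of m \<sigma>] hit ab by (simp add: sum_subtractf)
  qed
  have z: "alt_sum n (\<lambda>\<sigma>. pair_prod (r x y \<circ> \<sigma>) [0..<m]) = 0" if "x < n" "y < n" "x \<noteq> y" for x y
  proof (rule alt_sum_cancel[OF that])
    fix \<sigma> :: "nat \<Rightarrow> nat"
    have "r x y \<circ> (transpose x y \<circ> \<sigma>) = r x y \<circ> \<sigma>"
      by (auto simp: r_def transpose_def fun_eq_iff)
    then show "pair_prod (r x y \<circ> (transpose x y \<circ> \<sigma>)) [0..<m] = pair_prod (r x y \<circ> \<sigma>) [0..<m]" by simp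
  qed
  have "e a b * pfaff m - pfaff m * e a b
      = alt_sum n (\<lambda>\<sigma>. e a b * pair_prod \<sigma> [0..<m] - pair_prod \<sigma> [0..<m] * e a b)"
    unfolding pfaff_def n by (simp add: alt_sum_mult_left alt_sum_mult_right alt_sum_diff)
  also have "\<dots> = alt_sum n (\<lambda>\<sigma>. pair_prod (r a b \<circ> \<sigma>) [0..<m] - pair_prod (r b a \<circ> \<sigma>) [0..<m])"
    by (rule alt_sum_cong) (use bracket n in blast)
  also have "\<dots> = 0" using z ab False by (simp add: alt_sum_diff)
  finally show ?thesis by simp
qed

end

section \<open>Blocks of the Pfaffian on a tensor product\<close>

lemma sum_pairs:
  fixes f :: "nat \<Rightarrow> 'a :: comm_monoid_add"
  shows "(\<Sum>p<2 * m. f p) = (\<Sum>k<m. f (2 * k) + f (Suc (2 * k)))"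
  by (induction m) (simp_all add: ac_simps)

text \<open>Exchanging pairs, or the two entries of a pair, moves \<open>j\<close> from any of the first \<open>2 k\<close> positions to
  any other one; the sign by which \<open>X\<close> changes is the sign of the permutation, so all positions
  contribute equally.\<close>

lemma alt_sum_position:
  fixes X :: "(nat \<Rightarrow> nat) \<Rightarrow> 'r :: ring_1"
  assumes km: "k \<le> m" and l: "l < k"
    and swap: "\<And>\<sigma> a b. \<lbrakk>\<sigma> permutes {0..<2 * m}; a < k; b < k\<rbrakk> \<Longrightarrow> X (\<sigma> \<circ> swap_pairs a b) = X \<sigma>"
    and flip: "\<And>\<sigma> a. \<lbrakk>\<sigma> permutes {0..<2 * m}; a < k\<rbrakk> \<Longrightarrow> X (\<sigma> \<circ> transpose (2 * a) (Suc (2 * a))) = - X \<sigma>"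
  shows "(\<Sum>p<2 * k. alt_sum (2 * m) (\<lambda>\<sigma>. if \<sigma> p = j then X \<sigma> else 0))
    = of_nat (2 * k) * alt_sum (2 * m) (\<lambda>\<sigma>. if \<sigma> (2 * l) = j then X \<sigma> else 0)"
proof -
  define H where "H p = alt_sum (2 * m) (\<lambda>\<sigma>. if \<sigma> p = j then X \<sigma> else 0)" for p
  have H: "H (2 * a) = H (2 * l)" "H (Suc (2 * a)) = H (2 * l)" if a: "a < k" for a
  proof -
    let ?s = "swap_pairs a l" and ?t = "transpose (2 * a) (Suc (2 * a))"
    have "H (2 * a) = alt_sum (2 * m) (\<lambda>\<sigma>. if (\<sigma> \<circ> ?s) (2 * a) = j then X (\<sigma> \<circ> ?s) else 0)"
      unfolding H_def by (rule alt_sum_swap_pairs) (use a l km in auto)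
    also have "\<dots> = H (2 * l)" unfolding H_def by (rule alt_sum_cong) (use swap a l in simp)
    finally show even: "H (2 * a) = H (2 * l)" .
    have "H (Suc (2 * a)) = - alt_sum (2 * m) (\<lambda>\<sigma>. if (\<sigma> \<circ> ?t) (Suc (2 * a)) = j then X (\<sigma> \<circ> ?t) else 0)"
      unfolding H_def by (rule alt_sum_transpose) (use a km in auto)
    also have "\<dots> = H (2 * a)" unfolding H_def alt_sum_minus[symmetric] by (rule alt_sum_cong) (use flip a in simp)
    finally show "H (Suc (2 * a)) = H (2 * l)" using even by simp
  qed
  have "(\<Sum>p<2 * k. H p) = (\<Sum>a<k. H (2 * a) + H (Suc (2 * a)))" by (rule sum_pairs)
  also have "\<dots> = (\<Sum>a<k. H (2 * l) + H (2 * l))"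
    by (rule sum.cong[OF refl], rule arg_cong2[of _ _ _ _ "(+)"]) (use H in auto)
  also have "\<dots> = of_nat (2 * k) * H (2 * l)" by (simp add: algebra_simps mult_2)
  finally show ?thesis by (simp only: H_def)
qed

context so_family
begin

text \<open>The \<open>(i, j)\<close> entry of the matrix of \<open>e\<^sub>a \<and> e\<^sub>b\<close>.\<close>

definition wedge_entry :: "nat \<Rightarrow> nat \<Rightarrow> nat \<Rightarrow> nat \<Rightarrow> 'r" where
  "wedge_entry a b i j = (if a = j \<and> b = i then 1 else 0) - (if a = i \<and> b = j then 1 else 0)"

text \<open>The \<open>(i, j)\<close> block of the action of \<open>e\<^sub>a \<and> e\<^sub>b\<close> on \<open>V \<otimes> \<complex>\<^sup>n\<close>.\<close>

definition tensor_block :: "nat \<Rightarrow> nat \<Rightarrow> nat \<Rightarrow> nat \<Rightarrow> 'r" where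
  "tensor_block a b i j = (if i = j then e a b else 0) + wedge_entry a b i j"

primrec pair_block :: "(nat \<Rightarrow> nat) \<Rightarrow> nat list \<Rightarrow> nat \<Rightarrow> nat \<Rightarrow> 'r" where
  "pair_block \<kappa> [] i j = (if i = j then 1 else 0)"
| "pair_block \<kappa> (k # ks) i j = (\<Sum>l=0..<n. tensor_block (\<kappa> (2 * k)) (\<kappa> (2 * k + 1)) i l * pair_block \<kappa> ks l j)"

definition pf_block :: "nat \<Rightarrow> nat \<Rightarrow> nat \<Rightarrow> 'r" where
  "pf_block m i j = alt_sum (2 * m) (\<lambda>\<sigma>. pair_block \<sigma> [0..<m] i j)"

text \<open>The signed sub-Pfaffian that is left when the factor \<open>e\<^sub>i\<^sub>j\<close> is removed from the Pfaffian of size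
  \<open>2 k + 2\<close>, with \<open>i\<close> and \<open>j\<close> at the last two positions.\<close>

definition pf_cofactor :: "nat \<Rightarrow> nat \<Rightarrow> nat \<Rightarrow> 'r" where
  "pf_cofactor k i j = alt_sum (2 * Suc k)
     (\<lambda>\<sigma>. if \<sigma> (2 * k) = i \<and> \<sigma> (Suc (2 * k)) = j then pair_prod \<sigma> [0..<k] else 0)"

lemma wedge_entry_mult: "wedge_entry a b i j * x = (if a = j \<and> b = i then x else 0) - (if a = i \<and> b = j then x else 0)"
proof -
  have "((if P then 1 else 0) - (if Q then 1 else 0)) * x = (if P then x else 0) - (if Q then x else 0)" for P Q
    by simp
  then show ?thesis by (simp only: wedge_entry_def)
qed

lemma wedge_entry_comm: "wedge_entry a b i j * x = x * wedge_entry a b i j"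
proof -
  have "((if P then 1 else 0) - (if Q then 1 else 0)) * x = x * ((if P then 1 else 0) - (if Q then 1 else 0))" for P Q
    by simp
  then show ?thesis by (simp only: wedge_entry_def)
qed

lemma wedge_entry_sum:
  assumes "a < n" "b < n"
  shows "(\<Sum>l=0..<n. wedge_entry a b i l * X l) = (if b = i then X a else 0) - (if a = i then X b else 0)"
proof -
  have "(if a = l \<and> b = i then x else 0) = (if a = l then if b = i then x else 0 else 0)" for a b l and x :: 'r by simp
  moreover have "(if a = i \<and> b = l then x else 0) = (if b = l then if a = i then x else 0 else 0)" for a b l and x :: 'r by simp
  ultimately show ?thesis using assms by (simp only: wedge_entry_mult sum_subtractf sum.delta' finite_atLeastLessThan) simp
qed

text \<open>Two wedges with disjoint indices have product \<open>0\<close> on \<open>\<complex>\<^sup>n\<close>, so at most one factor of the product can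
  act on the second tensor factor.\<close>

lemma pair_block_expand:
  assumes "distinct ks" "inj \<kappa>" "\<And>k. k \<in> set ks \<Longrightarrow> \<kappa> (2 * k) < n \<and> \<kappa> (Suc (2 * k)) < n"
    and "i < n" "j < n"
  shows "pair_block \<kappa> ks i j = (if i = j then pair_prod \<kappa> ks else 0)
    + (\<Sum>k\<in>set ks. wedge_entry (\<kappa> (2 * k)) (\<kappa> (2 * k + 1)) i j * pair_prod \<kappa> (remove1 k ks))"
  using assms
proof (induction ks arbitrary: i j)
  case Nil
  then show ?case by simp
next
  case (Cons k ks)
  let ?a = "\<kappa> (2 * k)" and ?b = "\<kappa> (Suc (2 * k))"
  have ab: "?a < n" "?b < n" using Cons.prems(3)[of k] by auto
  have IH: "pair_block \<kappa> ks i j = (if i = j then pair_prod \<kappa> ks else 0)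
    + (\<Sum>k\<in>set ks. wedge_entry (\<kappa> (2 * k)) (\<kappa> (2 * k + 1)) i j * pair_prod \<kappa> (remove1 k ks))" if "i < n" "j < n" for i j
    by (rule Cons.IH) (use Cons.prems that in auto)
  (* the rest of the product acts only on V once the first factor has picked the index x *)
  have away: "pair_block \<kappa> ks x j = (if x = j then pair_prod \<kappa> ks else 0)" if "x = ?a \<or> x = ?b" for x
  proof -
    have "wedge_entry (\<kappa> (2 * k')) (\<kappa> (2 * k' + 1)) x j = 0" if k': "k' \<in> set ks" for k'
    proof -
      have "k' \<noteq> k" using Cons.prems(1) k' by auto
      moreover have "2 * k' \<noteq> Suc (2 * k)" "Suc (2 * k') \<noteq> 2 * k" by presburger+
      ultimately have "\<kappa> (2 * k') \<noteq> x" "\<kappa> (2 * k' + 1) \<noteq> x"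
        using \<open>x = ?a \<or> x = ?b\<close> Cons.prems(2) by (auto simp: inj_eq)
      then show ?thesis by (simp add: wedge_entry_def)
    qed
    then show ?thesis using IH[of x j] that ab Cons.prems(5) by auto
  qed
  have "pair_block \<kappa> (k # ks) i j = (\<Sum>l=0..<n. (if l = i then e ?a ?b * pair_block \<kappa> ks l j else 0) + wedge_entry ?a ?b i l * pair_block \<kappa> ks l j)"
    unfolding pair_block.simps Suc_eq_plus1[symmetric]
    by (rule sum.cong[OF refl]) (auto simp: tensor_block_def distrib_right)
  also have "\<dots> = e ?a ?b * pair_block \<kappa> ks i j + ((if ?b = i then pair_block \<kappa> ks ?a j else 0) - (if ?a = i then pair_block \<kappa> ks ?b j else 0))"
    using Cons.prems(4) by (simp add: sum.distrib wedge_entry_sum[OF ab])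
  also have "(if ?b = i then pair_block \<kappa> ks ?a j else 0) - (if ?a = i then pair_block \<kappa> ks ?b j else 0) = wedge_entry ?a ?b i j * pair_prod \<kappa> ks"
  proof -
    have "(if b = i then (if a = j then P else 0) else 0) = (if a = j \<and> b = i then P else 0)"
      "(if a = i then (if b = j then P else 0) else 0) = (if a = i \<and> b = j then P else 0)" for a b and P :: 'r by auto
    then show ?thesis unfolding away[OF disjI1[OF refl]] away[OF disjI2[OF refl]] by (simp only: wedge_entry_mult)
  qed
  also have "e ?a ?b * pair_block \<kappa> ks i j = (if i = j then pair_prod \<kappa> (k # ks) else 0)
     + (\<Sum>k'\<in>set ks. wedge_entry (\<kappa> (2 * k')) (\<kappa> (2 * k' + 1)) i j * pair_prod \<kappa> (remove1 k' (k # ks)))"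
  proof -
    have "e ?a ?b * (wedge_entry x y i j * z) = wedge_entry x y i j * (e ?a ?b * z)" for x y z
      by (metis wedge_entry_comm mult.assoc)
    then show ?thesis
      unfolding IH[OF Cons.prems(4,5)] using Cons.prems(1)
      by (auto simp: distrib_left sum_distrib_left intro!: sum.cong)
  qed
  finally show ?case using Cons.prems(1) by (simp add: algebra_simps)
qed

text \<open>Factors with disjoint indices commute.\<close>

lemma pair_prod_perm:
  assumes s: "\<sigma> permutes {0..<n}" and ks: "set ks \<subseteq> {k. Suc (2 * k) < n}" and m: "mset ks = mset ks'"
  shows "pair_prod \<sigma> ks = pair_prod \<sigma> ks'"
  unfolding pair_prod_def
proof (rule prod_list_perm[OF m])
  fix k l assume kl: "k \<in> set ks" "l \<in> set ks"
  show "e (\<sigma> (2 * k)) (\<sigma> (2 * k + 1)) * e (\<sigma> (2 * l)) (\<sigma> (2 * l + 1))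
      = e (\<sigma> (2 * l)) (\<sigma> (2 * l + 1)) * e (\<sigma> (2 * k)) (\<sigma> (2 * k + 1))"
  proof (cases "k = l")
    case False
    have inj: "\<sigma> x = \<sigma> y \<longleftrightarrow> x = y" for x y using permutes_inj[OF s] by (simp add: inj_eq)
    have "2 * k \<noteq> Suc (2 * l)" "Suc (2 * k) \<noteq> 2 * l" by presburger+
    moreover have lt: "\<sigma> x < n" if "x < n" for x using permutes_in_image[OF s, of x] that by simp
    have "2 * k < n" "2 * k + 1 < n" "2 * l < n" "2 * l + 1 < n"
      using ks kl by (auto simp: subset_iff dest: Suc_lessD)
    note comm[OF this[THEN lt]]
    ultimately show ?thesis using False by (simp add: inj)
  qed simp
qed

lemma pair_prod_swap_pairs: "pair_prod (\<sigma> \<circ> swap_pairs a b) ks = pair_prod \<sigma> (map (transpose a b) ks)"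
  by (induction ks) auto

lemma pair_prod_swap_pairs_upt:
  assumes "\<sigma> permutes {0..<n}" "2 * m \<le> n" "a < m" "b < m"
  shows "pair_prod (\<sigma> \<circ> swap_pairs a b) [0..<m] = pair_prod \<sigma> [0..<m]"
proof -
  have "transpose a b ` {0..<m} = {0..<m}" using assms by (intro transpose_image_eq) auto
  then have "mset (map (transpose a b) [0..<m]) = mset [0..<m]"
    by (subst set_eq_iff_mset_eq_distinct[symmetric]) (auto simp: distinct_map)
  then show ?thesis unfolding pair_prod_swap_pairs
    using assms by (intro pair_prod_perm[symmetric]) auto
qed

lemma pair_prod_flip:
  assumes s: "\<sigma> permutes {0..<n}" and ks: "set ks \<subseteq> {k. Suc (2 * k) < n}" "distinct ks"
  shows "pair_prod (\<sigma> \<circ> transpose (2 * k) (Suc (2 * k))) ks = (if k \<in> set ks then - pair_prod \<sigma> ks else pair_prod \<sigma> ks)"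
  using ks
proof (induction ks)
  case (Cons l ks)
  let ?t = "transpose (2 * k) (Suc (2 * k))"
  have n: "\<sigma> x < n" if "x < n" for x using permutes_in_image[OF s, of x] that by simp
  show ?case
  proof (cases "l = k")
    case True
    then show ?thesis using Cons anti[OF n[of "2 * k"] n[of "Suc (2 * k)"]] by simp
  next
    case False
    then have "?t (2 * l) = 2 * l" "?t (Suc (2 * l)) = Suc (2 * l)"
      by (auto simp: transpose_def; presburger)+
    then show ?thesis using Cons False by auto
  qed
qed simp

lemma pair_prod_flip_upt:
  assumes "\<sigma> permutes {0..<n}" "2 * l \<le> n"
  shows "pair_prod (\<sigma> \<circ> transpose (2 * k) (Suc (2 * k))) [0..<l]
    = (if k < l then - pair_prod \<sigma> [0..<l] else pair_prod \<sigma> [0..<l])"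
proof -
  have "set [0..<l] \<subseteq> {k. Suc (2 * k) < n}" using assms(2) by auto
  from pair_prod_flip[OF assms(1) this] show ?thesis by simp
qed

lemma pf_cofactor_antisym:
  assumes n: "n = 2 * Suc m"
  shows "pf_cofactor m j i = - pf_cofactor m i j"
proof -
  let ?t = "transpose (2 * m) (Suc (2 * m))"
  have b: "2 * m < n" "Suc (2 * m) < n" "2 * m \<le> n" using n by auto
  have "pf_cofactor m j i = - alt_sum n (\<lambda>\<sigma>. if (\<sigma> \<circ> ?t) (2 * m) = j \<and> (\<sigma> \<circ> ?t) (Suc (2 * m)) = i
      then pair_prod (\<sigma> \<circ> ?t) [0..<m] else 0)"
    unfolding pf_cofactor_def n[symmetric] by (rule alt_sum_transpose) (use b in auto)
  also have "\<dots> = - pf_cofactor m i j"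
    unfolding pf_cofactor_def n[symmetric] neg_equal_iff_equal
    by (rule alt_sum_cong) (use b in \<open>simp add: pair_prod_flip_upt conj_commute\<close>)
  finally show ?thesis .
qed

text \<open>By exchanging pairs the factor that acts on \<open>\<complex>\<^sup>n\<close> can be brought to the last place, so all \<open>m + 1\<close>
  choices contribute equally; each contributes \<open>- 2\<close> cofactors, because the entries of a wedge are
  antisymmetric as well.\<close>

lemma pf_block_expand:
  assumes n: "n = 2 * Suc m" and ij: "i < n" "j < n"
  shows "pf_block (Suc m) i j = (if i = j then pfaff (Suc m) else 0) - of_nat (2 * Suc m) * pf_cofactor m i j"
proof -
  let ?M = "Suc m"
  let ?F = "\<lambda>k \<sigma>. wedge_entry (\<sigma> (2 * k)) (\<sigma> (2 * k + 1)) i j * pair_prod \<sigma> (remove1 k [0..<?M])"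
  have expand: "pair_block \<sigma> [0..<?M] i j = (if i = j then pair_prod \<sigma> [0..<?M] else 0) + (\<Sum>k=0..<?M. ?F k \<sigma>)"
    if s: "\<sigma> permutes {0..<n}" for \<sigma>
  proof -
    have "\<sigma> x < n" if "x < n" for x using permutes_in_image[OF s, of x] that by simp
    then show ?thesis using pair_block_expand[of "[0..<?M]" \<sigma> i j] ij n permutes_inj[OF s]
      by (simp del: upt_Suc)
  qed
  have last: "alt_sum n (?F m) = - (pf_cofactor m i j + pf_cofactor m i j)"
  proof -
    have "alt_sum n (?F m) = alt_sum n (\<lambda>\<sigma>. (if \<sigma> (2 * m) = j \<and> \<sigma> (Suc (2 * m)) = i then pair_prod \<sigma> [0..<m] else 0)
        - (if \<sigma> (2 * m) = i \<and> \<sigma> (Suc (2 * m)) = j then pair_prod \<sigma> [0..<m] else 0))"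
      by (rule alt_sum_cong) (simp add: wedge_entry_mult remove1_append del: pair_prod_simps)
    also have "\<dots> = pf_cofactor m j i - pf_cofactor m i j" by (simp add: alt_sum_diff pf_cofactor_def n)
    finally show ?thesis unfolding pf_cofactor_antisym[OF n, of j i] by simp
  qed
  have each: "alt_sum n (?F k) = alt_sum n (?F m)" if k: "k < ?M" for k
  proof -
    have "alt_sum n (?F k) = alt_sum n (\<lambda>\<sigma>. ?F k (\<sigma> \<circ> swap_pairs k m))"
      unfolding n by (rule alt_sum_swap_pairs) (use k in auto)
    also have "\<dots> = alt_sum n (?F m)"
    proof (rule alt_sum_cong)
      fix \<sigma> assume s: "\<sigma> permutes {0..<n}"
      have "transpose k m ` ({0..<?M} - {k}) = {0..<?M} - {m}"
      proof -
        have "transpose k m ` {0..<?M} = {0..<?M}" using k by (intro transpose_image_eq) auto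
        moreover have "transpose k m ` ({0..<?M} - {k}) = transpose k m ` {0..<?M} - transpose k m ` {k}"
          by (rule image_set_diff) simp
        ultimately show ?thesis by simp
      qed
      then have ms: "mset (map (transpose k m) (remove1 k [0..<?M])) = mset (remove1 m [0..<?M])"
        by (subst set_eq_iff_mset_eq_distinct[symmetric]) (auto simp: distinct_map simp del: upt_Suc intro!: inj_onI dest: arg_cong[of _ _ "transpose k m"])
      have "pair_prod \<sigma> (map (transpose k m) (remove1 k [0..<?M])) = pair_prod \<sigma> (remove1 m [0..<?M])"
        by (rule pair_prod_perm[OF s _ ms[symmetric], symmetric]) (auto simp: n simp del: upt_Suc)
      then show "?F k (\<sigma> \<circ> swap_pairs k m) = ?F m \<sigma>"
        by (simp add: pair_prod_swap_pairs del: upt_Suc)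
    qed
    finally show ?thesis .
  qed
  have "pf_block ?M i j = alt_sum n (\<lambda>\<sigma>. (if i = j then pair_prod \<sigma> [0..<?M] else 0) + (\<Sum>k=0..<?M. ?F k \<sigma>))"
    unfolding pf_block_def n[symmetric] by (rule alt_sum_cong[OF expand])
  also have "\<dots> = (if i = j then pfaff ?M else 0) + (\<Sum>k=0..<?M. alt_sum n (?F k))"
    unfolding alt_sum_add alt_sum_sum by (simp add: pfaff_def n alt_sum_def)
  also have "(\<Sum>k=0..<?M. alt_sum n (?F k)) = (\<Sum>k=0..<?M. - (pf_cofactor m i j + pf_cofactor m i j))"
    by (rule sum.cong[OF refl], rule trans[OF each last]) simp
  also have "\<dots> = - (of_nat (2 * ?M) * pf_cofactor m i j)" by (simp add: algebra_simps mult_2)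
  finally show ?thesis by simp
qed

text \<open>Summing over \<open>k\<close> releases the constraint on the last position.\<close>

lemma pf_cofactor_mult_e:
  assumes n: "n = 2 * Suc m"
  shows "(\<Sum>k=0..<n. pf_cofactor m i k * e k j)
    = alt_sum n (\<lambda>\<sigma>. if \<sigma> (2 * m) = i then pair_prod \<sigma> [0..<m] * e (\<sigma> (Suc (2 * m))) j else 0)"
proof -
  have "(\<Sum>k=0..<n. pf_cofactor m i k * e k j) = alt_sum n (\<lambda>\<sigma>. \<Sum>k=0..<n.
     (if \<sigma> (2 * m) = i \<and> \<sigma> (Suc (2 * m)) = k then pair_prod \<sigma> [0..<m] else 0) * e k j)"
    unfolding alt_sum_sum by (simp add: pf_cofactor_def n alt_sum_mult_right)
  also have "\<dots> = alt_sum n (\<lambda>\<sigma>. if \<sigma> (2 * m) = i then pair_prod \<sigma> [0..<m] * e (\<sigma> (Suc (2 * m))) j else 0)"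
  proof (rule alt_sum_cong)
    fix \<sigma> assume s: "\<sigma> permutes {0..<n}"
    have "\<sigma> (Suc (2 * m)) < n" using permutes_in_image[OF s, of "Suc (2 * m)"] n by simp
    moreover have "(if \<sigma> (2 * m) = i \<and> \<sigma> (Suc (2 * m)) = k then pair_prod \<sigma> [0..<m] else 0) * e k j
      = (if \<sigma> (Suc (2 * m)) = k then (if \<sigma> (2 * m) = i then pair_prod \<sigma> [0..<m] * e k j else 0) else 0)" for k
      by simp
    ultimately show "(\<Sum>k=0..<n. (if \<sigma> (2 * m) = i \<and> \<sigma> (Suc (2 * m)) = k then pair_prod \<sigma> [0..<m] else 0) * e k j)
       = (if \<sigma> (2 * m) = i then pair_prod \<sigma> [0..<m] * e (\<sigma> (Suc (2 * m))) j else 0)"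
      by simp
  qed
  finally show ?thesis .
qed

text \<open>Expansion of the Pfaffian along row \<open>i\<close>: the index \<open>i\<close> occurs at one of \<open>2 m + 2\<close> positions, which
  contribute equally, and the last pair is split off.\<close>

lemma pf_cofactor_expand_diag:
  assumes n: "n = 2 * Suc m" and i: "i < n"
  shows "of_nat (2 * Suc m) * (\<Sum>k=0..<n. pf_cofactor m i k * e k i) = - pfaff (Suc m)"
proof -
  let ?M = "Suc m"
  have le: "2 * ?M \<le> n" using n by simp
  define H where "H p = alt_sum n (\<lambda>\<sigma>. if \<sigma> p = i then pair_prod \<sigma> [0..<?M] else 0)" for p
  have 1: "(\<Sum>k=0..<n. pf_cofactor m i k * e k i) = - H (2 * m)"
    unfolding pf_cofactor_mult_e[OF n] H_def alt_sum_minus[symmetric]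
  proof (rule alt_sum_cong)
    fix \<sigma> assume s: "\<sigma> permutes {0..<n}"
    have "\<sigma> (Suc (2 * m)) < n" using permutes_in_image[OF s, of "Suc (2 * m)"] n by simp
    then show "(if \<sigma> (2 * m) = i then pair_prod \<sigma> [0..<m] * e (\<sigma> (Suc (2 * m))) i else 0)
       = - (if \<sigma> (2 * m) = i then pair_prod \<sigma> [0..<?M] else 0)"
      using anti[of i "\<sigma> (Suc (2 * m))"] i by auto
  qed
  have "pfaff ?M = alt_sum n (\<lambda>\<sigma>. \<Sum>p<2 * ?M. if \<sigma> p = i then pair_prod \<sigma> [0..<?M] else 0)"
    unfolding pfaff_def n[symmetric]
  proof (rule alt_sum_cong)
    fix \<sigma> assume s: "\<sigma> permutes {0..<n}"
    have "inv_into UNIV \<sigma> i < n" using permutes_in_image[OF permutes_inv[OF s], of i] i by simp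
    moreover have "\<sigma> p = i \<longleftrightarrow> p = inv_into UNIV \<sigma> i" for p using s by (auto simp: permutes_inverses)
    ultimately show "pair_prod \<sigma> [0..<?M] = (\<Sum>p<n. if \<sigma> p = i then pair_prod \<sigma> [0..<?M] else 0)"
      by (simp del: upt_Suc)
  qed
  also have "\<dots> = of_nat (2 * ?M) * H (2 * m)"
    unfolding alt_sum_sum H_def n
    by (rule alt_sum_position) (use le n in \<open>simp_all add: pair_prod_swap_pairs_upt pair_prod_flip_upt del: upt_Suc\<close>)
  finally show ?thesis unfolding 1 by simp
qed

text \<open>For commuting entries this is the expansion of a Pfaffian with two equal rows and vanishes.  Here
  the two entries \<open>e\<^sub>j\<^sub>x\<close> and \<open>e\<^sub>j\<^sub>y\<close> of row \<open>j\<close> have the bracket \<open>\<plusminus> e\<^sub>x\<^sub>y\<close>, and antisymmetrising in \<open>x\<close> and \<open>y\<close>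
  leaves half of it for each of the \<open>2 m\<close> positions at which \<open>j\<close> can occur.\<close>

lemma pf_cofactor_expand_off_diag:
  assumes n: "n = 2 * Suc m" and i: "i < n" and j: "j < n" and ij: "i \<noteq> j"
  shows "(\<Sum>k=0..<n. pf_cofactor m i k * e k j) = - (of_nat m * pf_cofactor m i j)"
proof -
  have le: "2 * m \<le> n" using n by simp
  let ?X = "\<lambda>\<sigma>. pair_prod \<sigma> [0..<m] * e (\<sigma> (Suc (2 * m))) j"
  let ?Y = "\<lambda>\<sigma>. if \<sigma> (2 * m) = i then ?X \<sigma> else 0"
  define K where "K p = alt_sum n (\<lambda>\<sigma>. if \<sigma> p = j then ?Y \<sigma> else 0)" for p
  have 1: "(\<Sum>k=0..<n. pf_cofactor m i k * e k j) = (\<Sum>p<2 * m. K p)"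
  proof -
    have "?Y \<sigma> = (\<Sum>p<2 * m. if \<sigma> p = j then ?Y \<sigma> else 0)"
      if s: "\<sigma> permutes {0..<n}" for \<sigma>
    proof (cases "\<sigma> (2 * m) = i")
      case True
      define q where "q = inv_into UNIV \<sigma> j"
      have q: "q < n" using permutes_in_image[OF permutes_inv[OF s], of j] j by (simp add: q_def)
      have qj: "\<sigma> p = j \<longleftrightarrow> p = q" for p using s by (auto simp: permutes_inverses q_def)
      have "q \<noteq> 2 * m" using True qj ij by auto
      show ?thesis
      proof (cases "q < 2 * m")
        case True
        then show ?thesis by (simp add: qj)
      next
        case False
        then have "q = Suc (2 * m)" using q \<open>q \<noteq> 2 * m\<close> n by simp
        then have "\<sigma> (Suc (2 * m)) = j" using qj by simp
        then have "?X \<sigma> = 0" using e_diag[OF j] by simp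
        then show ?thesis by simp
      qed
    qed simp
    then show ?thesis unfolding pf_cofactor_mult_e[OF n] K_def alt_sum_sum[symmetric]
      by (intro alt_sum_cong)
  qed
  show ?thesis
  proof (cases m)
    case 0
    then show ?thesis using 1 by simp
  next
    case (Suc m')
    let ?C = "\<lambda>\<sigma>. \<sigma> (2 * m) = i \<and> \<sigma> (2 * m') = j"
    let ?x = "\<lambda>\<sigma>. \<sigma> (Suc (2 * m))" and ?y = "\<lambda>\<sigma>. \<sigma> (Suc (2 * m'))"
    let ?P = "\<lambda>\<sigma>. pair_prod \<sigma> [0..<m']"
    have pos: "2 * m' < n" "Suc (2 * m') < n" "2 * m < n" "Suc (2 * m) < n" using n Suc by auto
    have P: "?P (\<sigma> \<circ> transpose a b) = ?P \<sigma>" if "2 * m' \<le> a" "2 * m' \<le> b" for \<sigma> a b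
      by (rule pair_prod_cong) (use that in \<open>auto simp: transpose_def\<close>)
    have K1: "K (2 * m') = alt_sum n (\<lambda>\<sigma>. if ?C \<sigma> then ?P \<sigma> * (e j (?y \<sigma>) * e (?x \<sigma>) j) else 0)"
      unfolding K_def by (rule alt_sum_cong) (auto simp: Suc mult.assoc)
    also have "\<dots> = - alt_sum n (\<lambda>\<sigma>. if ?C \<sigma> then ?P \<sigma> * (e j (?x \<sigma>) * e (?y \<sigma>) j) else 0)"
      by (subst alt_sum_transpose[of "Suc (2 * m')" n "Suc (2 * m)"])
         (use pos Suc P in \<open>auto intro!: alt_sum_cong simp del: upt_Suc\<close>)
    finally have K2: "K (2 * m') = - alt_sum n (\<lambda>\<sigma>. if ?C \<sigma> then ?P \<sigma> * (e j (?x \<sigma>) * e (?y \<sigma>) j) else 0)" .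
    (* antisymmetrising in x and y produces the bracket of two entries of row j *)
    have "K (2 * m') + K (2 * m') = alt_sum n (\<lambda>\<sigma>. (if ?C \<sigma> then ?P \<sigma> * (e j (?y \<sigma>) * e (?x \<sigma>) j) else 0)
        - (if ?C \<sigma> then ?P \<sigma> * (e j (?x \<sigma>) * e (?y \<sigma>) j) else 0))"
      unfolding alt_sum_diff using K1 K2 by simp
    also have "\<dots> = - alt_sum n (\<lambda>\<sigma>. if ?C \<sigma> then ?P \<sigma> * e (?y \<sigma>) (?x \<sigma>) else 0)"
      unfolding alt_sum_minus[symmetric]
    proof (rule alt_sum_cong)
      fix \<sigma> assume s: "\<sigma> permutes {0..<n}"
      have inj: "\<sigma> x = \<sigma> y \<longleftrightarrow> x = y" for x y using permutes_inj[OF s] by (simp add: inj_eq)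
      have lt: "\<sigma> x < n" if "x < n" for x using permutes_in_image[OF s, of x] that by simp
      have "e j (?y \<sigma>) * e (?x \<sigma>) j - e j (?x \<sigma>) * e (?y \<sigma>) j = - e (?y \<sigma>) (?x \<sigma>)" if "\<sigma> (2 * m') = j"
      proof -
        have "?x \<sigma> \<noteq> j" "?y \<sigma> \<noteq> j" "?x \<sigma> \<noteq> ?y \<sigma>"
          unfolding that[symmetric] inj using Suc by auto
        then have "e j (?y \<sigma>) * e j (?x \<sigma>) - e j (?x \<sigma>) * e j (?y \<sigma>) = e (?y \<sigma>) (?x \<sigma>)"
          using comm[OF j lt[OF pos(2)] j lt[OF pos(4)]] by simp
        then show ?thesis using anti[OF j lt[OF pos(2)]] anti[OF j lt[OF pos(4)]] by (simp add: algebra_simps)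
      qed
      then show "(if ?C \<sigma> then ?P \<sigma> * (e j (?y \<sigma>) * e (?x \<sigma>) j) else 0)
        - (if ?C \<sigma> then ?P \<sigma> * (e j (?x \<sigma>) * e (?y \<sigma>) j) else 0) = - (if ?C \<sigma> then ?P \<sigma> * e (?y \<sigma>) (?x \<sigma>) else 0)"
        by (auto simp: right_diff_distrib[symmetric])
    qed
    also have "alt_sum n (\<lambda>\<sigma>. if ?C \<sigma> then ?P \<sigma> * e (?y \<sigma>) (?x \<sigma>) else 0) = pf_cofactor m i j"
    proof -
      have "alt_sum n (\<lambda>\<sigma>. if ?C \<sigma> then ?P \<sigma> * e (?y \<sigma>) (?x \<sigma>) else 0)
        = - alt_sum n (\<lambda>\<sigma>. if \<sigma> (2 * m) = i \<and> \<sigma> (Suc (2 * m)) = j then ?P \<sigma> * e (?y \<sigma>) (\<sigma> (2 * m')) else 0)"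
        by (subst alt_sum_transpose[of "2 * m'" n "Suc (2 * m)"])
           (use pos Suc P in \<open>auto intro!: alt_sum_cong simp del: upt_Suc\<close>)
      also have "\<dots> = pf_cofactor m i j"
        unfolding pf_cofactor_def n[symmetric] alt_sum_minus[symmetric]
      proof (rule alt_sum_cong)
        fix \<sigma> assume s: "\<sigma> permutes {0..<n}"
        have lt: "\<sigma> x < n" if "x < n" for x using permutes_in_image[OF s, of x] that by simp
        show "- (if \<sigma> (2 * m) = i \<and> \<sigma> (Suc (2 * m)) = j then ?P \<sigma> * e (?y \<sigma>) (\<sigma> (2 * m')) else 0)
          = (if \<sigma> (2 * m) = i \<and> \<sigma> (Suc (2 * m)) = j then pair_prod \<sigma> [0..<m] else 0)"
          using anti[OF lt[OF pos(1)] lt[OF pos(2)]] by (simp add: Suc)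
      qed
      finally show ?thesis .
    qed
    finally have KK: "K (2 * m') + K (2 * m') = - pf_cofactor m i j" .
    have "(\<Sum>p<2 * m. K p) = of_nat (2 * m) * K (2 * m')"
      unfolding K_def n
    proof (rule alt_sum_position)
      fix \<sigma> a assume \<sigma>: "\<sigma> permutes {0..<2 * Suc m}" and a: "a < m"
      note p = \<sigma>[folded n]
      have "transpose (2 * a) (Suc (2 * a)) (2 * m) = 2 * m" "transpose (2 * a) (Suc (2 * a)) (Suc (2 * m)) = Suc (2 * m)"
        using a by (auto simp: transpose_def)
      then show "?Y (\<sigma> \<circ> transpose (2 * a) (Suc (2 * a))) = - ?Y \<sigma>"
        using pair_prod_flip_upt[OF p le, of a] a by simp
      fix b assume b: "b < m"
      have "swap_pairs a b (2 * m) = 2 * m" "swap_pairs a b (Suc (2 * m)) = Suc (2 * m)"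
        using a b by (auto simp: transpose_def)
      then show "?Y (\<sigma> \<circ> swap_pairs a b) = ?Y \<sigma>"
        using pair_prod_swap_pairs_upt[OF p le a b] by (simp del: swap_pairs_even swap_pairs_odd)
    qed (use Suc in auto)
    also have "\<dots> = of_nat m * (K (2 * m') + K (2 * m'))" by (simp add: algebra_simps mult_2)
    also have "\<dots> = - (of_nat m * pf_cofactor m i j)" unfolding KK by simp
    finally show ?thesis using 1 by simp
  qed
qed

theorem pf_block_sym:
  assumes "n = 2 * Suc m" "i < n" "j < n"
  shows "pf_block (Suc m) i j + pf_block (Suc m) j i = (if i = j then 2 * pfaff (Suc m) else 0)"
  unfolding pf_block_expand[OF assms] pf_block_expand[OF assms(1,3,2)] pf_cofactor_antisym[OF assms(1), of j i]
  by (simp add: algebra_simps mult_2)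

lemma pf_block_mult_e:
  assumes n: "n = 2 * Suc m" and ij: "i < n" "j < n"
  shows "(\<Sum>k=0..<n. pf_block (Suc m) i k * e k j)
    = pfaff (Suc m) * e i j + (if i = j then pfaff (Suc m) else 0) + of_nat (2 * Suc m) * (of_nat m * pf_cofactor m i j)"
proof -
  have "(\<Sum>k=0..<n. pf_block (Suc m) i k * e k j)
     = (\<Sum>k=0..<n. (if i = k then pfaff (Suc m) * e k j else 0) - of_nat (2 * Suc m) * (pf_cofactor m i k * e k j))"
    using pf_block_expand[OF n ij(1)] by (intro sum.cong refl) (simp add: left_diff_distrib mult.assoc)
  also have "\<dots> = pfaff (Suc m) * e i j - of_nat (2 * Suc m) * (\<Sum>k=0..<n. pf_cofactor m i k * e k j)"
    using ij by (simp add: sum_subtractf sum_distrib_left)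
  finally have F: "(\<Sum>k=0..<n. pf_block (Suc m) i k * e k j) = \<dots>" .
  show ?thesis
  proof (cases "i = j")
    case True
    have "pf_cofactor m i i + pf_cofactor m i i = 0" using pf_cofactor_antisym[OF n, of i i] by (metis add.right_inverse)
    then have "2 *\<^sub>R pf_cofactor m i i = 0" by (simp only: scaleR_2)
    then have "pf_cofactor m i i = 0" by simp
    then show ?thesis using F pf_cofactor_expand_diag[OF n ij(1)] True by simp
  next
    case False
    then show ?thesis unfolding F pf_cofactor_expand_off_diag[OF n ij False] by (simp add: algebra_simps)
  qed
qed

text \<open>By the two expansions the product is \<open>pf \<cdot> (e\<^sub>i\<^sub>j + \<delta>\<^sub>i\<^sub>j)\<close> up to a multiple of the antisymmetric matrix of
  cofactors, and subtracting the block itself removes \<open>pf \<cdot> \<delta>\<^sub>i\<^sub>j\<close>.\<close>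

theorem pf_block_mult_e_antisym:
  assumes n: "n = 2 * Suc m" and ij: "i < n" "j < n"
  shows "((\<Sum>k=0..<n. pf_block (Suc m) i k * e k j) - pf_block (Suc m) i j)
       + ((\<Sum>k=0..<n. pf_block (Suc m) j k * e k i) - pf_block (Suc m) j i) = 0"
  unfolding pf_block_mult_e[OF n ij] pf_block_mult_e[OF n ij(2,1)] pf_block_expand[OF n ij] pf_block_expand[OF n ij(2,1)]
    pf_cofactor_antisym[OF n, of j i] anti[OF ij]
  by (simp add: algebra_simps)

end

section \<open>The Casimir element\<close>

text \<open>The unordered pairs of indices, sorted by the plane \<open>{2 j, 2 j + 1}\<close> that contains the smaller index.\<close>

lemma sum_symmetric_pairs:
  fixes Q :: "nat \<Rightarrow> nat \<Rightarrow> 'a :: comm_ring_1"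
  assumes sym: "\<And>a b. \<lbrakk>a < n; b < n\<rbrakk> \<Longrightarrow> Q a b = Q b a" and diag: "\<And>a. a < n \<Longrightarrow> Q a a = 0"
  shows "(\<Sum>a=0..<n. \<Sum>b=0..<n. Q a b)
    = 2 * (\<Sum>j=0..<n div 2. Q (2 * j) (Suc (2 * j)) + (\<Sum>l=2 * j + 2..<n. Q (2 * j) l + Q (Suc (2 * j)) l))"
proof -
  define S where "S k = (\<Sum>a=k..<n. \<Sum>b=k..<n. Q a b)" for k
  have peel: "S k = S (Suc k) + 2 * (\<Sum>l=Suc k..<n. Q k l)" if k: "k < n" for k
  proof -
    have s: "sum F {k..<n} = F k + sum F {Suc k..<n}" for F :: "nat \<Rightarrow> 'a"
      using k by (rule sum.atLeast_Suc_lessThan)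
    have "S k = (\<Sum>b=Suc k..<n. Q k b) + ((\<Sum>a=Suc k..<n. Q a k) + S (Suc k))"
      unfolding S_def s by (simp add: diag[OF k] sum.distrib)
    also have "(\<Sum>a=Suc k..<n. Q a k) = (\<Sum>b=Suc k..<n. Q k b)"
      by (rule sum.cong[OF refl], rule sym) (use k in auto)
    finally show ?thesis by (simp add: algebra_simps)
  qed
  have "S (2 * k) = 2 * (\<Sum>j=k..<n div 2. Q (2 * j) (Suc (2 * j)) + (\<Sum>l=2 * j + 2..<n. Q (2 * j) l + Q (Suc (2 * j)) l))"
    if "k \<le> n div 2" for k
    using that
  proof (induction rule: inc_induct)
    case base
    show ?case
    proof (cases "even n")
      case False
      then have "{2 * (n div 2)..<n} = {2 * (n div 2)}" "2 * (n div 2) < n" by (auto elim!: oddE)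
      then show ?thesis using diag[of "2 * (n div 2)"] by (simp add: S_def)
    qed (simp add: S_def)
  next
    case (step k)
    then have lt: "2 * k < n" "Suc (2 * k) < n" by auto
    have "S (2 * k) = S (2 * Suc k) + 2 * (\<Sum>l\<in>{Suc (Suc (2 * k))..<n}. Q (Suc (2 * k)) l)
       + 2 * (Q (2 * k) (Suc (2 * k)) + (\<Sum>l\<in>{Suc (Suc (2 * k))..<n}. Q (2 * k) l))"
      using peel[OF lt(1)] peel[OF lt(2)]
        sum.atLeast_Suc_lessThan[OF lt(2), of "Q (2 * k)"] by simp
    then show ?case unfolding sum.atLeast_Suc_lessThan[OF step.hyps(2)] using step.IH
      by (simp add: sum.distrib algebra_simps)
  qed
  from this[of 0] show ?thesis by (simp add: S_def)
qed

context so_family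
begin

text \<open>As the sum runs over ordered pairs, this is \<open>- 2\<close> times the positive Casimir element.\<close>

definition casimir :: 'r where
  "casimir = (\<Sum>a=0..<n. \<Sum>b=0..<n. e a b * e a b)"

lemma casimir_central: "\<lbrakk>i < n; j < n\<rbrakk> \<Longrightarrow> e i j * casimir = casimir * e i j"
proof -
  assume b: "i < n" "j < n"
  have "casimir = - (\<Sum>a=0..<n. \<Sum>b=0..<n. e a b * e b a)"
    unfolding casimir_def sum_negf[symmetric] by (intro sum.cong refl) (metis anti atLeastLessThan_iff mult_minus_right minus_minus)
  then show ?thesis using trace_central[OF equivariant_mult[OF equivariant_e equivariant_e] b] by simp
qed

text \<open>The blocks of the Casimir element on \<open>V \<otimes> \<complex>\<^sup>n\<close>: the Casimir elements of both tensor factors, and a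
  mixed term which is a multiple of the matrix \<open>(e\<^sub>i\<^sub>j)\<close> itself.\<close>

lemma tensor_casimir:
  assumes ij: "i < n" "j < n"
  shows "(\<Sum>a=0..<n. \<Sum>b=0..<n. \<Sum>l=0..<n. tensor_block a b i l * tensor_block a b l j)
    = (if i = j then casimir - of_real (2 * (real n - 1)) else 0) - 4 * e i j"
proof -
  have d: "(\<Sum>a=0..<n. if a = x then F a else 0) = F x" "(\<Sum>a=0..<n. if x = a then F a else 0) = F x"
    if "x < n" for x and F :: "nat \<Rightarrow> 'r"
    using that by simp_all
  have c: "(\<Sum>s=0..<n. if P then F s else 0) = (if P then \<Sum>s=0..<n. F s else 0)" for P and F :: "nat \<Rightarrow> 'r"
    by simp
  have inner: "(\<Sum>l=0..<n. tensor_block a b i l * tensor_block a b l j)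
      = (if i = j then e a b * e a b else 0) + e a b * wedge_entry a b i j
        + (if b = i then tensor_block a b a j else 0) - (if a = i then tensor_block a b b j else 0)"
    if "a < n" "b < n" for a b
  proof -
    have "(\<Sum>l=0..<n. tensor_block a b i l * tensor_block a b l j)
      = (\<Sum>l=0..<n. (if i = l then e a b * tensor_block a b l j else 0) + wedge_entry a b i l * tensor_block a b l j)"
      by (rule sum.cong[OF refl]) (simp add: tensor_block_def[of a b i] distrib_right)
    also have "\<dots> = e a b * tensor_block a b i j + ((if b = i then tensor_block a b a j else 0) - (if a = i then tensor_block a b b j else 0))"
      unfolding sum.distrib d[OF ij(1)] wedge_entry_sum[OF that] ..
    also have "e a b * tensor_block a b i j = (if i = j then e a b * e a b else 0) + e a b * wedge_entry a b i j"
      by (simp add: tensor_block_def distrib_left)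
    finally show ?thesis by simp
  qed
  have f1: "(\<Sum>a=0..<n. \<Sum>b=0..<n. e a b * wedge_entry a b i j) = e j i - e i j"
  proof -
    have "e a b * wedge_entry a b i j = (if a = j then if b = i then e a b else 0 else 0) - (if a = i then if b = j then e a b else 0 else 0)" for a b
    proof -
      have g: "(if P \<and> Q then x else 0) = (if P then if Q then x else 0 else 0)" for P Q and x :: 'r by simp
      show ?thesis unfolding wedge_entry_comm[symmetric] wedge_entry_mult g ..
    qed
    then show ?thesis
      by (simp only: sum_subtractf c d ij)
  qed
  have n1: "(\<Sum>a=0..<n. 1) = (of_nat n :: 'r)" by simp
  have f2: "(\<Sum>a=0..<n. tensor_block a i a j) = e j i + (if i = j then 1 - of_nat n else 0)"
  proof -
    have "tensor_block a i a j = (if a = j then e a i else 0) + ((if a = j then if i = j then 1 else 0 else 0) - (if i = j then 1 else 0))" for a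
      unfolding tensor_block_def wedge_entry_def by (cases "a = j") auto
    then show ?thesis by (simp only: sum.distrib sum_subtractf d[OF ij(2)] c n1) simp
  qed
  have f3: "(\<Sum>b=0..<n. tensor_block i b b j) = e i j + (if i = j then of_nat n - 1 else 0)"
  proof -
    have "tensor_block i b b j = (if b = j then e i b else 0) + ((if i = j then 1 else 0) - (if b = j then if i = j then 1 else 0 else 0))" for b
      unfolding tensor_block_def wedge_entry_def by (cases "b = j") auto
    then show ?thesis by (simp only: sum.distrib sum_subtractf d[OF ij(2)] c n1) simp
  qed
  have "(\<Sum>a=0..<n. \<Sum>b=0..<n. \<Sum>l=0..<n. tensor_block a b i l * tensor_block a b l j)
    = (\<Sum>a=0..<n. \<Sum>b=0..<n. (if i = j then e a b * e a b else 0) + e a b * wedge_entry a b i j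
        + (if b = i then tensor_block a b a j else 0) - (if a = i then tensor_block a b b j else 0))"
    by (intro sum.cong refl inner) auto
  also have "\<dots> = (if i = j then casimir else 0) + (e j i - e i j) + (\<Sum>a=0..<n. tensor_block a i a j) - (\<Sum>b=0..<n. tensor_block i b b j)"
    by (simp only: sum.distrib sum_subtractf c d ij f1 casimir_def)
  also have "\<dots> = (if i = j then casimir - of_real (2 * (real n - 1)) else 0) - 4 * e i j"
  proof -
    have four: "4 * x = x + x + (x + x)" for x :: 'r
      by (simp only: numeral_Bit0 numeral_One distrib_right mult_1_left)
    have two: "of_real (2 * (real n - 1)) = (of_nat n + of_nat n - (1 + 1) :: 'r)"
    proof -
      have "2 * (real n - 1) = real n + real n - (1 + 1)" by simp
      then show ?thesis by (simp only: of_real_add of_real_diff of_real_of_nat_eq of_real_1)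
    qed
    show ?thesis unfolding f2 f3 anti[OF ij] four two by (simp add: algebra_simps)
  qed
  finally show ?thesis .
qed

end

section \<open>Linear operators and matrices\<close>

lemma msum_carrier: "\<lbrakk>finite S; \<And>s. s \<in> S \<Longrightarrow> A s \<in> carrier_mat r c\<rbrakk> \<Longrightarrow> msum r c A S \<in> carrier_mat r c"
proof -
  interpret M: abelian_group "module_mat TYPE(complex) r c" by (rule abelian_group_mat)
  show "\<lbrakk>finite S; \<And>s. s \<in> S \<Longrightarrow> A s \<in> carrier_mat r c\<rbrakk> \<Longrightarrow> msum r c A S \<in> carrier_mat r c"
    using M.finsum_closed[of A S] by (auto simp: module_mat_simps)
qed

lemma msum_insert:
  assumes "finite S" "x \<notin> S" "\<And>s. s \<in> insert x S \<Longrightarrow> A s \<in> carrier_mat r c"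
  shows "msum r c A (insert x S) = A x + msum r c A S"
proof -
  interpret M: abelian_group "module_mat TYPE(complex) r c" by (rule abelian_group_mat)
  show ?thesis using M.finsum_insert[OF assms(1,2), of A] assms(3) by (auto simp: module_mat_simps)
qed

lemma msum_empty: "msum r c A {} = 0\<^sub>m r c"
proof -
  interpret M: abelian_group "module_mat TYPE(complex) r c" by (rule abelian_group_mat)
  show ?thesis using M.finsum_empty by (simp add: module_mat_simps)
qed

lemma index_msum:
  assumes "finite S" "\<And>s. s \<in> S \<Longrightarrow> A s \<in> carrier_mat r c" "i < r" "j < c"
  shows "msum r c A S $$ (i, j) = (\<Sum>s\<in>S. A s $$ (i, j))"
  using assms(1,2)
proof (induction S rule: finite_induct)
  case (insert x S)
  then have "msum r c A S \<in> carrier_mat r c" by (intro msum_carrier) auto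
  then show ?case using insert assms(3,4) by (subst msum_insert) auto
qed (use assms(3,4) in \<open>simp add: msum_empty\<close>)

text \<open>Sequences rather than vectors of a fixed length: these operators form one algebra, which contains
  the matrices of all sizes.\<close>

typedef lin_op = "{f :: (nat \<Rightarrow> complex) \<Rightarrow> nat \<Rightarrow> complex.
    (\<forall>x y. f (\<lambda>i. x i + y i) = (\<lambda>i. f x i + f y i)) \<and> (\<forall>c x. f (\<lambda>i. c * x i) = (\<lambda>i. c * f x i))}"
  morphisms app Lin_op
  by (rule exI[of _ "\<lambda>x. x"]) simp

setup_lifting type_definition_lin_op

lemma app_scale: "app X (\<lambda>i. c * x i) = (\<lambda>i. c * app X x i)"
  using app[of X] by simp

instantiation lin_op :: real_algebra_1
begin

lift_definition zero_lin_op :: lin_op is "\<lambda>x i. 0" by simp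
lift_definition one_lin_op :: lin_op is "\<lambda>x. x" by simp
lift_definition plus_lin_op :: "lin_op \<Rightarrow> lin_op \<Rightarrow> lin_op" is "\<lambda>f g x i. f x i + g x i"
  by (simp add: algebra_simps)
lift_definition minus_lin_op :: "lin_op \<Rightarrow> lin_op \<Rightarrow> lin_op" is "\<lambda>f g x i. f x i - g x i"
  by (simp add: algebra_simps)
lift_definition uminus_lin_op :: "lin_op \<Rightarrow> lin_op" is "\<lambda>f x i. - f x i"
  by simp
lift_definition times_lin_op :: "lin_op \<Rightarrow> lin_op \<Rightarrow> lin_op" is "\<lambda>f g x. f (g x)"
  by simp
lift_definition scaleR_lin_op :: "real \<Rightarrow> lin_op \<Rightarrow> lin_op" is "\<lambda>r f x i. complex_of_real r * f x i"
  by (simp add: algebra_simps)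

instance
proof
  fix a b c :: lin_op and r s :: real
  show "(0 :: lin_op) \<noteq> 1"
    by transfer (metis zero_neq_one)
qed (transfer; simp add: fun_eq_iff algebra_simps)+

end

text \<open>Complex scalars as operators; the real algebra structure only provides the real ones.\<close>

lift_definition cscale :: "complex \<Rightarrow> lin_op" is "\<lambda>c x i. c * x i"
  by (simp add: algebra_simps)

lemma app_simps [simp]:
  "app 0 x = (\<lambda>i. 0)" "app 1 x = x" "app (X + Y) x = (\<lambda>i. app X x i + app Y x i)"
  "app (X - Y) x = (\<lambda>i. app X x i - app Y x i)" "app (- X) x = (\<lambda>i. - app X x i)"
  "app (X * Y) x = app X (app Y x)" "app (cscale c) x = (\<lambda>i. c * x i)"
  "app (r *\<^sub>R X) x = (\<lambda>i. complex_of_real r * app X x i)"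
  by (transfer; simp)+

lemma lin_op_eqI: "(\<And>x i. app X x i = app Y x i) \<Longrightarrow> X = Y"
  by transfer (simp add: fun_eq_iff)

lemma cscale_comm: "cscale c * X = X * cscale c"
  by (rule lin_op_eqI) (simp add: app_scale)

lemma cscale_hom: "cscale (a * b) = cscale a * cscale b" "cscale (a + b) = cscale a + cscale b"
  "cscale (- a) = - cscale a" "cscale 1 = 1" "cscale 0 = 0" "cscale (of_real r) = of_real r"
  by (rule lin_op_eqI; simp add: algebra_simps of_real_def)+

lemma app_sum: "app (\<Sum>i\<in>S. X i) x = (\<lambda>j. \<Sum>i\<in>S. app (X i) x j)"
  by (induction S rule: infinite_finite_induct) simp_all

definition vfun :: "complex vec \<Rightarrow> nat \<Rightarrow> complex" where
  "vfun v = (\<lambda>i. if i < dim_vec v then v $ i else 0)"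

lemma vfun_inject: "\<lbrakk>v \<in> carrier_vec N; w \<in> carrier_vec N\<rbrakk> \<Longrightarrow> vfun v = vfun w \<longleftrightarrow> v = w"
  by (auto simp: vfun_def fun_eq_iff intro!: eq_vecI)

lemma vfun_add: "\<lbrakk>v \<in> carrier_vec N; w \<in> carrier_vec N\<rbrakk> \<Longrightarrow> vfun (v + w) = (\<lambda>i. vfun v i + vfun w i)"
  by (auto simp: vfun_def)

lemma vfun_smult: "vfun (c \<cdot>\<^sub>v v) = (\<lambda>i. c * vfun v i)"
  by (auto simp: vfun_def)

lemma vfun_zero: "vfun (0\<^sub>v N) = (\<lambda>i. 0)"
  by (auto simp: vfun_def)

text \<open>The operator leaves the vectors of length \<open>N\<close> invariant and restricts to the matrix \<open>A\<close> there.  What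
  it does elsewhere is left open, so that the identity operator acts as the identity matrix.\<close>

definition acts :: "nat \<Rightarrow> lin_op \<Rightarrow> complex mat \<Rightarrow> bool" where
  "acts N X A \<longleftrightarrow> A \<in> carrier_mat N N \<and> (\<forall>v \<in> carrier_vec N. app X (vfun v) = vfun (A *\<^sub>v v))"

lemma acts_carrier: "acts N X A \<Longrightarrow> A \<in> carrier_mat N N"
  by (simp add: acts_def)

lemma acts_app: "\<lbrakk>acts N X A; v \<in> carrier_vec N\<rbrakk> \<Longrightarrow> app X (vfun v) = vfun (A *\<^sub>v v)"
  by (simp add: acts_def)

lemma mat_eq_by_vec:
  fixes A B :: "'a :: comm_ring_1 mat"
  assumes A: "A \<in> carrier_mat r c" and B: "B \<in> carrier_mat r c"
    and eq: "\<And>v. v \<in> carrier_vec c \<Longrightarrow> A *\<^sub>v v = B *\<^sub>v v"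
  shows "A = B"
proof (rule eq_matI)
  fix i j assume "i < dim_row B" "j < dim_col B"
  then have ij: "i < r" "j < c" using B by auto
  have "(A *\<^sub>v unit_vec c j) $ i = (B *\<^sub>v unit_vec c j) $ i" using eq by simp
  then show "A $$ (i, j) = B $$ (i, j)" using ij A B by simp
qed (use A B in auto)

lemma acts_unique: "\<lbrakk>acts N X A; acts N X B\<rbrakk> \<Longrightarrow> A = B"
  by (rule mat_eq_by_vec[of _ N N]) (auto simp: acts_def vfun_inject[of _ N] dest!: bspec)

lemma smult_mat_vec: "\<lbrakk>A \<in> carrier_mat N M; v \<in> carrier_vec M\<rbrakk> \<Longrightarrow> (c \<cdot>\<^sub>m A) *\<^sub>v v = c \<cdot>\<^sub>v (A *\<^sub>v v)"
  for c :: "'a :: comm_ring_1"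
  by (intro eq_vecI) (auto simp: scalar_prod_def sum_distrib_left mult.assoc)

lemma zero_mat_vec: "v \<in> carrier_vec M \<Longrightarrow> 0\<^sub>m N M *\<^sub>v v = 0\<^sub>v N"
  for v :: "'a :: comm_ring_1 vec"
  by (intro eq_vecI) (auto simp: scalar_prod_def)

lemma acts_add: "\<lbrakk>acts N X A; acts N Y B\<rbrakk> \<Longrightarrow> acts N (X + Y) (A + B)"
  by (auto simp: acts_def add_mult_distrib_mat_vec[of _ N N] vfun_add[of _ N])

lemma acts_smult: "acts N X A \<Longrightarrow> acts N (cscale c * X) (c \<cdot>\<^sub>m A)"
  by (auto simp: acts_def smult_mat_vec[of _ N N] vfun_smult)

lemma acts_mult: "\<lbrakk>acts N X A; acts N Y B\<rbrakk> \<Longrightarrow> acts N (X * Y) (A * B)"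
  by (auto simp: acts_def assoc_mult_mat_vec[of _ N N _ N])

lemma acts_one: "acts N 1 (1\<^sub>m N)"
  by (simp add: acts_def)

lemma acts_cscale: "acts N (cscale c) (c \<cdot>\<^sub>m 1\<^sub>m N)"
  using acts_smult[OF acts_one] by simp

lemma acts_zero: "acts N 0 (0\<^sub>m N N)"
  by (auto simp: acts_def vfun_zero zero_mat_vec)

lemma acts_msum:
  assumes "finite S" "\<And>i. i \<in> S \<Longrightarrow> acts N (X i) (A i)"
  shows "acts N (\<Sum>i\<in>S. X i) (msum N N A S)"
  using assms
proof (induction S rule: finite_induct)
  case (insert i S)
  then have "msum N N A (insert i S) = A i + msum N N A S"
    by (intro msum_insert) (auto dest: acts_carrier)
  then show ?case using insert by (simp add: acts_add)
qed (simp add: msum_empty acts_zero)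

text \<open>The extension of a matrix by \<open>0\<close>.  It respects products and brackets but not the identity.\<close>

definition mat_op :: "complex mat \<Rightarrow> lin_op" where
  "mat_op A = Lin_op (\<lambda>x i. if i < dim_row A then \<Sum>j=0..<dim_col A. A $$ (i, j) * x j else 0)"

lemma app_mat_op: "app (mat_op A) x = (\<lambda>i. if i < dim_row A then \<Sum>j=0..<dim_col A. A $$ (i, j) * x j else 0)"
  unfolding mat_op_def
  by (subst Lin_op_inverse) (auto simp: fun_eq_iff algebra_simps sum.distrib sum_distrib_left)

lemma acts_mat_op: "A \<in> carrier_mat N N \<Longrightarrow> acts N (mat_op A) A"
  by (auto simp: acts_def app_mat_op vfun_def fun_eq_iff scalar_prod_def intro!: sum.cong)

lemma mat_op_add: "\<lbrakk>A \<in> carrier_mat N N; B \<in> carrier_mat N N\<rbrakk> \<Longrightarrow> mat_op (A + B) = mat_op A + mat_op B"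
  by (rule lin_op_eqI) (auto simp: app_mat_op distrib_right sum.distrib)

lemma mat_op_diff: "\<lbrakk>A \<in> carrier_mat N N; B \<in> carrier_mat N N\<rbrakk> \<Longrightarrow> mat_op (A - B) = mat_op A - mat_op B"
  by (rule lin_op_eqI) (auto simp: app_mat_op left_diff_distrib sum_subtractf)

lemma mat_op_mult: "\<lbrakk>A \<in> carrier_mat N N; B \<in> carrier_mat N N\<rbrakk> \<Longrightarrow> mat_op (A * B) = mat_op A * mat_op B"
proof (rule lin_op_eqI)
  fix x i
  assume A: "A \<in> carrier_mat N N" and B: "B \<in> carrier_mat N N"
  show "app (mat_op (A * B)) x i = app (mat_op A * mat_op B) x i"
  proof (cases "i < N")
    case True
    have "app (mat_op (A * B)) x i = (\<Sum>j=0..<N. \<Sum>k=0..<N. A $$ (i, k) * (B $$ (k, j) * x j))"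
      using A B True by (simp add: app_mat_op scalar_prod_def sum_distrib_right mult.assoc)
    also have "\<dots> = (\<Sum>k=0..<N. \<Sum>j=0..<N. A $$ (i, k) * (B $$ (k, j) * x j))"
      by (rule sum.swap)
    finally show ?thesis using A B True by (simp add: app_mat_op sum_distrib_left)
  qed (use A in \<open>simp add: app_mat_op\<close>)
qed

section \<open>Representations\<close>

text \<open>The algebraic part of being a unitary representation, which is what passes from \<open>\<pi>\<close> to the tensor
  product by comparing blocks.\<close>

definition so_rep :: "nat \<Rightarrow> nat \<Rightarrow> (real mat \<Rightarrow> complex mat) \<Rightarrow> bool" where
  "so_rep n N \<pi> \<longleftrightarrow>
     (\<forall>X \<in> so n. \<pi> X \<in> carrier_mat N N) \<and>
     (\<forall>X \<in> so n. \<forall>Y \<in> so n. \<pi> (X + Y) = \<pi> X + \<pi> Y) \<and>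
     (\<forall>r. \<forall>X \<in> so n. \<pi> (r \<cdot>\<^sub>m X) = complex_of_real r \<cdot>\<^sub>m \<pi> X) \<and>
     (\<forall>X \<in> so n. \<forall>Y \<in> so n. \<pi> (X * Y - Y * X) = \<pi> X * \<pi> Y - \<pi> Y * \<pi> X)"

lemma unitary_so_rep_so_rep: "unitary_so_rep n d \<pi> \<Longrightarrow> so_rep n d \<pi>"
  by (simp add: unitary_so_rep_def so_rep_def)

definition gen :: "nat \<Rightarrow> (real mat \<Rightarrow> complex mat) \<Rightarrow> nat \<Rightarrow> nat \<Rightarrow> lin_op" where
  "gen n \<pi> i j = mat_op (\<pi> (so_basis n i j))"

lemma so_basis_carrier: "so_basis n i j \<in> carrier_mat n n"
  by (simp add: so_basis_def)

lemma so_basis_index: "so_basis n i j $$ (a, b)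
    = of_bool (b = i) * of_bool (a = j) - of_bool (b = j) * of_bool (a = i)"
  if "a < n" "b < n"
proof -
  have "(if P \<and> Q then 1 else 0) = (of_bool P * of_bool Q :: real)" for P Q by simp
  then show ?thesis using that by (simp only: so_basis_def index_mat prod.case)
qed

lemma so_iff: "X \<in> so n \<longleftrightarrow> X \<in> carrier_mat n n \<and> (\<forall>i<n. \<forall>j<n. X $$ (j, i) = - X $$ (i, j))"
proof (cases "X \<in> carrier_mat n n")
  case True
  then have "transpose_mat X = - X \<longleftrightarrow> (\<forall>i<n. \<forall>j<n. transpose_mat X $$ (i, j) = (- X) $$ (i, j))"
    by (subst mat_eq_iff) auto
  then show ?thesis using True by (simp add: so_def)
qed (simp add: so_def)

lemma so_carrier: "X \<in> so n \<Longrightarrow> X \<in> carrier_mat n n"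
  by (simp add: so_def)

lemma so_index: "\<lbrakk>X \<in> so n; i < n; j < n\<rbrakk> \<Longrightarrow> X $$ (j, i) = - X $$ (i, j)"
  using so_iff by blast

lemma so_smult:
  assumes X: "X \<in> so n" shows "r \<cdot>\<^sub>m X \<in> so n"
  unfolding so_iff
proof (intro conjI allI impI)
  fix i j assume "i < n" "j < n"
  then show "(r \<cdot>\<^sub>m X) $$ (j, i) = - (r \<cdot>\<^sub>m X) $$ (i, j)"
    using so_index[OF X, of i j] so_carrier[OF X] by simp
qed (use so_carrier[OF X] in simp)

lemma so_add:
  assumes X: "X \<in> so n" and Y: "Y \<in> so n" shows "X + Y \<in> so n"
  unfolding so_iff
proof (intro conjI allI impI)
  fix i j assume "i < n" "j < n"
  then show "(X + Y) $$ (j, i) = - (X + Y) $$ (i, j)"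
    using so_index[OF X, of i j] so_index[OF Y, of i j] so_carrier[OF X] so_carrier[OF Y] by simp
qed (use so_carrier[OF X] so_carrier[OF Y] in simp)

lemma so_basis_mult_index:
  assumes b: "i < n" "j < n" "k < n" "l < n" and ab: "a < n" "b < n"
  shows "(so_basis n i j * so_basis n k l) $$ (a, b)
    = of_bool (a = j) * (of_bool (k = b) * of_bool (i = l) - of_bool (l = b) * of_bool (i = k))
      - of_bool (a = i) * (of_bool (k = b) * of_bool (j = l) - of_bool (l = b) * of_bool (j = k))"
proof -
  have s: "(\<Sum>c=0..<n. of_bool (c = x) * F c) = F x" if "x < n" for x and F :: "nat \<Rightarrow> real"
  proof -
    have "of_bool (c = x) * F c = (if c = x then F c else 0)" for c by simp
    then show ?thesis using that by (simp only: sum.delta finite_atLeastLessThan) simp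
  qed
  have "(so_basis n i j * so_basis n k l) $$ (a, b)
      = (\<Sum>c=0..<n. so_basis n i j $$ (a, c) * so_basis n k l $$ (c, b))"
    using ab so_basis_carrier[of n i j] so_basis_carrier[of n k l] by (simp add: scalar_prod_def)
  also have "\<dots> = (\<Sum>c=0..<n. of_bool (c = i) * (of_bool (a = j) * (of_bool (k = b) * of_bool (c = l) - of_bool (l = b) * of_bool (c = k))))
     - (\<Sum>c=0..<n. of_bool (c = j) * (of_bool (a = i) * (of_bool (k = b) * of_bool (c = l) - of_bool (l = b) * of_bool (c = k))))"
    unfolding sum_subtractf[symmetric]
  proof (rule sum.cong[OF refl])
    fix c assume "c \<in> {0..<n}"
    then have c: "c < n" by simp
    have e: "of_bool (b = k) = of_bool (k = b)" "of_bool (b = l) = of_bool (l = b)" by (rule arg_cong[of _ _ of_bool], blast)+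
    show "so_basis n i j $$ (a, c) * so_basis n k l $$ (c, b)
      = of_bool (c = i) * (of_bool (a = j) * (of_bool (k = b) * of_bool (c = l) - of_bool (l = b) * of_bool (c = k)))
       - of_bool (c = j) * (of_bool (a = i) * (of_bool (k = b) * of_bool (c = l) - of_bool (l = b) * of_bool (c = k)))"
      unfolding so_basis_index[OF ab(1) c] so_basis_index[OF c ab(2)] e by (simp only: left_diff_distrib mult.assoc)
  qed
  finally show ?thesis unfolding s[OF b(1)] s[OF b(2)] .
qed

lemma so_basis_dim [simp]: "dim_row (so_basis n i j) = n" "dim_col (so_basis n i j) = n"
  by (simp_all add: so_basis_def)

text \<open>Every skew-symmetric matrix is the combination of the \<open>e\<^sub>a \<and> e\<^sub>b\<close> with coefficients \<open>X\<^sub>b\<^sub>a / 2\<close>.\<close>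

lemma so_induct [consumes 1, case_names basis zero smult add]:
  assumes X: "X \<in> so n"
    and basis: "\<And>a b. \<lbrakk>a < n; b < n\<rbrakk> \<Longrightarrow> P (so_basis n a b)"
    and zero: "P (0\<^sub>m n n)"
    and smult: "\<And>r Y. \<lbrakk>Y \<in> so n; P Y\<rbrakk> \<Longrightarrow> P (r \<cdot>\<^sub>m Y)"
    and add: "\<And>Y Z. \<lbrakk>Y \<in> so n; Z \<in> so n; P Y; P Z\<rbrakk> \<Longrightarrow> P (Y + Z)"
  shows "P X"
proof -
  define Y where "Y S = mat n n (\<lambda>(i, j). \<Sum>(a, b)\<in>S. X $$ (b, a) / 2 * so_basis n a b $$ (i, j))" for S
  have "Y S \<in> so n \<and> P (Y S)" if "finite S" "S \<subseteq> {0..<n} \<times> {0..<n}" for S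
    using that
  proof (induction S rule: finite_induct)
    case empty
    have "Y {} = 0\<^sub>m n n" by (rule eq_matI) (auto simp: Y_def)
    then show ?case using zero by (simp add: so_iff)
  next
    case (insert p S)
    obtain a b where p: "p = (a, b)" by force
    then have ab: "a < n" "b < n" using insert.prems by auto
    have "Y (insert p S) = (X $$ (b, a) / 2) \<cdot>\<^sub>m so_basis n a b + Y S"
      using insert.hyps so_basis_carrier[of n a b] unfolding Y_def p by (intro eq_matI) auto
    moreover have "Y S \<in> so n" "P (Y S)" using insert by auto
    ultimately show ?case
      using so_basis_in_so[of n a b] basis[OF ab] by (auto intro!: so_add so_smult smult add)
  qed
  then have "P (Y ({0..<n} \<times> {0..<n}))" by auto
  also have "Y ({0..<n} \<times> {0..<n}) = X"
  proof (rule eq_matI)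
    fix i j assume "i < dim_row X" "j < dim_col X"
    then have ij: "i < n" "j < n" using so_carrier[OF X] by auto
    have s: "(\<Sum>c=0..<n. F c * of_bool (x = c)) = F x" if "x < n" for x and F :: "nat \<Rightarrow> real"
    proof -
      have "F c * of_bool (x = c) = (if x = c then F c else 0)" for c by simp
      then show ?thesis using that by (simp only: sum.delta' finite_atLeastLessThan) simp
    qed
    have "Y ({0..<n} \<times> {0..<n}) $$ (i, j) = (\<Sum>a=0..<n. \<Sum>b=0..<n. X $$ (b, a) / 2 * so_basis n a b $$ (i, j))"
      using ij by (simp add: Y_def sum.cartesian_product)
    also have "\<dots> = (\<Sum>a=0..<n. \<Sum>b=0..<n. X $$ (b, a) / 2 * of_bool (j = a) * of_bool (i = b))
       - (\<Sum>a=0..<n. \<Sum>b=0..<n. X $$ (b, a) / 2 * of_bool (i = a) * of_bool (j = b))"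
      unfolding so_basis_index[OF ij] sum_subtractf[symmetric]
      by (intro sum.cong refl) (simp only: algebra_simps)
    also have "\<dots> = X $$ (i, j) / 2 - X $$ (j, i) / 2"
      unfolding s[OF ij(1)] s[OF ij(2)] by (simp only:)
    also have "\<dots> = X $$ (i, j)" using so_index[OF X, of i j] ij by simp
    finally show "Y ({0..<n} \<times> {0..<n}) $$ (i, j) = X $$ (i, j)" .
  qed (use so_carrier[OF X] in \<open>auto simp: Y_def\<close>)
  finally show ?thesis .
qed

lemma mat_op_smult: "mat_op (c \<cdot>\<^sub>m A) = cscale c * mat_op A"
  by (rule lin_op_eqI) (auto simp: app_mat_op sum_distrib_left mult.assoc)

lemma so_basis_bracket:
  assumes b: "i < n" "j < n" "k < n" "l < n"
  shows "so_basis n i j * so_basis n k l - so_basis n k l * so_basis n i j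
    = (of_bool (i = k) \<cdot>\<^sub>m so_basis n j l + (- of_bool (j = k)) \<cdot>\<^sub>m so_basis n i l)
      + (of_bool (i = l) \<cdot>\<^sub>m so_basis n k j + (- of_bool (j = l)) \<cdot>\<^sub>m so_basis n k i)"
    (is "?L = ?R")
proof (rule eq_matI)
  note C = so_basis_carrier[of n]
  fix x y assume "x < dim_row ?R" "y < dim_col ?R"
  then have xy: "x < n" "y < n" by (auto simp: so_basis_def)
  have e: "of_bool (y = p) = of_bool (p = y)" "of_bool (x = p) = of_bool (p = x)"
     "of_bool (k = i) = of_bool (i = k)" "of_bool (k = j) = of_bool (j = k)"
     "of_bool (l = i) = of_bool (i = l)" "of_bool (l = j) = of_bool (j = l)" for p
    by (rule arg_cong[of _ _ of_bool], blast)+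
  have "?L $$ (x, y) = (so_basis n i j * so_basis n k l) $$ (x, y) - (so_basis n k l * so_basis n i j) $$ (x, y)"
    using xy by (subst index_minus_mat) auto
  also have "\<dots> = ?R $$ (x, y)"
  proof -
    have "?R $$ (x, y) = (of_bool (i = k) * so_basis n j l $$ (x, y) + (- of_bool (j = k)) * so_basis n i l $$ (x, y))
      + (of_bool (i = l) * so_basis n k j $$ (x, y) + (- of_bool (j = l)) * so_basis n k i $$ (x, y))"
      using C xy by auto
    moreover have "jx * (ky * il - ly * ik) - ix * (ky * jl - ly * jk) - (lx * (iy * jk - jy * ik) - kx * (iy * jl - jy * il))
        = (ik * (jy * lx - ly * jx) + (- jk) * (iy * lx - ly * ix)) + (il * (ky * jx - jy * kx) + (- jl) * (ky * ix - iy * kx))"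
      for ix jx kx lx iy jy ky ly ik jk il jl :: real
      by (simp add: algebra_simps)
    ultimately show ?thesis
      unfolding so_basis_mult_index[OF b xy] so_basis_mult_index[OF b(3,4,1,2) xy] so_basis_index[OF xy] e
      by (simp only:)
  qed
  finally show "?L $$ (x, y) = ?R $$ (x, y)" .
qed (use so_basis_carrier[of n] in auto)

lemma cscale_of_int: "cscale (of_int k) = of_int k"
  using cscale_hom(6)[of "of_int k"] by simp

context
  fixes n N :: nat and \<pi> :: "real mat \<Rightarrow> complex mat"
  assumes rep: "so_rep n N \<pi>"
begin

lemma rep_carrier: "X \<in> so n \<Longrightarrow> \<pi> X \<in> carrier_mat N N"
  using rep by (simp add: so_rep_def)

lemma rep_add: "\<lbrakk>X \<in> so n; Y \<in> so n\<rbrakk> \<Longrightarrow> \<pi> (X + Y) = \<pi> X + \<pi> Y"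
  using rep by (simp add: so_rep_def)

lemma rep_smult: "X \<in> so n \<Longrightarrow> \<pi> (r \<cdot>\<^sub>m X) = complex_of_real r \<cdot>\<^sub>m \<pi> X"
  using rep by (simp add: so_rep_def)

lemma rep_bracket: "\<lbrakk>X \<in> so n; Y \<in> so n\<rbrakk> \<Longrightarrow> \<pi> (X * Y - Y * X) = \<pi> X * \<pi> Y - \<pi> Y * \<pi> X"
  using rep by (simp add: so_rep_def)

lemma rep_zero: "\<pi> (0\<^sub>m n n) = 0\<^sub>m N N"
proof -
  have "0\<^sub>m n n = 0 \<cdot>\<^sub>m so_basis n 0 0" by (rule eq_matI) (auto simp: so_basis_def)
  then have "\<pi> (0\<^sub>m n n) = 0 \<cdot>\<^sub>m \<pi> (so_basis n 0 0)" using rep_smult[OF so_basis_in_so, of 0] by simp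
  then show ?thesis using rep_carrier[OF so_basis_in_so[of n 0 0]] by (auto intro!: eq_matI)
qed

lemma acts_gen: "acts N (gen n \<pi> i j) (\<pi> (so_basis n i j))"
  unfolding gen_def by (rule acts_mat_op[OF rep_carrier[OF so_basis_in_so]])

lemma so_family_gen: "so_family n (gen n \<pi>)"
proof
  fix i j assume "i < n" "j < n"
  have "so_basis n j i = (- 1) \<cdot>\<^sub>m so_basis n i j"
    by (rule eq_matI) (auto simp: so_basis_def)
  then show "gen n \<pi> j i = - gen n \<pi> i j"
    unfolding gen_def by (simp add: rep_smult[OF so_basis_in_so] mat_op_smult cscale_hom)
next
  fix i j k l assume b: "i < n" "j < n" "k < n" "l < n"
  note S = so_basis_in_so[of n]
  note C = rep_carrier[OF S]
  have "gen n \<pi> i j * gen n \<pi> k l - gen n \<pi> k l * gen n \<pi> i j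
    = mat_op (\<pi> (so_basis n i j * so_basis n k l - so_basis n k l * so_basis n i j))"
    unfolding rep_bracket[OF S S] gen_def
    by (simp add: mat_op_diff[of _ N] mat_op_mult[of _ N] mult_carrier_mat[of _ N N] C)
  also have "\<dots> = cscale (of_real (of_bool (i = k))) * gen n \<pi> j l + cscale (of_real (- of_bool (j = k))) * gen n \<pi> i l
      + (cscale (of_real (of_bool (i = l))) * gen n \<pi> k j + cscale (of_real (- of_bool (j = l))) * gen n \<pi> k i)"
    unfolding so_basis_bracket[OF b] gen_def
    by (simp only: rep_add so_add so_smult S rep_smult mat_op_add[of _ N] C smult_carrier_mat add_carrier_mat mat_op_smult)
  also have "\<dots> = (if i = k then gen n \<pi> j l else 0) - (if j = k then gen n \<pi> i l else 0)
      + (if i = l then gen n \<pi> k j else 0) - (if j = l then gen n \<pi> k i else 0)"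
    by (auto simp: cscale_hom)
  finally show "gen n \<pi> i j * gen n \<pi> k l - gen n \<pi> k l * gen n \<pi> i j = \<dots>" .
qed

lemma acts_e_hat: "acts N (so_family.ehat n (gen n \<pi>) i j) (e_hat n N \<pi> i j)"
proof -
  have "(if i = j then of_real ((real n - 1) / 2) else 0) = cscale (if i = j then (of_nat n - 1) / 2 else 0)"
    using cscale_hom(6)[of "(real n - 1) / 2"] by (simp add: cscale_hom)
  then show ?thesis unfolding so_family.ehat_def[OF so_family_gen] e_hat_def
    by (simp only: acts_add acts_gen acts_cscale)
qed

lemma acts_e_hat_pow: "acts N (so_family.ehat_pow n (gen n \<pi>) q i j) (e_hat_pow n N \<pi> q i j)"
proof (induction q arbitrary: i)
  case 0
  have "(if i = j then 1 else 0) = cscale (if i = j then 1 else 0)" by (simp add: cscale_hom)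
  then show ?case unfolding so_family.ehat_pow.simps[OF so_family_gen] e_hat_pow.simps
    by (simp only: acts_cscale)
next
  case (Suc q)
  then show ?case unfolding so_family.ehat_pow.simps[OF so_family_gen] e_hat_pow.simps
    by (intro acts_msum acts_mult acts_e_hat) auto
qed

lemma acts_c_hat: "acts N (so_family.ehat_trace n (gen n \<pi>) q) (c_hat n N \<pi> q)"
  unfolding so_family.ehat_trace_def[OF so_family_gen] c_hat_def by (intro acts_msum acts_e_hat_pow) auto

lemma acts_pair_prod:
  "acts N (so_family.pair_prod (gen n \<pi>) \<sigma> ks)
     (foldr (*) (map (\<lambda>k. \<pi> (so_basis n (\<sigma> (2 * k)) (\<sigma> (2 * k + 1)))) ks) (1\<^sub>m N))"
  unfolding so_family.pair_prod_def[OF so_family_gen]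
  by (induction ks) (auto intro: acts_one acts_mult acts_gen)

lemma acts_pf:
  assumes "n = 2 * m"
  shows "acts N (cscale (1 / (\<i> ^ m * 2 ^ m * fact m)) * so_family.pfaff (gen n \<pi>) m) (pf n N \<pi>)"
proof -
  have m: "n div 2 = m" "{0..<n} = {0..<2 * m}" using assms by auto
  show ?thesis
    unfolding pf_def Let_def m so_family.pfaff_def[OF so_family_gen] alt_sum_def
    by (intro acts_smult acts_msum acts_smult[of N _ _ "of_int _", unfolded cscale_of_int] acts_pair_prod finite_permutations) auto
qed

end

section \<open>Schur's lemma\<close>

definition preserves :: "complex vec set \<Rightarrow> lin_op \<Rightarrow> bool" where
  "preserves W X \<longleftrightarrow> (\<forall>f \<in> vfun ` W. app X f \<in> vfun ` W)"

definition is_subspace :: "nat \<Rightarrow> complex vec set \<Rightarrow> bool" where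
  "is_subspace N W \<longleftrightarrow> W \<subseteq> carrier_vec N \<and> 0\<^sub>v N \<in> W \<and> (\<forall>v\<in>W. \<forall>w\<in>W. v + w \<in> W) \<and> (\<forall>c. \<forall>v\<in>W. c \<cdot>\<^sub>v v \<in> W)"

lemma subspace_is_subspace:
  "VectorSpace.subspace class_ring W (module_vec TYPE(complex) N) \<longleftrightarrow> is_subspace N W"
proof -
  interpret vec_space "TYPE(complex)" N .
  show ?thesis
    unfolding VectorSpace.subspace_def LinearCombinations.submodule_def is_subspace_def
    using vectorspace_axioms module_axioms by (auto simp: module_vec_simps)
qed

lemma so_invariant_iff:
  "so_invariant n N \<pi> W \<longleftrightarrow> is_subspace N W \<and> (\<forall>X \<in> so n. \<forall>v \<in> W. \<pi> X *\<^sub>v v \<in> W)"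
  by (simp add: so_invariant_def subspace_is_subspace)

context
  fixes N :: nat and W :: "complex vec set"
  assumes W: "is_subspace N W"
begin

lemma subspace_carrier: "v \<in> W \<Longrightarrow> v \<in> carrier_vec N"
  using W by (auto simp: is_subspace_def)

lemma vfun_subspace_add: "\<lbrakk>f \<in> vfun ` W; g \<in> vfun ` W\<rbrakk> \<Longrightarrow> (\<lambda>i. f i + g i) \<in> vfun ` W"
  using W subspace_carrier by (auto simp: is_subspace_def vfun_add[of _ N, symmetric])

lemma vfun_subspace_scale: "f \<in> vfun ` W \<Longrightarrow> (\<lambda>i. c * f i) \<in> vfun ` W"
  using W by (auto simp: is_subspace_def vfun_smult[symmetric])

lemma preserves_add: "\<lbrakk>preserves W X; preserves W Y\<rbrakk> \<Longrightarrow> preserves W (X + Y)"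
  unfolding preserves_def by (auto intro!: vfun_subspace_add)

lemma preserves_cscale: "preserves W (cscale c)"
  unfolding preserves_def by (auto intro!: vfun_subspace_scale)

lemma preserves_mult: "\<lbrakk>preserves W X; preserves W Y\<rbrakk> \<Longrightarrow> preserves W (X * Y)"
  unfolding preserves_def by auto

lemma preserves_one: "preserves W 1"
  unfolding preserves_def by auto

lemma preserves_zero: "preserves W 0"
  using preserves_cscale[of 0] by (simp add: cscale_hom)

lemma preserves_of_int: "preserves W (of_int k)"
  using preserves_cscale[of "of_int k"] by (simp add: cscale_of_int)

lemma preserves_sum: "(\<And>i. i \<in> S \<Longrightarrow> preserves W (X i)) \<Longrightarrow> preserves W (\<Sum>i\<in>S. X i)"
  by (induction S rule: infinite_finite_induct) (auto intro: preserves_zero preserves_add)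

lemma preserves_prod_list: "(\<And>X. X \<in> set Xs \<Longrightarrow> preserves W X) \<Longrightarrow> preserves W (prod_list Xs)"
  by (induction Xs) (auto intro: preserves_one preserves_mult)

end

text \<open>The polynomial \<open>p\<close> evaluated at the operator \<open>X\<close>.\<close>

definition polyop :: "lin_op \<Rightarrow> complex poly \<Rightarrow> lin_op" where
  "polyop X p = fold_coeffs (\<lambda>a R. cscale a + X * R) p 0"

lemma polyop_0 [simp]: "polyop X 0 = 0"
  by (simp add: polyop_def)

lemma polyop_pCons [simp]: "polyop X (pCons a p) = cscale a + X * polyop X p"
  by (cases "p = 0 \<and> a = 0") (auto simp: polyop_def cscale_hom)

lemma polyop_add: "polyop X (p + q) = polyop X p + polyop X q"
  by (induction p q rule: poly_induct2) (simp_all add: cscale_hom algebra_simps)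

lemma polyop_smult: "polyop X (smult c p) = cscale c * polyop X p"
proof (induction p)
  case (pCons a p)
  have "X * (cscale c * R) = cscale c * (X * R)" for R by (metis cscale_comm mult.assoc)
  then show ?case using pCons cscale_comm[of c "cscale a"] by (simp add: cscale_hom algebra_simps)
qed simp

lemma polyop_linear_factor: "polyop X ([:- a, 1:] * q) = (X - cscale a) * polyop X q"
proof -
  have "[:- a, 1:] * q = smult (- a) q + pCons 0 q" by simp
  then show ?thesis
    by (simp only: polyop_add polyop_smult polyop_pCons cscale_hom) (simp add: algebra_simps)
qed

lemma polyop_Poly: "polyop X (Poly us) = (\<Sum>k<length us. cscale (us ! k) * X ^ k)"
proof (induction us)
  case (Cons u us)
  have "X * (cscale c * R) = cscale c * (X * R)" for c R by (metis cscale_comm mult.assoc)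
  then show ?case using Cons by (simp add: sum.lessThan_Suc_shift sum_distrib_left del: sum.lessThan_Suc)
qed simp

lemma preserves_polyop:
  assumes "is_subspace N W" "preserves W X" shows "preserves W (polyop X p)"
  by (induction p) (auto intro!: preserves_zero preserves_add preserves_cscale preserves_mult assms)

text \<open>The \<open>N + 1\<close> vectors \<open>w, X w, \<dots>, X\<^sup>N w\<close> of length \<open>N\<close> are linearly dependent: padded with a zero row
  they form a singular square matrix.\<close>

lemma annihilating_poly:
  assumes X: "acts N X A" and w: "w \<in> carrier_vec N"
  shows "\<exists>p. p \<noteq> 0 \<and> app (polyop X p) (vfun w) = (\<lambda>i. 0)"
proof -
  define K where "K = mat (Suc N) (Suc N) (\<lambda>(i, k). if i < N then app (X ^ k) (vfun w) i else 0)"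
  have K: "K \<in> carrier_mat (Suc N) (Suc N)" by (simp add: K_def)
  (* the zero row of K *)
  have "transpose_mat K *\<^sub>v unit_vec (Suc N) N = 0\<^sub>v (Suc N)"
    by (rule eq_vecI) (auto simp: K_def scalar_prod_def)
  then have "det (transpose_mat K) = 0"
    using det_0_iff_vec_prod_zero[of "transpose_mat K" "Suc N"] K
    by (metis lessI transpose_carrier_mat unit_vec_carrier unit_vec_nonzero)
  then have "det K = 0" using det_transpose[OF K] by simp
  then obtain u where u: "u \<in> carrier_vec (Suc N)" "u \<noteq> 0\<^sub>v (Suc N)" "K *\<^sub>v u = 0\<^sub>v (Suc N)"
    using det_0_iff_vec_prod_zero[OF K] by blast
  have supp: "app (X ^ k) (vfun w) i = 0" if "\<not> i < N" for k i
  proof -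
    have "\<exists>v \<in> carrier_vec N. app (X ^ k) (vfun w) = vfun v"
    proof (induction k)
      case (Suc k)
      then obtain v where "v \<in> carrier_vec N" "app (X ^ k) (vfun w) = vfun v" by blast
      then show ?case using acts_app[OF X] acts_carrier[OF X] by (intro bexI[of _ "A *\<^sub>v v"]) auto
    qed (use w in auto)
    then show ?thesis using that by (auto simp: vfun_def)
  qed
  define p where "p = Poly (list_of_vec u)"
  have len: "length (list_of_vec u) = Suc N" using u by simp
  have "app (polyop X p) (vfun w) i = 0" for i
  proof -
    have s: "app (polyop X p) (vfun w) i = (\<Sum>k=0..<Suc N. u $ k * app (X ^ k) (vfun w) i)"
      unfolding p_def polyop_Poly app_sum len atLeast0LessThan
      by (rule sum.cong) (use u in \<open>auto simp: list_of_vec_index\<close>)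
    show ?thesis
    proof (cases "i < N")
      case True
      have "(K *\<^sub>v u) $ i = (\<Sum>k=0..<Suc N. app (X ^ k) (vfun w) i * u $ k)"
        using True u(1) by (simp add: K_def scalar_prod_def)
      then show ?thesis using s u(3) True by (simp add: mult.commute)
    qed (simp add: s supp)
  qed
  moreover have "p \<noteq> 0"
  proof
    assume "p = 0"
    then obtain l where "list_of_vec u = replicate l 0" by (auto simp: p_def Poly_eq_0)
    then have "u $ k = 0" if "k < Suc N" for k
      using that u(1) len by (metis carrier_vecD length_replicate list_of_vec_index nth_replicate)
    then show False using u(1,2) by (auto intro!: eq_vecI)
  qed
  ultimately show ?thesis by auto
qed

text \<open>Over the complex numbers the polynomial splits off a factor \<open>x - a\<close>.  Either the cofactor still
  annihilates \<open>f\<close>, or it maps \<open>f\<close> to an eigenvector for \<open>a\<close>.\<close>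

lemma eigenvector_of_annihilating_poly:
  assumes W: "is_subspace N W" and P: "preserves W X"
  shows "\<lbrakk>p \<noteq> 0; app (polyop X p) f = (\<lambda>i. 0); f \<in> vfun ` W; f \<noteq> (\<lambda>i. 0)\<rbrakk>
    \<Longrightarrow> \<exists>g \<in> vfun ` W. g \<noteq> (\<lambda>i. 0) \<and> (\<exists>c. app X g = (\<lambda>i. c * g i))"
proof (induction "degree p" arbitrary: p)
  case 0
  then obtain c where "p = [:c:]" by (metis degree_eq_zeroE)
  with 0 show ?case by (auto simp: cscale_hom fun_eq_iff)
next
  case (Suc m)
  then have "\<not> constant (poly p)" by (simp add: constant_degree)
  then obtain a where "poly p a = 0" using fundamental_theorem_of_algebra by blast
  then obtain q where q: "p = [:- a, 1:] * q" by (metis dvdE poly_eq_0_iff_dvd)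
  have "q \<noteq> 0" using Suc.prems q by auto
  have "degree p = degree [:- a, 1:] + degree q"
    unfolding q by (rule degree_mult_eq) (use \<open>q \<noteq> 0\<close> in auto)
  then have deg: "m = degree q" using Suc.hyps(2) by simp
  let ?g = "app (polyop X q) f"
  have g: "?g \<in> vfun ` W" using preserves_polyop[OF W P, of q] Suc.prems(3) unfolding preserves_def by blast
  show ?case
  proof (cases "?g = (\<lambda>i. 0)")
    case True
    show ?thesis by (rule Suc.hyps(1)[OF deg \<open>q \<noteq> 0\<close> True Suc.prems(3,4)])
  next
    case False
    have "(\<lambda>i. app X ?g i - a * ?g i) = (\<lambda>i. 0)"
      using Suc.prems(2) unfolding q polyop_linear_factor by simp
    then have "app X ?g = (\<lambda>i. a * ?g i)" by (auto simp: fun_eq_iff)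
    then show ?thesis using g False by blast
  qed
qed

text \<open>Schur's lemma.  The eigenspace of an eigenvalue of \<open>X\<close> on \<open>W\<close> is invariant and nonzero, hence all of
  \<open>W\<close>.\<close>

lemma so_irreducible_schur:
  assumes rep: "so_rep n N \<pi>" and irr: "so_irreducible n N \<pi> W"
    and X: "acts N X A" and P: "preserves W X"
    and comm: "\<And>a b. \<lbrakk>a < n; b < n\<rbrakk> \<Longrightarrow> gen n \<pi> a b * X = X * gen n \<pi> a b"
  shows "\<exists>c. \<forall>w \<in> W. A *\<^sub>v w = c \<cdot>\<^sub>v w"
proof -
  have inv: "so_invariant n N \<pi> W" and ne: "W \<noteq> {0\<^sub>v N}"
    and min: "\<And>U. \<lbrakk>so_invariant n N \<pi> U; U \<subseteq> W\<rbrakk> \<Longrightarrow> U = {0\<^sub>v N} \<or> U = W"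
    using irr by (auto simp: so_irreducible_def)
  have sub: "is_subspace N W" using inv by (simp add: so_invariant_iff)
  note Wc = subspace_carrier[OF sub] and A = acts_carrier[OF X]
  obtain w where w: "w \<in> W" "w \<noteq> 0\<^sub>v N" using ne sub by (auto simp: is_subspace_def)
  have vz: "vfun v = (\<lambda>i. 0) \<longleftrightarrow> v = 0\<^sub>v N" if "v \<in> W" for v
    using vfun_inject[OF Wc[OF that] zero_carrier_vec] by (simp add: vfun_zero)
  obtain p where "p \<noteq> 0" "app (polyop X p) (vfun w) = (\<lambda>i. 0)"
    using annihilating_poly[OF X Wc[OF w(1)]] by blast
  from eigenvector_of_annihilating_poly[OF sub P this, OF imageI[OF w(1)]] vz w
  obtain v c where v: "v \<in> W" "v \<noteq> 0\<^sub>v N" and c: "app X (vfun v) = (\<lambda>i. c * vfun v i)" by blast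
  have Av: "A *\<^sub>v v = c \<cdot>\<^sub>v v"
    using c acts_app[OF X Wc[OF v(1)]] vfun_inject[of "A *\<^sub>v v" N "c \<cdot>\<^sub>v v"] A Wc[OF v(1)]
    by (simp add: vfun_smult mult_mat_vec_carrier[of _ N N])
  have commA: "A * \<pi> Y = \<pi> Y * A" if "Y \<in> so n" for Y
    using that
  proof (induction Y rule: so_induct)
    case (basis a b)
    then show ?case
      using acts_unique[OF acts_mult[OF X acts_gen[OF rep]]] acts_mult[OF acts_gen[OF rep] X] comm by metis
  next
    case zero
    then show ?case using A by (simp add: rep_zero[OF rep])
  next
    case (smult r Y)
    then show ?case using A rep_carrier[OF rep]
      by (simp add: rep_smult[OF rep] mult_smult_distrib[of _ N N _ N] mult_smult_assoc_mat[of _ N N _ N])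
  next
    case (add Y Z)
    then show ?case using A rep_carrier[OF rep]
      by (simp add: rep_add[OF rep] mult_add_distrib_mat[of _ N N _ N] add_mult_distrib_mat[of _ N N _ _ N])
  qed
  let ?U = "{u \<in> W. A *\<^sub>v u = c \<cdot>\<^sub>v u}"
  have "so_invariant n N \<pi> ?U"
    unfolding so_invariant_iff
  proof (intro conjI ballI)
    show "is_subspace N ?U"
      unfolding is_subspace_def
    proof (intro conjI ballI allI)
      show "?U \<subseteq> carrier_vec N" using Wc by auto
      show "0\<^sub>v N \<in> ?U" using sub A by (auto simp: is_subspace_def)
      fix x y d assume x: "x \<in> ?U"
      show "d \<cdot>\<^sub>v x \<in> ?U" using x sub A Wc
        by (auto simp: is_subspace_def mult_mat_vec[of _ N N] smult_smult_assoc mult.commute)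
      assume y: "y \<in> ?U"
      show "x + y \<in> ?U" using x y sub A Wc
        by (auto simp: is_subspace_def mult_add_distrib_mat_vec[of _ N N] smult_add_distrib_vec[of _ N])
    qed
    fix Y u assume Y: "Y \<in> so n" and u: "u \<in> ?U"
    have "A *\<^sub>v (\<pi> Y *\<^sub>v u) = \<pi> Y *\<^sub>v (A *\<^sub>v u)"
      using commA[OF Y] A rep_carrier[OF rep Y] u Wc by (auto simp: assoc_mult_mat_vec[of _ N N _ N, symmetric])
    also have "\<dots> = c \<cdot>\<^sub>v (\<pi> Y *\<^sub>v u)"
      using u Wc rep_carrier[OF rep Y] by (simp add: mult_mat_vec[of _ N N])
    finally show "\<pi> Y *\<^sub>v u \<in> ?U" using inv Y u by (auto simp: so_invariant_iff)
  qed
  moreover have "?U \<subseteq> W" "?U \<noteq> {0\<^sub>v N}" using v Av by auto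
  ultimately have "?U = W" using min by blast
  then show ?thesis by blast
qed

section \<open>Highest weights\<close>

text \<open>This is \<open>\<langle>\<mu> + \<delta>, \<mu> + \<delta>\<rangle> - \<langle>\<delta>, \<delta>\<rangle>\<close>, because \<open>2 \<delta>\<^sup>j = n - 2 j - 2\<close> with \<open>j\<close> counted from \<open>0\<close>.\<close>

definition casimir_value :: "nat \<Rightarrow> real vec \<Rightarrow> real" where
  "casimir_value n \<mu> = (\<Sum>j=0..<n div 2. \<mu> $ j * \<mu> $ j + (real n - 2 * real j - 2) * \<mu> $ j)"

text \<open>\<open>(e\<^sub>2\<^sub>j - \<i> e\<^sub>2\<^sub>j\<^sub>+\<^sub>1) \<and> e\<^sub>l\<close>.  For \<open>l \<ge> 2 j + 2\<close> it is a sum of root vectors for positive roots: one root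
  vector if \<open>l\<close> is the index outside all planes for odd \<open>n\<close>, and otherwise two, one for each of the
  two weights in the plane that contains \<open>l\<close>.\<close>

definition raising :: "(nat \<Rightarrow> nat \<Rightarrow> lin_op) \<Rightarrow> nat \<Rightarrow> nat \<Rightarrow> lin_op" where
  "raising e j l = e (2 * j) l - cscale \<i> * e (Suc (2 * j)) l"

lemma cscale_left_commute: "X * (cscale c * Y) = cscale c * (X * Y)"
  by (metis cscale_comm mult.assoc)

lemma even_odd_neq [simp]: "Suc (2 * a) \<noteq> 2 * b" "2 * b \<noteq> Suc (2 * a)" for a b :: nat
  by presburger+

lemma cscale_ii: "cscale \<i> * (cscale \<i> * X) = - X"
  by (rule lin_op_eqI) simp

text \<open>This expresses the contribution of a pair of indices to the Casimir element by a product that ends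
  with a raising operator.\<close>

lemma ladder_product:
  assumes "E * F = F * E + H"
  shows "(E + cscale \<i> * F) * (E - cscale \<i> * F) = E * E + F * F - cscale \<i> * H"
  using assms
  by (simp add: algebra_simps cscale_left_commute[of E] cscale_left_commute[of F] cscale_ii)

lemma raising_bracket:
  assumes "so_family n e" and s: "Suc (2 * s) < n" and j: "Suc (2 * j) < n" and l: "l < n" "2 * j + 2 \<le> l"
  shows "e (2 * s) (Suc (2 * s)) * raising e j l = raising e j l * e (2 * s) (Suc (2 * s))
    + (if s = j then cscale \<i> * raising e j l else 0)
    + (if 2 * s = l then raising e j (Suc (2 * s)) else 0) - (if Suc (2 * s) = l then raising e j (2 * s) else 0)"
proof -
  interpret so_family n e by fact
  have s': "2 * s < n" "2 * j < n" using s j by auto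
  let ?h = "e (2 * s) (Suc (2 * s))"
  have 1: "?h * e (2 * j) l = e (2 * j) l * ?h + ((if s = j then e (Suc (2 * j)) l else 0)
      + (if 2 * s = l then e (2 * j) (Suc (2 * s)) else 0) - (if Suc (2 * s) = l then e (2 * j) (2 * s) else 0))"
    using equivariantD[OF equivariant_e s'(1) s s'(2) l(1)] by auto
  have 2: "?h * e (Suc (2 * j)) l = e (Suc (2 * j)) l * ?h + (- (if s = j then e (2 * j) l else 0)
      + (if 2 * s = l then e (Suc (2 * j)) (Suc (2 * s)) else 0) - (if Suc (2 * s) = l then e (Suc (2 * j)) (2 * s) else 0))"
    using equivariantD[OF equivariant_e s'(1) s j l(1)] by auto
  have "?h * raising e j l = ?h * e (2 * j) l - cscale \<i> * (?h * e (Suc (2 * j)) l)"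
    by (simp add: raising_def right_diff_distrib cscale_left_commute)
  also have "\<dots> = raising e j l * ?h
    + (if s = j then cscale \<i> * raising e j l else 0)
    + (if 2 * s = l then raising e j (Suc (2 * s)) else 0) - (if Suc (2 * s) = l then raising e j (2 * s) else 0)"
    unfolding 1 2 
    by (auto simp: raising_def right_diff_distrib left_diff_distrib distrib_left distrib_right mult.assoc cscale_ii)
  finally show ?thesis .
qed

context
  fixes n N :: nat and \<pi> :: "real mat \<Rightarrow> complex mat" and W and \<nu> :: "real vec"
  assumes rep: "so_rep n N \<pi>" and inv: "so_invariant n N \<pi> W" and hw: "so_highest_weight n N \<pi> W \<nu>"
begin

interpretation so_family n "gen n \<pi>" by (rule so_family_gen[OF rep])

lemma invariant_subspace: "is_subspace N W"
  using inv by (simp add: so_invariant_iff)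

lemma preserves_gen: "preserves W (gen n \<pi> a b)"
  unfolding preserves_def
proof
  fix f assume "f \<in> vfun ` W"
  then obtain w where w: "w \<in> W" "f = vfun w" by blast
  then have "app (gen n \<pi> a b) f = vfun (\<pi> (so_basis n a b) *\<^sub>v w)"
    using acts_app[OF acts_gen[OF rep]] subspace_carrier[OF invariant_subspace] by blast
  then show "app (gen n \<pi> a b) f \<in> vfun ` W"
    using inv w so_basis_in_so by (auto simp: so_invariant_iff)
qed

lemma weight_eq_iff:
  assumes u: "u \<in> W"
  shows "((- \<i>) \<cdot>\<^sub>m \<pi> (so_basis n (2 * s) (2 * s + 1))) *\<^sub>v u = complex_of_real c \<cdot>\<^sub>v u
    \<longleftrightarrow> app (gen n \<pi> (2 * s) (Suc (2 * s))) (vfun u) = (\<lambda>i. \<i> * of_real c * vfun u i)"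
proof -
  note C = rep_carrier[OF rep so_basis_in_so] and uc = subspace_carrier[OF invariant_subspace u]
  let ?w = "\<pi> (so_basis n (2 * s) (Suc (2 * s))) *\<^sub>v u"
  have 1: "((- \<i>) \<cdot>\<^sub>m \<pi> (so_basis n (2 * s) (2 * s + 1))) *\<^sub>v u = (- \<i>) \<cdot>\<^sub>v ?w"
    by (simp add: smult_mat_vec[OF C uc])
  have 2: "(- \<i>) \<cdot>\<^sub>v ?w = complex_of_real c \<cdot>\<^sub>v u \<longleftrightarrow> vfun ((- \<i>) \<cdot>\<^sub>v ?w) = vfun (complex_of_real c \<cdot>\<^sub>v u)"
    using mult_mat_vec_carrier[OF C uc] uc by (subst vfun_inject[of _ N]) auto
  have 3: "- \<i> * x = y \<longleftrightarrow> x = \<i> * y" for x y by (auto simp: complex_eq_iff)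
  show ?thesis
    unfolding 1 2 vfun_smult acts_app[OF acts_gen[OF rep] uc] fun_eq_iff 3 mult.assoc ..
qed

text \<open>A nonzero \<open>x\<close> would be a weight vector for a weight that is lexicographically greater than the
  highest one.\<close>

lemma no_higher_weight:
  assumes x: "x \<in> vfun ` W" and j: "j < n div 2"
    and wt: "\<And>s. s < n div 2 \<Longrightarrow> app (gen n \<pi> (2 * s) (Suc (2 * s))) x = (\<lambda>i. \<i> * of_real (\<mu> s) * x i)"
    and gt: "\<nu> $ j < \<mu> j" and eq: "\<And>s. s < j \<Longrightarrow> \<mu> s = \<nu> $ s"
  shows "x = (\<lambda>i. 0)"
proof (rule ccontr)
  assume nz: "x \<noteq> (\<lambda>i. 0)"
  obtain u where u: "u \<in> W" "x = vfun u" using x by blast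
  let ?\<mu> = "vec (n div 2) \<mu>"
  have "u \<noteq> 0\<^sub>v N" using nz u by (auto simp: vfun_zero)
  moreover have "\<forall>s < n div 2. ((- \<i>) \<cdot>\<^sub>m \<pi> (so_basis n (2 * s) (2 * s + 1))) *\<^sub>v u = complex_of_real (?\<mu> $ s) \<cdot>\<^sub>v u"
    using weight_eq_iff[OF u(1)] wt u(2) by simp
  ultimately have "?\<mu> \<in> so_weights n N \<pi> W" using u(1) unfolding so_weights_def by auto
  then have "?\<mu> = \<nu> \<or> (list_of_vec ?\<mu>, list_of_vec \<nu>) \<in> lexord {(x, y). x < y}"
    using hw unfolding so_highest_weight_def by blast
  moreover have "?\<mu> \<noteq> \<nu>" using gt j by auto
  moreover have nc: "\<nu> \<in> carrier_vec (n div 2)" using hw by (simp add: so_highest_weight_def so_weights_def)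
  have "(list_of_vec ?\<mu>, list_of_vec \<nu>) \<notin> lexord {(x, y). x < y}"
  proof
    assume "(list_of_vec ?\<mu>, list_of_vec \<nu>) \<in> lexord {(x, y). x < y}"
    then obtain i where i: "i < n div 2" "take i (list_of_vec ?\<mu>) = take i (list_of_vec \<nu>)" "\<mu> i < \<nu> $ i"
      using nc by (auto simp: lexord_take_index_conv list_of_vec_index)
    have "\<not> i < j" using i(3) eq by auto
    moreover have "i \<noteq> j" using i(3) gt by auto
    ultimately have "j < i" by simp
    then have "list_of_vec ?\<mu> ! j = list_of_vec \<nu> ! j" using i(2) by (metis nth_take)
    then show False using gt j nc by (simp add: list_of_vec_index)
  qed
  ultimately show False by blast
qed

text \<open>Root vectors for positive roots raise the weight in lexicographic order, so they annihilate a
  highest weight vector; and the raising operator is a sum of such root vectors.\<close>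

lemma raising_kills:
  assumes v: "v \<in> W" "\<And>s. s < n div 2 \<Longrightarrow> app (gen n \<pi> (2 * s) (Suc (2 * s))) (vfun v) = (\<lambda>i. \<i> * of_real (\<nu> $ s) * vfun v i)"
    and j: "j < n div 2" and l: "l < n" "2 * j + 2 \<le> l"
  shows "app (raising (gen n \<pi>) j l) (vfun v) = (\<lambda>i. 0)"
proof -
  let ?e = "gen n \<pi>" and ?f = "vfun v"
  have lt: "Suc (2 * s) < n" if "s < n div 2" for s using that by auto
  (* c is the root of X, given by its values on the Cartan elements *)
  have kill: "app X ?f = (\<lambda>i. 0)"
    if X: "preserves W X"
      and br: "\<And>s. s < n div 2 \<Longrightarrow> ?e (2 * s) (Suc (2 * s)) * X = X * ?e (2 * s) (Suc (2 * s)) + cscale (\<i> * of_real (c s)) * X"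
      and c: "0 < c j" "\<And>s. s < j \<Longrightarrow> c s = 0" for X and c :: "nat \<Rightarrow> real"
  proof (rule no_higher_weight[OF _ j])
    show "app X ?f \<in> vfun ` W" using X v(1) by (auto simp: preserves_def)
    fix s assume s: "s < n div 2"
    have "app (?e (2 * s) (Suc (2 * s)) * X) ?f = app (X * ?e (2 * s) (Suc (2 * s)) + cscale (\<i> * of_real (c s)) * X) ?f"
      by (simp only: br[OF s])
    then show "app (?e (2 * s) (Suc (2 * s))) (app X ?f) = (\<lambda>i. \<i> * of_real (\<nu> $ s + c s) * app X ?f i)"
      by (simp add: v(2)[OF s] app_scale) (simp add: distrib_left distrib_right mult.assoc)
  qed (use c in auto)
  have pr: "preserves W (raising ?e j l)" for l
    unfolding raising_def diff_conv_add_uminus mult_minus_left[symmetric] cscale_hom(3)[symmetric]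
    by (intro preserves_add[OF invariant_subspace] preserves_mult[OF invariant_subspace] preserves_cscale[OF invariant_subspace] preserves_gen)
  note rb = raising_bracket[OF so_family_gen[OF rep] lt lt[OF j]]
  show ?thesis
  proof (cases "l = 2 * (n div 2)")
    case True
    show ?thesis
    proof (rule kill[OF pr, of _ "\<lambda>s. of_bool (s = j)"])
      fix s assume s: "s < n div 2"
      then have "2 * s \<noteq> l" "Suc (2 * s) \<noteq> l" using True by auto
      then show "?e (2 * s) (Suc (2 * s)) * raising ?e j l = raising ?e j l * ?e (2 * s) (Suc (2 * s))
          + cscale (\<i> * of_real (of_bool (s = j))) * raising ?e j l"
        unfolding rb[OF s l] by (simp add: cscale_hom)
    qed auto
  next
    case False
    define k where "k = l div 2"
    have k: "j < k" "k < n div 2" "l = 2 * k \<or> l = Suc (2 * k)"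
      using l False unfolding k_def by presburger+
    let ?A = "raising ?e j (2 * k)" and ?B = "raising ?e j (Suc (2 * k))"
    have bl: "2 * k < n" "2 * j + 2 \<le> 2 * k" "Suc (2 * k) < n" "2 * j + 2 \<le> Suc (2 * k)" using k by auto
    (* t = i and t = - i give the root vectors for the differences and sums of two weights *)
    have "app (?A + cscale t * ?B) ?f = (\<lambda>i. 0)" if t: "t = \<i> * of_real r" and r: "r = 1 \<or> r = - 1" for t r
    proof (rule kill[of _ "\<lambda>s. of_bool (s = j) - r * of_bool (s = k)"])
      show "preserves W (?A + cscale t * ?B)"
        by (intro preserves_add[OF invariant_subspace] preserves_mult[OF invariant_subspace] preserves_cscale[OF invariant_subspace] pr)
      fix s assume s: "s < n div 2"
      let ?h = "?e (2 * s) (Suc (2 * s))"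
      have a: "?h * ?A = ?A * ?h + (if s = j then cscale \<i> * ?A else 0) + (if s = k then ?B else 0)"
        unfolding rb[OF s bl(1,2)] by auto
      have b: "?h * ?B = ?B * ?h + (if s = j then cscale \<i> * ?B else 0) - (if s = k then ?A else 0)"
        unfolding rb[OF s bl(3,4)] by auto
      have tt: "cscale \<i> * (cscale t * X) = - cscale (of_real r) * X" "cscale (\<i> * of_real (- r)) * (cscale t * X) = X"
        "cscale (\<i> * of_real (- r)) = - cscale t" for X
        using r unfolding t by (auto intro!: lin_op_eqI)
      have "?h * (?A + cscale t * ?B) = ?h * ?A + cscale t * (?h * ?B)"
        by (simp add: distrib_left cscale_left_commute)
      also have "\<dots> = (?A + cscale t * ?B) * ?h + cscale (\<i> * of_real (of_bool (s = j) - r * of_bool (s = k))) * (?A + cscale t * ?B)"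
      proof -
        have com: "cscale t * (cscale \<i> * Y) = cscale \<i> * (cscale t * Y)" for Y by (rule cscale_left_commute)
        consider "s = j" "s \<noteq> k" | "s = k" "s \<noteq> j" | "s \<noteq> j" "s \<noteq> k" using k by blast
        then show ?thesis
        proof cases
          case 1
          then show ?thesis unfolding a b by (simp add: algebra_simps com)
        next
          case 2
          then show ?thesis unfolding a b using tt by (simp add: algebra_simps)
        next
          case 3
          then show ?thesis unfolding a b by (simp add: algebra_simps cscale_hom)
        qed
      qed
      finally show "?h * (?A + cscale t * ?B) = \<dots>" .
    qed (use k in auto)
    from this[of \<i> 1] this[of "- \<i>" "- 1"]
    have "app ?A ?f i + \<i> * app ?B ?f i = 0" "app ?A ?f i - \<i> * app ?B ?f i = 0" for i
      by (auto simp: fun_eq_iff)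
    moreover have "x = 0 \<and> y = 0" if "x + \<i> * y = 0" "x - \<i> * y = 0" for x y :: complex
      using that by (auto simp: add_eq_0_iff complex_eq_iff)
    ultimately have "app ?A ?f i = 0 \<and> app ?B ?f i = 0" for i by blast
    then show ?thesis using k(3) by (auto simp: fun_eq_iff)
  qed
qed

text \<open>Up to the common factor \<open>- 2\<close>, the planes contribute the squares of the weights, and every further
  couple of pairs \<open>(2 j, l), (2 j + 1, l)\<close> contributes one multiple of the \<open>j\<close>th weight, the commutator
  that arises when a raising operator is brought to the right; there are \<open>n - 2 j - 2\<close> such \<open>l\<close>.\<close>

lemma casimir_highest_weight_vector:
  assumes v: "v \<in> W" "\<And>s. s < n div 2 \<Longrightarrow> app (gen n \<pi> (2 * s) (Suc (2 * s))) (vfun v) = (\<lambda>i. \<i> * of_real (\<nu> $ s) * vfun v i)"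
  shows "app casimir (vfun v) = (\<lambda>i. of_real (- 2 * casimir_value n \<nu>) * vfun v i)"
proof
  fix i
  let ?e = "gen n \<pi>" and ?f = "vfun v"
  let ?Q = "\<lambda>a b. app (?e a b) (app (?e a b) ?f) i"
  have neg: "app (?e b a) x = (\<lambda>i. - app (?e a b) x i)" if "a < n" "b < n" for a b x
    using anti[OF that] by simp
  have d1: "?Q (2 * j) (Suc (2 * j)) = - (of_real (\<nu> $ j * \<nu> $ j)) * ?f i" if "j < n div 2" for j
  proof -
    have "\<i> * x * (\<i> * x * y) = - (x * x) * y" for x y by (simp add: algebra_simps)
    then show ?thesis by (simp add: v(2)[OF that] app_scale)
  qed
  have d2: "?Q (2 * j) l + ?Q (Suc (2 * j)) l = - of_real (\<nu> $ j) * ?f i" if j: "j < n div 2" and l: "2 * j + 2 \<le> l" "l < n" for j l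
  proof -
    have b: "2 * j < n" "Suc (2 * j) < n" using j by auto
    let ?E = "?e (2 * j) l" and ?F = "?e (Suc (2 * j)) l"
    have "?E * ?F = ?F * ?E + ?e (2 * j) (Suc (2 * j))"
      using equivariantD[OF equivariant_e b(1) l(2) b(2) l(2)] anti[OF b] l by auto
    then have "(?E + cscale \<i> * ?F) * raising ?e j l = ?E * ?E + ?F * ?F - cscale \<i> * ?e (2 * j) (Suc (2 * j))"
      unfolding raising_def by (rule ladder_product)
    then have "app (?E * ?E + ?F * ?F - cscale \<i> * ?e (2 * j) (Suc (2 * j))) ?f i
        = app (?E + cscale \<i> * ?F) (app (raising ?e j l) ?f) i" by (metis app_simps(6))
    also have "app (raising ?e j l) ?f = (\<lambda>i. 0)"
      using raising_kills[OF v j l(2,1)] by blast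
    also have "app (?E + cscale \<i> * ?F) (\<lambda>i. 0) i = 0"
      using app_scale[of "?E + cscale \<i> * ?F" 0] by simp
    finally show ?thesis by (simp add: v(2)[OF j] mult.assoc eq_neg_iff_add_eq_0)
  qed
  have "app casimir ?f i = (\<Sum>a=0..<n. \<Sum>b=0..<n. ?Q a b)"
    by (simp add: casimir_def app_sum)
  also have "\<dots> = 2 * (\<Sum>j=0..<n div 2. ?Q (2 * j) (Suc (2 * j)) + (\<Sum>l=2 * j + 2..<n. ?Q (2 * j) l + ?Q (Suc (2 * j)) l))"
  proof (rule sum_symmetric_pairs)
    show "?Q a b = ?Q b a" if "a < n" "b < n" for a b
      using app_scale[of "?e a b" "- 1"] by (simp add: neg[OF that])
    show "?Q a a = 0" if "a < n" for a using e_diag[OF that] by simp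
  qed
  also have "\<dots> = 2 * (\<Sum>j=0..<n div 2. - of_real (\<nu> $ j * \<nu> $ j + (real n - 2 * real j - 2) * \<nu> $ j) * ?f i)"
  proof (intro arg_cong[of _ _ "\<lambda>x. 2 * x"] sum.cong refl)
    fix j assume "j \<in> {0..<n div 2}"
    then have j: "j < n div 2" by simp
    have "(\<Sum>l=2 * j + 2..<n. ?Q (2 * j) l + ?Q (Suc (2 * j)) l) = (\<Sum>l=2 * j + 2..<n. - of_real (\<nu> $ j) * ?f i)"
      by (rule sum.cong[OF refl], rule d2[OF j]) auto
    also have "\<dots> = - of_real ((real n - 2 * real j - 2) * \<nu> $ j) * ?f i"
    proof -
      have "real (n - (2 * j + 2)) = real n - 2 * real j - 2" using j by (subst of_nat_diff) auto
      then have "of_nat (n - (2 * j + 2)) = complex_of_real (real n - 2 * real j - 2)" by (metis of_real_of_nat_eq)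
      then show ?thesis by simp
    qed
    finally show "?Q (2 * j) (Suc (2 * j)) + (\<Sum>l=2 * j + 2..<n. ?Q (2 * j) l + ?Q (Suc (2 * j)) l)
      = - of_real (\<nu> $ j * \<nu> $ j + (real n - 2 * real j - 2) * \<nu> $ j) * ?f i"
      unfolding d1[OF j] by (simp add: algebra_simps)
  qed
  also have "\<dots> = of_real (- 2 * casimir_value n \<nu>) * ?f i"
  proof -
    have "2 * (\<Sum>j\<in>J. - complex_of_real (g j) * z) = of_real (- 2 * (\<Sum>j\<in>J. g j)) * z" for g z and J :: "nat set"
      by (simp add: sum_negf sum_distrib_right[symmetric])
    then show ?thesis unfolding casimir_value_def .
  qed
  finally show "app casimir ?f i = \<dots>" .
qed

theorem casimir_scalar:
  assumes irr: "so_irreducible n N \<pi> W" and C: "acts N casimir C" and w: "w \<in> W"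
  shows "C *\<^sub>v w = of_real (- 2 * casimir_value n \<nu>) \<cdot>\<^sub>v w"
proof -
  have P: "preserves W casimir" unfolding casimir_def
    by (intro preserves_sum[OF invariant_subspace] preserves_mult[OF invariant_subspace] preserves_gen)
  obtain c where c: "\<And>w. w \<in> W \<Longrightarrow> C *\<^sub>v w = c \<cdot>\<^sub>v w"
    using so_irreducible_schur[OF rep irr C P casimir_central] by blast
  obtain v where v: "v \<in> W" "v \<noteq> 0\<^sub>v N" "\<And>s. s < n div 2 \<Longrightarrow> app (gen n \<pi> (2 * s) (Suc (2 * s))) (vfun v) = (\<lambda>i. \<i> * of_real (\<nu> $ s) * vfun v i)"
    using hw weight_eq_iff unfolding so_highest_weight_def so_weights_def by blast
  have vc: "v \<in> carrier_vec N" using subspace_carrier[OF invariant_subspace v(1)] .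
  have "(\<lambda>i. c * vfun v i) = (\<lambda>i. of_real (- 2 * casimir_value n \<nu>) * vfun v i)"
    using casimir_highest_weight_vector[OF v(1,3)] acts_app[OF C vc] c[OF v(1)] by (simp add: vfun_smult)
  moreover obtain i where "vfun v i \<noteq> 0"
    using v(2) vfun_inject[OF vc zero_carrier_vec] by (auto simp: vfun_zero fun_eq_iff)
  ultimately have "c = of_real (- 2 * casimir_value n \<nu>)" by (metis mult_right_cancel)
  then show ?thesis using c[OF w] by simp
qed

end

section \<open>Block matrices and the tensor product\<close>

lemma block_index: "\<lbrakk>a < d; i < n\<rbrakk> \<Longrightarrow> a * n + i < d * n" for a d i n :: nat
proof -
  assume a: "a < d" "i < n"
  then have "a * n + i < Suc a * n" by simp
  also have "\<dots> \<le> d * n" using a by (intro mult_le_mono1) simp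
  finally show ?thesis .
qed

definition mat_block :: "nat \<Rightarrow> nat \<Rightarrow> complex mat \<Rightarrow> nat \<Rightarrow> nat \<Rightarrow> complex mat" where
  "mat_block d n M i j = mat d d (\<lambda>(a, b). M $$ (a * n + i, b * n + j))"

text \<open>The blocks of \<open>M\<close> as an operator on \<open>V \<otimes> \<complex>\<^sup>n\<close>, with \<open>dim V = d\<close>.\<close>

definition block_acts :: "nat \<Rightarrow> nat \<Rightarrow> (nat \<Rightarrow> nat \<Rightarrow> lin_op) \<Rightarrow> complex mat \<Rightarrow> bool" where
  "block_acts d n X M \<longleftrightarrow> M \<in> carrier_mat (d * n) (d * n) \<and> (\<forall>i<n. \<forall>j<n. acts d (X i j) (mat_block d n M i j))"

lemma mat_block_carrier: "mat_block d n M i j \<in> carrier_mat d d"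
  by (simp add: mat_block_def)

lemma mat_block_eqI:
  assumes M: "M \<in> carrier_mat (d * n) (d * n)" "M' \<in> carrier_mat (d * n) (d * n)"
    and eq: "\<And>i j. \<lbrakk>i < n; j < n\<rbrakk> \<Longrightarrow> mat_block d n M i j = mat_block d n M' i j"
  shows "M = M'"
proof (rule eq_matI)
  fix k l assume "k < dim_row M'" "l < dim_col M'"
  then have k: "k < d * n" and l: "l < d * n" using M by auto
  then have n: "0 < n" by (cases n) auto
  have "k div n < d" "l div n < d" using k l by (simp_all add: less_mult_imp_div_less)
  moreover have "mat_block d n M (k mod n) (l mod n) $$ (k div n, l div n) = mat_block d n M' (k mod n) (l mod n) $$ (k div n, l div n)"
    using eq n by simp
  ultimately show "M $$ (k, l) = M' $$ (k, l)" by (simp add: mat_block_def)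
qed (use M in auto)

lemma block_acts_unique:
  assumes "block_acts d n X M" "block_acts d n X M'"
  shows "M = M'"
proof (rule mat_block_eqI[of _ d n])
  fix i j assume "i < n" "j < n"
  then show "mat_block d n M i j = mat_block d n M' i j"
    using assms by (intro acts_unique[of d "X i j"]) (simp_all add: block_acts_def)
qed (use assms in \<open>simp_all add: block_acts_def\<close>)

lemma block_acts_cong:
  assumes "block_acts d n X M" "\<And>i j. \<lbrakk>i < n; j < n\<rbrakk> \<Longrightarrow> X i j = Y i j"
  shows "block_acts d n Y M"
  using assms by (simp add: block_acts_def)

lemma block_acts_add:
  assumes "block_acts d n X M" "block_acts d n Y M'"
  shows "block_acts d n (\<lambda>i j. X i j + Y i j) (M + M')"
proof -
  have C: "M \<in> carrier_mat (d * n) (d * n)" "M' \<in> carrier_mat (d * n) (d * n)" using assms by (auto simp: block_acts_def)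
  have "mat_block d n (M + M') i j = mat_block d n M i j + mat_block d n M' i j" if "i < n" "j < n" for i j
    using C that by (intro eq_matI) (auto simp: mat_block_def block_index)
  then show ?thesis using assms by (auto simp: block_acts_def intro: acts_add)
qed

lemma block_acts_cscale:
  assumes "block_acts d n X M"
  shows "block_acts d n (\<lambda>i j. cscale c * X i j) (c \<cdot>\<^sub>m M)"
proof -
  have C: "M \<in> carrier_mat (d * n) (d * n)" using assms by (auto simp: block_acts_def)
  have "mat_block d n (c \<cdot>\<^sub>m M) i j = c \<cdot>\<^sub>m mat_block d n M i j" if "i < n" "j < n" for i j
    using C that by (intro eq_matI) (auto simp: mat_block_def block_index)
  then show ?thesis using assms by (auto simp: block_acts_def intro: acts_smult)
qed

lemma block_acts_one: "block_acts d n (\<lambda>i j. if i = j then 1 else 0) (1\<^sub>m (d * n))"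
proof -
  have "mat_block d n (1\<^sub>m (d * n)) i j = (if i = j then 1\<^sub>m d else 0\<^sub>m d d)" if ij: "i < n" "j < n" for i j
  proof (rule eq_matI)
    fix a b assume "a < dim_row (if i = j then 1\<^sub>m d else 0\<^sub>m d d :: complex mat)" "b < dim_col (if i = j then 1\<^sub>m d else 0\<^sub>m d d :: complex mat)"
    then have ab: "a < d" "b < d" by (auto split: if_splits)
    have "a * n + i = b * n + j \<longleftrightarrow> a = b \<and> i = j"
      using ij by (metis add.commute div_mult_self3 div_less less_nat_zero_code mod_less mod_mult_self3 add.right_neutral)
    then show "mat_block d n (1\<^sub>m (d * n)) i j $$ (a, b) = (if i = j then 1\<^sub>m d else 0\<^sub>m d d) $$ (a, b)"
      using ab ij by (auto simp: mat_block_def block_index)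
  qed (auto simp: mat_block_def)
  then show ?thesis by (auto simp: block_acts_def acts_one acts_zero)
qed

lemma block_acts_zero: "block_acts d n (\<lambda>i j. 0) (0\<^sub>m (d * n) (d * n))"
proof -
  have "mat_block d n (0\<^sub>m (d * n) (d * n)) i j = 0\<^sub>m d d" if "i < n" "j < n" for i j
    using that by (intro eq_matI) (auto simp: mat_block_def block_index)
  then show ?thesis by (auto simp: block_acts_def acts_zero)
qed

lemma block_acts_mult:
  assumes X: "block_acts d n X M" and Y: "block_acts d n Y M'"
  shows "block_acts d n (\<lambda>i j. \<Sum>k=0..<n. X i k * Y k j) (M * M')"
proof -
  have C: "M \<in> carrier_mat (d * n) (d * n)" "M' \<in> carrier_mat (d * n) (d * n)" using assms by (auto simp: block_acts_def)
  have "mat_block d n (M * M') i j = msum d d (\<lambda>k. mat_block d n M i k * mat_block d n M' k j) {0..<n}" if ij: "i < n" "j < n" for i j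
  proof (rule eq_matI)
    let ?S = "msum d d (\<lambda>k. mat_block d n M i k * mat_block d n M' k j) {0..<n}"
    have S: "?S \<in> carrier_mat d d" by (rule msum_carrier) (auto intro: mult_carrier_mat[of _ d d] mat_block_carrier)
    fix a b assume "a < dim_row ?S" "b < dim_col ?S"
    then have ab: "a < d" "b < d" using S by auto
    have "mat_block d n (M * M') i j $$ (a, b) = (\<Sum>l=0..<d * n. M $$ (a * n + i, l) * M' $$ (l, b * n + j))"
      using C ab ij by (simp add: mat_block_def block_index scalar_prod_def)
    also have "\<dots> = (\<Sum>l=0..<d * n. M $$ (a * n + i, (l div n) * n + l mod n) * M' $$ ((l div n) * n + l mod n, b * n + j))"
      by simp
    also have "\<dots> = (\<Sum>c=0..<d. \<Sum>k=0..<n. M $$ (a * n + i, c * n + k) * M' $$ (c * n + k, b * n + j))"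
      by (rule sum_div_mod)
    also have "\<dots> = (\<Sum>k=0..<n. \<Sum>c=0..<d. M $$ (a * n + i, c * n + k) * M' $$ (c * n + k, b * n + j))"
      by (rule sum.swap)
    also have "\<dots> = (\<Sum>k=0..<n. (mat_block d n M i k * mat_block d n M' k j) $$ (a, b))"
      using ab by (simp add: mat_block_def scalar_prod_def)
    also have "\<dots> = ?S $$ (a, b)"
      by (rule index_msum[symmetric]) (use ab in \<open>auto intro: mult_carrier_mat[of _ d d] mat_block_carrier\<close>)
    finally show "mat_block d n (M * M') i j $$ (a, b) = ?S $$ (a, b)" .
  next
    have "msum d d (\<lambda>k. mat_block d n M i k * mat_block d n M' k j) {0..<n} \<in> carrier_mat d d"
      by (rule msum_carrier) (auto intro: mult_carrier_mat[of _ d d] mat_block_carrier)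
    then show "dim_row (mat_block d n (M * M') i j) = dim_row (msum d d (\<lambda>k. mat_block d n M i k * mat_block d n M' k j) {0..<n})"
      "dim_col (mat_block d n (M * M') i j) = dim_col (msum d d (\<lambda>k. mat_block d n M i k * mat_block d n M' k j) {0..<n})"
      by (auto simp: mat_block_def)
  qed
  then show ?thesis using X Y C by (auto simp: block_acts_def intro!: acts_msum acts_mult)
qed

lemma block_acts_msum:
  assumes "finite S" "\<And>s. s \<in> S \<Longrightarrow> block_acts d n (X s) (M s)"
  shows "block_acts d n (\<lambda>i j. \<Sum>s\<in>S. X s i j) (msum (d * n) (d * n) M S)"
  using assms
proof (induction S rule: finite_induct)
  case (insert s S)
  then have "msum (d * n) (d * n) M (insert s S) = M s + msum (d * n) (d * n) M S"
    by (intro msum_insert) (auto simp: block_acts_def)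
  then show ?case using insert by (simp add: block_acts_add)
qed (simp add: block_acts_zero msum_empty)

lemma tensor_mat_index:
  assumes "A \<in> carrier_mat d d" "B \<in> carrier_mat n n" "a < d" "b < d" "i < n" "j < n"
  shows "tensor_mat A B $$ (a * n + i, b * n + j) = A $$ (a, b) * B $$ (i, j)"
  using assms block_index[of a d i n] block_index[of b d j n] by (simp add: tensor_mat_def)

lemma tensor_mat_carrier:
  "\<lbrakk>A \<in> carrier_mat d d; B \<in> carrier_mat n n\<rbrakk> \<Longrightarrow> tensor_mat A B \<in> carrier_mat (d * n) (d * n)"
  by (simp add: tensor_mat_def)

context
  fixes n d :: nat and \<pi> :: "real mat \<Rightarrow> complex mat"
  assumes rep: "so_rep n d \<pi>"
begin

lemma block_acts_tensor_rep:
  assumes X: "X \<in> so n"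
  shows "block_acts d n (\<lambda>i j. (if i = j then mat_op (\<pi> X) else 0) + of_real (X $$ (i, j))) (tensor_rep n d \<pi> X)"
proof -
  note P = rep_carrier[OF rep X] and XC = so_carrier[OF X]
  have C: "tensor_mat (\<pi> X) (1\<^sub>m n) \<in> carrier_mat (d * n) (d * n)"
    "tensor_mat (1\<^sub>m d) (map_mat complex_of_real X) \<in> carrier_mat (d * n) (d * n)"
    using P XC by (auto intro!: tensor_mat_carrier)
  have "mat_block d n (tensor_rep n d \<pi> X) i j = (if i = j then 1 else 0) \<cdot>\<^sub>m \<pi> X + complex_of_real (X $$ (i, j)) \<cdot>\<^sub>m 1\<^sub>m d"
    if ij: "i < n" "j < n" for i j
  proof (rule eq_matI)
    fix a b assume "a < dim_row ((if i = j then 1 else 0) \<cdot>\<^sub>m \<pi> X + complex_of_real (X $$ (i, j)) \<cdot>\<^sub>m 1\<^sub>m d)"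
      "b < dim_col ((if i = j then 1 else 0) \<cdot>\<^sub>m \<pi> X + complex_of_real (X $$ (i, j)) \<cdot>\<^sub>m 1\<^sub>m d)"
    then have ab: "a < d" "b < d" by auto
    have "mat_block d n (tensor_rep n d \<pi> X) i j $$ (a, b) = tensor_mat (\<pi> X) (1\<^sub>m n) $$ (a * n + i, b * n + j)
       + tensor_mat (1\<^sub>m d) (map_mat complex_of_real X) $$ (a * n + i, b * n + j)"
      using C ab ij by (simp add: mat_block_def tensor_rep_def block_index)
    also have "\<dots> = \<pi> X $$ (a, b) * 1\<^sub>m n $$ (i, j) + 1\<^sub>m d $$ (a, b) * complex_of_real (X $$ (i, j))"
      using tensor_mat_index[OF P one_carrier_mat ab ij]
        tensor_mat_index[OF one_carrier_mat, of "map_mat complex_of_real X" n a d b i j] XC ab ij by simp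
    finally show "mat_block d n (tensor_rep n d \<pi> X) i j $$ (a, b)
      = ((if i = j then 1 else 0) \<cdot>\<^sub>m \<pi> X + complex_of_real (X $$ (i, j)) \<cdot>\<^sub>m 1\<^sub>m d) $$ (a, b)"
      using ab ij P by auto
  qed (use P in \<open>auto simp: mat_block_def\<close>)
  moreover have "acts d ((if i = j then mat_op (\<pi> X) else 0) + of_real (X $$ (i, j)))
      ((if i = j then 1 else 0) \<cdot>\<^sub>m \<pi> X + complex_of_real (X $$ (i, j)) \<cdot>\<^sub>m 1\<^sub>m d)" for i j
  proof -
    have "(if i = j then mat_op (\<pi> X) else 0) = cscale (if i = j then 1 else 0) * mat_op (\<pi> X)"
      by (simp add: cscale_hom)
    then show ?thesis unfolding cscale_hom(6)[symmetric]
      by (simp only: acts_add acts_smult acts_cscale acts_mat_op[OF P])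
  qed
  moreover have "tensor_rep n d \<pi> X \<in> carrier_mat (d * n) (d * n)" using C by (simp add: tensor_rep_def)
  ultimately show ?thesis by (simp add: block_acts_def)
qed

text \<open>All conditions are compared blockwise; in the bracket the mixed terms
  \<open>X\<^sub>i\<^sub>j \<pi>(Y) + Y\<^sub>i\<^sub>j \<pi>(X)\<close> are symmetric in \<open>X\<close> and \<open>Y\<close> and cancel.\<close>

lemma so_rep_tensor: "so_rep n (d * n) (tensor_rep n d \<pi>)"
proof -
  let ?F = "\<lambda>X i j. (if i = j then mat_op (\<pi> X) else 0) + of_real (X $$ (i, j)) :: lin_op"
  have C: "tensor_rep n d \<pi> X \<in> carrier_mat (d * n) (d * n)" if "X \<in> so n" for X
    using block_acts_tensor_rep[OF that] by (simp add: block_acts_def)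
  have add: "tensor_rep n d \<pi> (X + Y) = tensor_rep n d \<pi> X + tensor_rep n d \<pi> Y" if XY: "X \<in> so n" "Y \<in> so n" for X Y
  proof (rule block_acts_unique[OF block_acts_tensor_rep[OF so_add[OF XY]]])
    show "block_acts d n (?F (X + Y)) (tensor_rep n d \<pi> X + tensor_rep n d \<pi> Y)"
      by (rule block_acts_cong[OF block_acts_add[OF block_acts_tensor_rep[OF XY(1)] block_acts_tensor_rep[OF XY(2)]]])
        (use so_carrier[OF XY(1)] so_carrier[OF XY(2)] rep_carrier[OF rep] XY in
          \<open>auto simp: rep_add[OF rep] mat_op_add[of _ d]\<close>)
  qed
  have smult: "tensor_rep n d \<pi> (r \<cdot>\<^sub>m X) = complex_of_real r \<cdot>\<^sub>m tensor_rep n d \<pi> X" if X: "X \<in> so n" for r X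
  proof (rule block_acts_unique[OF block_acts_tensor_rep[OF so_smult[OF X]]])
    show "block_acts d n (?F (r \<cdot>\<^sub>m X)) (complex_of_real r \<cdot>\<^sub>m tensor_rep n d \<pi> X)"
      by (rule block_acts_cong[OF block_acts_cscale[OF block_acts_tensor_rep[OF X]]])
        (use so_carrier[OF X] X in \<open>auto simp: rep_smult[OF rep] mat_op_smult distrib_left cscale_hom\<close>)
  qed
  have bracket: "tensor_rep n d \<pi> (X * Y - Y * X) = tensor_rep n d \<pi> X * tensor_rep n d \<pi> Y - tensor_rep n d \<pi> Y * tensor_rep n d \<pi> X"
    if XY: "X \<in> so n" "Y \<in> so n" for X Y
  proof -
    note XC = so_carrier[OF XY(1)] and YC = so_carrier[OF XY(2)]
    have S: "X * Y - Y * X \<in> so n"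
      unfolding so_iff
    proof (intro conjI allI impI)
      fix i j assume ij: "i < n" "j < n"
      have "(X * Y) $$ (j, i) = (Y * X) $$ (i, j)" "(Y * X) $$ (j, i) = (X * Y) $$ (i, j)"
      proof -
        have *: "(A * B) $$ (j, i) = (B * A) $$ (i, j)" if A: "A \<in> so n" and B: "B \<in> so n" for A B
        proof -
          have "(A * B) $$ (j, i) = (\<Sum>k=0..<n. A $$ (j, k) * B $$ (k, i))"
            using ij so_carrier[OF A] so_carrier[OF B] by (simp add: scalar_prod_def)
          also have "\<dots> = (\<Sum>k=0..<n. B $$ (i, k) * A $$ (k, j))"
            by (rule sum.cong[OF refl]) (use ij so_index[OF A] so_index[OF B] in \<open>metis atLeastLessThan_iff minus_mult_minus mult.commute\<close>)
          finally show ?thesis using ij so_carrier[OF A] so_carrier[OF B] by (simp add: scalar_prod_def)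
        qed
        show "(X * Y) $$ (j, i) = (Y * X) $$ (i, j)" "(Y * X) $$ (j, i) = (X * Y) $$ (i, j)"
          using * XY by blast+
      qed
      then show "(X * Y - Y * X) $$ (j, i) = - (X * Y - Y * X) $$ (i, j)" using ij XC YC by simp
    qed (use XC YC in auto)
    let ?a = "mat_op (\<pi> X)" and ?b = "mat_op (\<pi> Y)"
    have prod: "(\<Sum>k=0..<n. ?F A i k * ?F B k j)
       = (if i = j then mat_op (\<pi> A) * mat_op (\<pi> B) else 0) + of_real (B $$ (i, j)) * mat_op (\<pi> A)
         + of_real (A $$ (i, j)) * mat_op (\<pi> B) + of_real ((A * B) $$ (i, j))"
      if A: "A \<in> so n" and B: "B \<in> so n" and ij: "i < n" "j < n" for A B i j
    proof -
      have c: "x * of_real r = of_real r * x" for x :: lin_op and r by (simp add: of_real_def)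
      have "(\<Sum>k=0..<n. ?F A i k * ?F B k j) = (\<Sum>k=0..<n. (if i = k then mat_op (\<pi> A) * ?F B k j else 0)
         + (if k = j then of_real (A $$ (i, k)) * mat_op (\<pi> B) else 0) + of_real (A $$ (i, k) * B $$ (k, j)))"
        by (rule sum.cong[OF refl]) (auto simp: algebra_simps)
      also have "\<dots> = mat_op (\<pi> A) * ?F B i j + of_real (A $$ (i, j)) * mat_op (\<pi> B) + of_real (\<Sum>k=0..<n. A $$ (i, k) * B $$ (k, j))"
        using ij by (simp add: sum.distrib)
      also have "(\<Sum>k=0..<n. A $$ (i, k) * B $$ (k, j)) = (A * B) $$ (i, j)"
        using ij so_carrier[OF A] so_carrier[OF B] by (simp add: scalar_prod_def)
      finally show ?thesis by (simp add: distrib_left c[of "mat_op (\<pi> A)"])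
    qed
    let ?M = "tensor_rep n d \<pi> X * tensor_rep n d \<pi> Y" and ?M' = "tensor_rep n d \<pi> Y * tensor_rep n d \<pi> X"
    have MC: "?M \<in> carrier_mat (d * n) (d * n)" "?M' \<in> carrier_mat (d * n) (d * n)" using C XY by (auto intro: mult_carrier_mat)
    have "block_acts d n (?F (X * Y - Y * X)) (?M + (- 1) \<cdot>\<^sub>m ?M')"
    proof (rule block_acts_cong[OF block_acts_add[OF block_acts_mult block_acts_cscale[OF block_acts_mult]]])
      fix i j assume ij: "i < n" "j < n"
      have idx: "(X * Y - Y * X) $$ (i, j) = (X * Y) $$ (i, j) - (Y * X) $$ (i, j)" using ij XC YC by simp
      have em: "mat_op (\<pi> (X * Y - Y * X)) = ?a * ?b - ?b * ?a"
        using rep_carrier[OF rep] XY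
        by (simp add: rep_bracket[OF rep] mat_op_diff[of _ d] mat_op_mult[of _ d] mult_carrier_mat[of _ d d])
      show "(\<Sum>k=0..<n. ?F X i k * ?F Y k j) + cscale (- 1) * (\<Sum>k=0..<n. ?F Y i k * ?F X k j) = ?F (X * Y - Y * X) i j"
        unfolding prod[OF XY ij] prod[OF XY(2,1) ij] idx em by (simp add: cscale_hom)
    qed (use XY in \<open>auto intro: block_acts_tensor_rep\<close>)
    moreover have "?M + (- 1) \<cdot>\<^sub>m ?M' = ?M - ?M'" using MC by (intro eq_matI) auto
    ultimately show ?thesis using block_acts_unique[OF block_acts_tensor_rep[OF S]] by simp
  qed
  show ?thesis unfolding so_rep_def using C add smult bracket by blast
qed

lemma block_acts_tensor_gen:
  assumes "a < n" "b < n"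
  shows "block_acts d n (so_family.tensor_block (gen n \<pi>) a b) (tensor_rep n d \<pi> (so_basis n a b))"
proof (rule block_acts_cong[OF block_acts_tensor_rep[OF so_basis_in_so]])
  fix i j assume ij: "i < n" "j < n"
  have "of_real (so_basis n a b $$ (i, j)) = (so_family.wedge_entry a b i j :: lin_op)"
  proof -
    have g: "of_real (of_bool P * of_bool Q - of_bool P' * of_bool Q') = ((if P \<and> Q then 1 else 0) - (if P' \<and> Q' then 1 else 0) :: lin_op)"
      for P Q P' Q' by simp
    have e: "(j = a) = (a = j)" "(i = b) = (b = i)" "(j = b) = (b = j)" "(i = a) = (a = i)" by blast+
    have cc: "(if a = i \<and> b = j then x else y) = (if b = j \<and> a = i then x else y)" for x y :: lin_op by (simp add: conj_commute)
    show ?thesis unfolding so_basis_index[OF ij] g e so_family.wedge_entry_def[OF so_family_gen[OF rep]] cc ..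
  qed
  then show "(if i = j then mat_op (\<pi> (so_basis n a b)) else 0) + of_real (so_basis n a b $$ (i, j)) = so_family.tensor_block (gen n \<pi>) a b i j"
    by (simp add: so_family.tensor_block_def[OF so_family_gen[OF rep]] gen_def)
qed

end

section \<open>Orthogonal projections and Clifford homomorphisms\<close>

lemma cscalar_prod_swap:
  fixes x y :: "complex vec"
  assumes "x \<in> carrier_vec N" "y \<in> carrier_vec N"
  shows "cnj (x \<bullet>c y) = y \<bullet>c x"
  using assms by (simp add: scalar_prod_def mult.commute)

lemma mult_mat_vec_index:
  assumes "M \<in> carrier_mat r c" "z \<in> carrier_vec c" "k < r"
  shows "(M *\<^sub>v z) $ k = (\<Sum>l=0..<c. M $$ (k, l) * z $ l)"
  using assms by (simp add: scalar_prod_def)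

lemma orth_proj_unique_value:
  assumes W: "is_subspace N W" and v: "v \<in> carrier_vec N"
    and x: "x \<in> W" "\<And>u. u \<in> W \<Longrightarrow> (v - x) \<bullet>c u = 0"
    and y: "y \<in> W" "\<And>u. u \<in> W \<Longrightarrow> (v - y) \<bullet>c u = 0"
  shows "x = y"
proof -
  note Wc = subspace_carrier[OF W]
  have xc: "x \<in> carrier_vec N" and yc: "y \<in> carrier_vec N" using Wc x y by auto
  have m: "x + (- 1) \<cdot>\<^sub>v y = x - y" using xc yc by (intro eq_vecI) auto
  have u: "x - y \<in> W" using W x(1) y(1) unfolding m[symmetric] by (auto simp: is_subspace_def)
  then have uc: "conjugate (x - y) \<in> carrier_vec N" using Wc by auto
  have "(v - y) - (v - x) = x - y" using v xc yc by (intro eq_vecI) auto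
  then have "(x - y) \<bullet>c (x - y) = (v - y) \<bullet>c (x - y) - (v - x) \<bullet>c (x - y)"
    using minus_scalar_prod_distrib[of "v - y" N "v - x" "conjugate (x - y)"] v xc yc uc by simp
  then have "(x - y) \<bullet>c (x - y) = 0" using x(2)[OF u] y(2)[OF u] by simp
  then have "x - y = 0\<^sub>v N" using xc yc by (simp add: conjugate_square_eq_0_vec[of _ N])
  moreover have "x = (x - y) + y" using xc yc by (intro eq_vecI) auto
  ultimately show ?thesis using yc by simp
qed

text \<open>The decomposition of the basis vectors determines the columns of the projection, and the set of
  pairs \<open>(v, w)\<close> with \<open>w \<in> W\<close> and \<open>v - w\<close> orthogonal to \<open>W\<close> is a linear space, so that every vector is
  decomposed correctly.\<close>

lemma orth_proj_exists:
  assumes W: "is_subspace N W"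
    and split: "\<And>v. v \<in> carrier_vec N \<Longrightarrow> \<exists>w \<in> W. \<forall>u \<in> W. (v - w) \<bullet>c u = 0"
  shows "orth_proj N W \<in> carrier_mat N N \<and>
     (\<forall>v \<in> carrier_vec N. orth_proj N W *\<^sub>v v \<in> W \<and> (\<forall>u \<in> W. (v - orth_proj N W *\<^sub>v v) \<bullet>c u = 0))"
proof -
  note Wc = subspace_carrier[OF W]
  let ?is = "\<lambda>P. P \<in> carrier_mat N N \<and> (\<forall>v \<in> carrier_vec N. P *\<^sub>v v \<in> W \<and> (\<forall>u \<in> W. (v - P *\<^sub>v v) \<bullet>c u = 0))"
  obtain w where w: "\<And>j. w j \<in> W" "\<And>j u. u \<in> W \<Longrightarrow> (unit_vec N j - w j) \<bullet>c u = 0"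
    using split[of "unit_vec N _"] by (metis unit_vec_carrier)
  have wc: "w j \<in> carrier_vec N" for j using w(1) Wc by blast
  define P where "P = mat N N (\<lambda>(i, j). w j $ i)"
  have "P *\<^sub>v v \<in> W \<and> (\<forall>u \<in> W. (v - P *\<^sub>v v) \<bullet>c u = 0)" if v: "v \<in> carrier_vec N" for v
  proof -
    define x where "x k = vec N (\<lambda>i. if i < k then v $ i else 0)" for k
    define y where "y k = vec N (\<lambda>i. \<Sum>j=0..<k. w j $ i * v $ j)" for k
    have "y k \<in> W \<and> (\<forall>u \<in> W. (x k - y k) \<bullet>c u = 0)" if "k \<le> N" for k
      using that
    proof (induction k)
      case 0
      have "y 0 = 0\<^sub>v N" "x 0 - y 0 = 0\<^sub>v N" by (auto simp: x_def y_def)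
      then show ?case using W Wc by (auto simp: is_subspace_def)
    next
      case (Suc k)
      then have IH: "y k \<in> W" "\<And>u. u \<in> W \<Longrightarrow> (x k - y k) \<bullet>c u = 0" by auto
      have "y (Suc k) = y k + v $ k \<cdot>\<^sub>v w k" using wc[of k] by (intro eq_vecI) (auto simp: y_def)
      moreover have "x (Suc k) - y (Suc k) = (x k - y k) + v $ k \<cdot>\<^sub>v (unit_vec N k - w k)"
        using wc[of k] Suc.prems by (intro eq_vecI) (auto simp: x_def y_def algebra_simps unit_vec_def less_Suc_eq)
      moreover have "((x k - y k) + v $ k \<cdot>\<^sub>v (unit_vec N k - w k)) \<bullet>c u = 0" if u: "u \<in> W" for u
        using IH(2)[OF u] w(2)[OF u, of k] Wc[OF u] wc[of k]
        by (subst add_scalar_prod_distrib[of _ N]) (auto simp: x_def y_def)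
      ultimately show ?case using IH(1) w(1)[of k] W by (auto simp: is_subspace_def)
    qed
    from this[of N] have "y N \<in> W \<and> (\<forall>u \<in> W. (x N - y N) \<bullet>c u = 0)" by simp
    moreover have "x N = v" using v by (intro eq_vecI) (auto simp: x_def)
    moreover have "y N = P *\<^sub>v v" using v by (intro eq_vecI) (auto simp: y_def P_def scalar_prod_def)
    ultimately show ?thesis by simp
  qed
  then have P: "?is P" by (simp add: P_def)
  moreover have "Q = P" if Q: "?is Q" for Q
  proof (rule mat_eq_by_vec[of _ N N])
    fix v :: "complex vec" assume "v \<in> carrier_vec N"
    then show "Q *\<^sub>v v = P *\<^sub>v v" using orth_proj_unique_value[OF W] P Q by blast
  qed (use P Q in auto)
  ultimately show ?thesis unfolding orth_proj_def by (rule theI)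
qed

lemma scalar_on_eq:
  assumes "w \<in> W" "w \<in> carrier_vec N" "w \<noteq> 0\<^sub>v N" "\<And>v. v \<in> W \<Longrightarrow> A *\<^sub>v v = c \<cdot>\<^sub>v v"
  shows "scalar_on W A = c"
  unfolding scalar_on_def
proof (rule the_equality)
  fix c' assume "\<forall>v \<in> W. A *\<^sub>v v = c' \<cdot>\<^sub>v v"
  then have eq: "c' \<cdot>\<^sub>v w = c \<cdot>\<^sub>v w" using assms(1,4) by metis
  obtain i where i: "i < N" "w $ i \<noteq> 0" using assms(2,3) by (metis eq_vecI carrier_vecD index_zero_vec)
  have "c' * w $ i = c * w $ i" using arg_cong[OF eq, of "\<lambda>v. v $ i"] i assms(2) by simp
  then show "c' = c" using i by simp
qed (use assms(4) in blast)

lemma irreducible_nonzero: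
  assumes "so_irreducible n N \<pi> W"
  shows "is_subspace N W" "\<exists>w. w \<in> W \<and> w \<in> carrier_vec N \<and> w \<noteq> 0\<^sub>v N"
proof -
  show W: "is_subspace N W" using assms by (simp add: so_irreducible_def so_invariant_iff)
  show "\<exists>w. w \<in> W \<and> w \<in> carrier_vec N \<and> w \<noteq> 0\<^sub>v N"
    using assms W by (auto simp: so_irreducible_def is_subspace_def)
qed

lemma decomposition_orth_proj:
  assumes dec: "irreducible_decomposition n N \<tau> L W" and w: "\<And>\<nu>. \<nu> \<in> L \<Longrightarrow> w \<nu> \<in> W \<nu>"
    and v: "v = finsum_vec TYPE(complex) N w L" and \<nu>: "\<nu> \<in> L"
  shows "u \<in> W \<nu> \<Longrightarrow> (v - w \<nu>) \<bullet>c u = 0"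
proof -
  assume u: "u \<in> W \<nu>"
  have fin: "finite L" and orth: "\<And>\<mu> x. \<lbrakk>\<mu> \<in> L; \<mu> \<noteq> \<nu>; x \<in> W \<mu>\<rbrakk> \<Longrightarrow> x \<bullet>c u = 0"
    and sub: "\<And>\<mu>. \<mu> \<in> L \<Longrightarrow> is_subspace N (W \<mu>)"
    using dec u \<nu> irreducible_nonzero(1) by (auto simp: irreducible_decomposition_def)
  have wc: "w \<mu> \<in> carrier_vec N" if "\<mu> \<in> L" for \<mu> using subspace_carrier[OF sub[OF that] w[OF that]] .
  have uc: "u \<in> carrier_vec N" using subspace_carrier[OF sub[OF \<nu>] u] .
  have vc: "v \<in> carrier_vec N" unfolding v by (rule finsum_vec_closed) (use wc in auto)
  have "(v - w \<nu>) \<bullet>c u = (\<Sum>i=0..<N. (\<Sum>\<mu>\<in>L - {\<nu>}. w \<mu> $ i) * cnj (u $ i))"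
  proof -
    have "(v - w \<nu>) $ i = (\<Sum>\<mu>\<in>L - {\<nu>}. w \<mu> $ i)" if "i < N" for i
    proof -
      have "v $ i = (\<Sum>\<mu>\<in>L. w \<mu> $ i)"
        unfolding v by (rule index_finsum_vec[OF fin that]) (use wc in auto)
      also have "\<dots> = w \<nu> $ i + (\<Sum>\<mu>\<in>L - {\<nu>}. w \<mu> $ i)" by (rule sum.remove[OF fin \<nu>])
      finally show ?thesis using that vc wc[OF \<nu>] by simp
    qed
    then show ?thesis using vc wc[OF \<nu>] uc by (simp add: scalar_prod_def)
  qed
  also have "\<dots> = (\<Sum>\<mu>\<in>L - {\<nu>}. w \<mu> \<bullet>c u)"
  proof -
    have "(\<Sum>\<mu>\<in>L - {\<nu>}. w \<mu> \<bullet>c u) = (\<Sum>\<mu>\<in>L - {\<nu>}. \<Sum>i=0..<N. w \<mu> $ i * cnj (u $ i))"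
      using uc wc by (intro sum.cong refl) (simp add: scalar_prod_def)
    then show ?thesis by (subst (asm) sum.swap) (simp add: sum_distrib_right)
  qed
  also have "\<dots> = 0" using orth w by (intro sum.neutral) auto
  finally show ?thesis .
qed

lemma decomposition_projections:
  assumes dec: "irreducible_decomposition n N \<tau> L W"
  shows "\<And>\<nu>. \<nu> \<in> L \<Longrightarrow> orth_proj N (W \<nu>) \<in> carrier_mat N N"
    and "\<And>\<nu> v. \<lbrakk>\<nu> \<in> L; v \<in> carrier_vec N\<rbrakk> \<Longrightarrow> orth_proj N (W \<nu>) *\<^sub>v v \<in> W \<nu>"
    and "\<And>\<nu> v u. \<lbrakk>\<nu> \<in> L; v \<in> carrier_vec N; u \<in> W \<nu>\<rbrakk> \<Longrightarrow> (v - orth_proj N (W \<nu>) *\<^sub>v v) \<bullet>c u = 0"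
    and "\<And>v i. \<lbrakk>v \<in> carrier_vec N; i < N\<rbrakk> \<Longrightarrow> v $ i = (\<Sum>\<nu>\<in>L. (orth_proj N (W \<nu>) *\<^sub>v v) $ i)"
proof -
  have fin: "finite L" and sub: "\<And>\<nu>. \<nu> \<in> L \<Longrightarrow> is_subspace N (W \<nu>)"
    using dec irreducible_nonzero(1) by (auto simp: irreducible_decomposition_def)
  have total: "\<exists>w. (\<forall>\<nu> \<in> L. w \<nu> \<in> W \<nu>) \<and> v = finsum_vec TYPE(complex) N w L" if "v \<in> carrier_vec N" for v
    using dec that unfolding irreducible_decomposition_def by blast
  have P: "orth_proj N (W \<nu>) \<in> carrier_mat N N \<and>
     (\<forall>v \<in> carrier_vec N. orth_proj N (W \<nu>) *\<^sub>v v \<in> W \<nu> \<and> (\<forall>u \<in> W \<nu>. (v - orth_proj N (W \<nu>) *\<^sub>v v) \<bullet>c u = 0))"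
    if \<nu>: "\<nu> \<in> L" for \<nu>
  proof (rule orth_proj_exists[OF sub[OF \<nu>]])
    fix v :: "complex vec" assume "v \<in> carrier_vec N"
    then obtain w where "\<forall>\<nu> \<in> L. w \<nu> \<in> W \<nu>" "v = finsum_vec TYPE(complex) N w L" using total by blast
    then show "\<exists>w \<in> W \<nu>. \<forall>u \<in> W \<nu>. (v - w) \<bullet>c u = 0"
      using decomposition_orth_proj[OF dec _ _ \<nu>, of w v] \<nu> by blast
  qed
  show "\<And>\<nu>. \<nu> \<in> L \<Longrightarrow> orth_proj N (W \<nu>) \<in> carrier_mat N N"
    "\<And>\<nu> v. \<lbrakk>\<nu> \<in> L; v \<in> carrier_vec N\<rbrakk> \<Longrightarrow> orth_proj N (W \<nu>) *\<^sub>v v \<in> W \<nu>"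
    "\<And>\<nu> v u. \<lbrakk>\<nu> \<in> L; v \<in> carrier_vec N; u \<in> W \<nu>\<rbrakk> \<Longrightarrow> (v - orth_proj N (W \<nu>) *\<^sub>v v) \<bullet>c u = 0"
    using P by blast+
  fix v :: "complex vec" and i assume v: "v \<in> carrier_vec N" and i: "i < N"
  then obtain w where w: "\<forall>\<nu> \<in> L. w \<nu> \<in> W \<nu>" "v = finsum_vec TYPE(complex) N w L" using total by blast
  have "orth_proj N (W \<nu>) *\<^sub>v v = w \<nu>" if \<nu>: "\<nu> \<in> L" for \<nu>
    by (rule orth_proj_unique_value[OF sub[OF \<nu>] v])
      (use P[OF \<nu>] v w \<nu> decomposition_orth_proj[OF dec _ w(2) \<nu>] in auto)
  moreover have "v $ i = (\<Sum>\<nu>\<in>L. w \<nu> $ i)"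
    unfolding w(2) by (rule index_finsum_vec[OF fin i]) (use w(1) sub in \<open>auto dest: subspace_carrier\<close>)
  ultimately show "v $ i = (\<Sum>\<nu>\<in>L. (orth_proj N (W \<nu>) *\<^sub>v v) $ i)" by simp
qed

lemma mat_adjoint_mult_index:
  fixes A B :: "complex mat"
  assumes "A \<in> carrier_mat r c" "B \<in> carrier_mat r c" "a < c" "b < c"
  shows "(mat_adjoint A * B) $$ (a, b) = col B b \<bullet>c col A a"
proof -
  have "(mat_adjoint A * B) $$ (a, b) = conjugate (col A a) \<bullet> col B b"
    using assms unfolding mat_adjoint_def by simp
  also have "\<dots> = col B b \<bullet>c col A a"
    by (rule comm_scalar_prod[of _ r]) (use assms in auto)
  finally show ?thesis .
qed

text \<open>One of the two projections in \<open>p(\<xi>)\<^sup>* p(\<eta>)\<close> can be omitted, because \<open>x - P x\<close> is orthogonal to the image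
  of \<open>P\<close>.\<close>

lemma clifford_pairing:
  assumes dec: "irreducible_decomposition n (d * n) \<tau> L W" and \<nu>: "\<nu> \<in> L"
    and \<xi>: "\<xi> \<in> carrier_vec n" and \<eta>: "\<eta> \<in> carrier_vec n" and ab: "a < d" "b < d"
  shows "clifford_hom n d (W \<nu>) \<xi> \<in> carrier_mat (d * n) d"
    and "(mat_adjoint (clifford_hom n d (W \<nu>) \<xi>) * clifford_hom n d (W \<nu>) \<eta>) $$ (a, b)
      = (orth_proj (d * n) (W \<nu>) *\<^sub>v tensor_vec (unit_vec d b) \<eta>) \<bullet>c tensor_vec (unit_vec d a) \<xi>"
proof -
  let ?P = "orth_proj (d * n) (W \<nu>)"
  note P = decomposition_projections[OF dec]
  have C: "clifford_hom n d (W \<nu>) \<zeta> \<in> carrier_mat (d * n) d" for \<zeta>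
    unfolding clifford_hom_def using P(1)[OF \<nu>] by (intro mult_carrier_mat[of _ _ "d * n"]) auto
  then show "clifford_hom n d (W \<nu>) \<xi> \<in> carrier_mat (d * n) d" .
  have col: "col (clifford_hom n d (W \<nu>) \<zeta>) c = ?P *\<^sub>v tensor_vec (unit_vec d c) \<zeta>"
    if "\<zeta> \<in> carrier_vec n" "c < d" for \<zeta> c
  proof -
    have "col (clifford_hom n d (W \<nu>) \<zeta>) c = clifford_hom n d (W \<nu>) \<zeta> *\<^sub>v unit_vec d c"
      using C[of \<zeta>] that by (intro eq_vecI) auto
    then show ?thesis using clifford_hom_mult_vec[OF P(1)[OF \<nu>] that(1)] by simp
  qed
  let ?x = "tensor_vec (unit_vec d a) \<xi>" and ?y = "tensor_vec (unit_vec d b) \<eta>"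
  have xy: "?x \<in> carrier_vec (d * n)" "?y \<in> carrier_vec (d * n)" using \<xi> \<eta> by (auto simp: tensor_vec_def)
  have Pc: "?P *\<^sub>v ?x \<in> carrier_vec (d * n)" "?P *\<^sub>v ?y \<in> carrier_vec (d * n)"
    using P(1)[OF \<nu>] xy by (auto intro: mult_mat_vec_carrier)
  have "(?x - ?P *\<^sub>v ?x) \<bullet>c (?P *\<^sub>v ?y) = 0" using P(3)[OF \<nu> xy(1) P(2)[OF \<nu> xy(2)]] .
  then have "?x \<bullet>c (?P *\<^sub>v ?y) = (?P *\<^sub>v ?x) \<bullet>c (?P *\<^sub>v ?y)"
    using minus_scalar_prod_distrib[OF xy(1) Pc(1), of "conjugate (?P *\<^sub>v ?y)"] Pc by simp
  then have "cnj (?x \<bullet>c (?P *\<^sub>v ?y)) = cnj ((?P *\<^sub>v ?x) \<bullet>c (?P *\<^sub>v ?y))" by (rule arg_cong)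
  then have "(?P *\<^sub>v ?y) \<bullet>c ?x = (?P *\<^sub>v ?y) \<bullet>c (?P *\<^sub>v ?x)"
    unfolding cscalar_prod_swap[OF xy(1) Pc(2)] cscalar_prod_swap[OF Pc] .
  then show "(mat_adjoint (clifford_hom n d (W \<nu>) \<xi>) * clifford_hom n d (W \<nu>) \<eta>) $$ (a, b) = (?P *\<^sub>v ?y) \<bullet>c ?x"
    unfolding mat_adjoint_mult_index[OF C C ab] col[OF \<xi> ab(1)] col[OF \<eta> ab(2)] by simp
qed

lemma tensor_vec_block_form:
  assumes M: "M \<in> carrier_mat (d * n) (d * n)" and \<xi>: "\<xi> \<in> carrier_vec n" and \<eta>: "\<eta> \<in> carrier_vec n"
    and ab: "a < d" "b < d"
  shows "(M *\<^sub>v tensor_vec (unit_vec d b) \<eta>) \<bullet>c tensor_vec (unit_vec d a) \<xi>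
    = (\<Sum>i=0..<n. \<Sum>j=0..<n. mat_block d n M i j $$ (a, b) * \<eta> $ j * cnj (\<xi> $ i))"
proof -
  have pick: "(\<Sum>k=0..<d * n. F (k div n) (k mod n) * ((if k div n = c then 1 else 0) * G (k mod n)))
     = (\<Sum>i=0..<n. F c i * G i)" if c: "c < d" for c F and G :: "nat \<Rightarrow> complex"
  proof -
    have "(\<Sum>k=0..<d * n. F (k div n) (k mod n) * ((if k div n = c then 1 else 0) * G (k mod n)))
      = (\<Sum>p=0..<d. \<Sum>i=0..<n. F p i * ((if p = c then 1 else 0) * G i))" by (rule sum_div_mod)
    also have "\<dots> = (\<Sum>p=0..<d. if p = c then \<Sum>i=0..<n. F p i * G i else 0)"
      by (intro sum.cong refl) auto
    finally show ?thesis using c by simp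
  qed
  have t: "tensor_vec (unit_vec d c) \<zeta> $ k = (if k div n = c then 1 else 0) * \<zeta> $ (k mod n)"
    if "k < d * n" "\<zeta> \<in> carrier_vec n" "c < d" for c \<zeta> k
    using that by (simp add: tensor_vec_def unit_vec_def less_mult_imp_div_less)
  have y: "(M *\<^sub>v tensor_vec (unit_vec d b) \<eta>) $ k = (\<Sum>j=0..<n. M $$ (k, b * n + j) * \<eta> $ j)" if k: "k < d * n" for k
  proof -
    have "(M *\<^sub>v tensor_vec (unit_vec d b) \<eta>) $ k
      = (\<Sum>l=0..<d * n. M $$ (k, (l div n) * n + l mod n) * ((if l div n = b then 1 else 0) * \<eta> $ (l mod n)))"
      using M k \<eta> ab by (simp add: scalar_prod_def t tensor_vec_def[of _ \<eta>] cong: sum.cong) (simp add: t[symmetric] tensor_vec_def)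
    then show ?thesis using pick[OF ab(2), of "\<lambda>p i. M $$ (k, p * n + i)" "\<lambda>i. \<eta> $ i"] by simp
  qed
  have "(M *\<^sub>v tensor_vec (unit_vec d b) \<eta>) \<bullet>c tensor_vec (unit_vec d a) \<xi>
    = (\<Sum>k=0..<d * n. (\<Sum>j=0..<n. M $$ ((k div n) * n + k mod n, b * n + j) * \<eta> $ j) * ((if k div n = a then 1 else 0) * cnj (\<xi> $ (k mod n))))"
  proof -
    have "dim_vec (tensor_vec (unit_vec d a) \<xi>) = d * n" using \<xi> by (simp add: tensor_vec_def)
    then show ?thesis unfolding scalar_prod_def using \<xi> ab
      by (auto intro!: sum.cong simp: y t)
  qed
  also have "\<dots> = (\<Sum>i=0..<n. (\<Sum>j=0..<n. M $$ (a * n + i, b * n + j) * \<eta> $ j) * cnj (\<xi> $ i))"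
    by (rule pick[OF ab(1), of "\<lambda>p i. \<Sum>j=0..<n. M $$ (p * n + i, b * n + j) * \<eta> $ j" "\<lambda>i. cnj (\<xi> $ i)"])
  finally show ?thesis using ab by (simp add: mat_block_def sum_distrib_right)
qed

text \<open>The spectral decomposition of \<open>M\<close> turns the weighted sum of the projections into \<open>M\<close> itself, and its
  matrix elements between \<open>e\<^sub>b \<otimes> \<eta>\<close> and \<open>e\<^sub>a \<otimes> \<xi>\<close> only involve the blocks of \<open>M\<close>.\<close>

theorem clifford_sym_sum:
  assumes dec: "irreducible_decomposition n (d * n) \<tau> L W"
    and M: "M \<in> carrier_mat (d * n) (d * n)"
    and eig: "\<And>\<nu> w. \<lbrakk>\<nu> \<in> L; w \<in> W \<nu>\<rbrakk> \<Longrightarrow> M *\<^sub>v w = f \<nu> \<cdot>\<^sub>v w"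
    and blocks: "\<And>i j. \<lbrakk>i < n; j < n\<rbrakk> \<Longrightarrow> mat_block d n M i j + mat_block d n M j i = (if i = j then c else 0) \<cdot>\<^sub>m 1\<^sub>m d"
    and \<xi>: "\<xi> \<in> carrier_vec n" and \<eta>: "\<eta> \<in> carrier_vec n"
  shows "msum d d (\<lambda>\<nu>. f \<nu> \<cdot>\<^sub>m clifford_sym n d (W \<nu>) \<xi> \<eta>) L = (c * complex_of_real (\<xi> \<bullet> \<eta>)) \<cdot>\<^sub>m 1\<^sub>m d"
proof -
  have fin: "finite L" using dec by (simp add: irreducible_decomposition_def)
  note P = decomposition_projections[OF dec]
  let ?P = "\<lambda>\<nu>. orth_proj (d * n) (W \<nu>)"
  let ?c = "\<lambda>\<zeta>. map_vec complex_of_real \<zeta>"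
  let ?t = "\<lambda>a \<zeta>. tensor_vec (unit_vec d a) (?c \<zeta>)"
  let ?K = "\<lambda>\<nu>. clifford_sym n d (W \<nu>) \<xi> \<eta>" and ?p = "\<lambda>\<nu> \<zeta>. clifford_hom n d (W \<nu>) (?c \<zeta>)"
  have spectral: "(M *\<^sub>v v) \<bullet>c u = (\<Sum>\<nu>\<in>L. f \<nu> * ((?P \<nu> *\<^sub>v v) \<bullet>c u))"
    if v: "v \<in> carrier_vec (d * n)" and u: "u \<in> carrier_vec (d * n)" for u v
  proof -
    have entry: "(M *\<^sub>v v) $ k = (\<Sum>\<nu>\<in>L. f \<nu> * (?P \<nu> *\<^sub>v v) $ k)" if k: "k < d * n" for k
    proof -
      have "(M *\<^sub>v v) $ k = (\<Sum>l=0..<d * n. M $$ (k, l) * (\<Sum>\<nu>\<in>L. (?P \<nu> *\<^sub>v v) $ l))"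
        unfolding mult_mat_vec_index[OF M v k] by (intro sum.cong refl) (use P(4)[OF v] in simp)
      also have "\<dots> = (\<Sum>\<nu>\<in>L. \<Sum>l=0..<d * n. M $$ (k, l) * (?P \<nu> *\<^sub>v v) $ l)"
        unfolding sum_distrib_left by (rule sum.swap)
      also have "\<dots> = (\<Sum>\<nu>\<in>L. f \<nu> * (?P \<nu> *\<^sub>v v) $ k)"
      proof (rule sum.cong[OF refl])
        fix \<nu> assume \<nu>: "\<nu> \<in> L"
        have Pv: "?P \<nu> *\<^sub>v v \<in> carrier_vec (d * n)" using P(1)[OF \<nu>] v by (rule mult_mat_vec_carrier)
        have "(\<Sum>l=0..<d * n. M $$ (k, l) * (?P \<nu> *\<^sub>v v) $ l) = (M *\<^sub>v (?P \<nu> *\<^sub>v v)) $ k"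
          by (rule mult_mat_vec_index[OF M Pv k, symmetric])
        also have "\<dots> = f \<nu> * (?P \<nu> *\<^sub>v v) $ k"
          unfolding eig[OF \<nu> P(2)[OF \<nu> v]] by (rule index_smult_vec(1)) (use k carrier_vecD[OF Pv] in simp)
        finally show "(\<Sum>l=0..<d * n. M $$ (k, l) * (?P \<nu> *\<^sub>v v) $ l) = f \<nu> * (?P \<nu> *\<^sub>v v) $ k" .
      qed
      finally show ?thesis .
    qed
    have "(M *\<^sub>v v) \<bullet>c u = (\<Sum>k=0..<d * n. (M *\<^sub>v v) $ k * cnj (u $ k))"
      using u unfolding scalar_prod_def by (auto intro!: sum.cong)
    also have "\<dots> = (\<Sum>k=0..<d * n. \<Sum>\<nu>\<in>L. f \<nu> * (?P \<nu> *\<^sub>v v) $ k * cnj (u $ k))"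
      by (rule sum.cong[OF refl]) (simp add: entry sum_distrib_right)
    also have "\<dots> = (\<Sum>\<nu>\<in>L. \<Sum>k=0..<d * n. f \<nu> * (?P \<nu> *\<^sub>v v) $ k * cnj (u $ k))"
      by (rule sum.swap)
    also have "\<dots> = (\<Sum>\<nu>\<in>L. f \<nu> * ((?P \<nu> *\<^sub>v v) \<bullet>c u))"
      using u unfolding scalar_prod_def
      by (auto intro!: sum.cong simp: sum_distrib_left mult.assoc)
    finally show ?thesis .
  qed
  have sym: "?K \<nu> \<in> carrier_mat d d \<and> (\<forall>a<d. \<forall>b<d. ?K \<nu> $$ (a, b)
     = (?P \<nu> *\<^sub>v ?t b \<eta>) \<bullet>c ?t a \<xi>
     + (?P \<nu> *\<^sub>v ?t b \<xi>) \<bullet>c ?t a \<eta>)" if \<nu>: "\<nu> \<in> L" for \<nu>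
  proof (cases "d = 0")
    case False
    note pr = clifford_pairing[OF dec \<nu>]
    have C: "?p \<nu> \<zeta> \<in> carrier_mat (d * n) d" if "\<zeta> \<in> carrier_vec n" for \<zeta>
      using pr(1)[of "?c \<zeta>" "?c \<zeta>" 0 0] that False by simp
    have A: "mat_adjoint (?p \<nu> \<zeta>) * ?p \<nu> \<zeta>' \<in> carrier_mat d d"
      if "\<zeta> \<in> carrier_vec n" "\<zeta>' \<in> carrier_vec n" for \<zeta> \<zeta>'
      using C[OF that(1)] C[OF that(2)] by (auto simp: mat_adjoint_def)
    have cv: "?c \<xi> \<in> carrier_vec n" "?c \<eta> \<in> carrier_vec n" using \<xi> \<eta> by auto
    show ?thesis
      unfolding clifford_sym_def Let_def
    proof (intro conjI allI impI)
      fix a b assume ab: "a < d" "b < d"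
      have add: "(X + Y) $$ (a, b) = X $$ (a, b) + Y $$ (a, b)" if "Y \<in> carrier_mat d d" for X Y :: "complex mat"
        using that ab by auto
      show "(mat_adjoint (?p \<nu> \<xi>) * ?p \<nu> \<eta>
          + mat_adjoint (?p \<nu> \<eta>) * ?p \<nu> \<xi>) $$ (a, b)
        = (?P \<nu> *\<^sub>v ?t b \<eta>) \<bullet>c ?t a \<xi>
          + (?P \<nu> *\<^sub>v ?t b \<xi>) \<bullet>c ?t a \<eta>"
        unfolding add[OF A[OF \<eta> \<xi>]] pr(2)[OF cv ab] pr(2)[OF cv(2,1) ab] ..
    qed (use A[OF \<xi> \<eta>] A[OF \<eta> \<xi>] in simp)
  qed (auto simp: clifford_sym_def Let_def mat_adjoint_def clifford_hom_def)
  show ?thesis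
  proof (rule eq_matI)
    fix a b assume "a < dim_row ((c * complex_of_real (\<xi> \<bullet> \<eta>)) \<cdot>\<^sub>m 1\<^sub>m d)" "b < dim_col ((c * complex_of_real (\<xi> \<bullet> \<eta>)) \<cdot>\<^sub>m 1\<^sub>m d)"
    then have ab: "a < d" "b < d" by auto
    let ?x = "\<lambda>i. complex_of_real (\<xi> $ i)" and ?y = "\<lambda>i. complex_of_real (\<eta> $ i)"
    have tc: "?t e \<zeta> \<in> carrier_vec (d * n)" if "\<zeta> \<in> carrier_vec n" for e \<zeta>
      using that by (simp add: tensor_vec_def)
    have form: "(M *\<^sub>v ?t b \<zeta>') \<bullet>c ?t a \<zeta>
       = (\<Sum>i=0..<n. \<Sum>j=0..<n. mat_block d n M i j $$ (a, b) * complex_of_real (\<zeta>' $ j) * complex_of_real (\<zeta> $ i))"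
      if "\<zeta> \<in> carrier_vec n" "\<zeta>' \<in> carrier_vec n" for \<zeta> \<zeta>'
      using tensor_vec_block_form[OF M _ _ ab, of "?c \<zeta>" "?c \<zeta>'"] that by simp
    have "msum d d (\<lambda>\<nu>. f \<nu> \<cdot>\<^sub>m ?K \<nu>) L $$ (a, b)
       = (\<Sum>\<nu>\<in>L. f \<nu> * ?K \<nu> $$ (a, b))"
    proof -
      have "(f \<nu> \<cdot>\<^sub>m ?K \<nu>) $$ (a, b) = f \<nu> * ?K \<nu> $$ (a, b)"
        if "\<nu> \<in> L" for \<nu>
        by (rule index_smult_mat(1)) (use carrier_matD[OF conjunct1[OF sym[OF that]]] ab in simp_all)
      moreover have "f \<nu> \<cdot>\<^sub>m ?K \<nu> \<in> carrier_mat d d" if "\<nu> \<in> L" for \<nu>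
        by (rule smult_carrier_mat[OF conjunct1[OF sym[OF that]]])
      ultimately show ?thesis using index_msum[OF fin _ ab] by simp
    qed
    also have "\<dots> = (\<Sum>\<nu>\<in>L. f \<nu> * ((?P \<nu> *\<^sub>v ?t b \<eta>) \<bullet>c ?t a \<xi>))
       + (\<Sum>\<nu>\<in>L. f \<nu> * ((?P \<nu> *\<^sub>v ?t b \<xi>) \<bullet>c ?t a \<eta>))"
      unfolding sum.distrib[symmetric] by (rule sum.cong[OF refl]) (use sym ab in \<open>simp add: distrib_left\<close>)
    also have "\<dots> = (M *\<^sub>v ?t b \<eta>) \<bullet>c ?t a \<xi>
       + (M *\<^sub>v ?t b \<xi>) \<bullet>c ?t a \<eta>"
      unfolding spectral[OF tc[OF \<eta>] tc[OF \<xi>]] spectral[OF tc[OF \<xi>] tc[OF \<eta>]] ..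
    also have "\<dots> = (\<Sum>i=0..<n. \<Sum>j=0..<n. mat_block d n M i j $$ (a, b) * ?y j * ?x i)
       + (\<Sum>i=0..<n. \<Sum>j=0..<n. mat_block d n M i j $$ (a, b) * ?x j * ?y i)"
      unfolding form[OF \<xi> \<eta>] form[OF \<eta> \<xi>] ..
    also have "(\<Sum>i=0..<n. \<Sum>j=0..<n. mat_block d n M i j $$ (a, b) * ?x j * ?y i)
      = (\<Sum>i=0..<n. \<Sum>j=0..<n. mat_block d n M j i $$ (a, b) * ?x i * ?y j)" by (rule sum.swap)
    also have "(\<Sum>i=0..<n. \<Sum>j=0..<n. mat_block d n M i j $$ (a, b) * ?y j * ?x i) + \<dots>
      = (\<Sum>i=0..<n. \<Sum>j=0..<n. (mat_block d n M i j + mat_block d n M j i) $$ (a, b) * (?x i * ?y j))"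
      unfolding sum.distrib[symmetric]
      by (intro sum.cong refl) (use ab in \<open>simp add: mat_block_def algebra_simps\<close>)
    also have "\<dots> = (\<Sum>i=0..<n. \<Sum>j=0..<n. if i = j then (if a = b then c else 0) * (?x i * ?y j) else 0)"
      by (intro sum.cong refl) (use ab blocks in auto)
    also have "\<dots> = (if a = b then c else 0) * (\<Sum>i=0..<n. ?x i * ?y i)"
      by (simp add: sum_distrib_left)
    also have "(\<Sum>i=0..<n. ?x i * ?y i) = complex_of_real (\<xi> \<bullet> \<eta>)"
      using \<eta> by (simp add: scalar_prod_def)
    finally show "msum d d (\<lambda>\<nu>. f \<nu> \<cdot>\<^sub>m ?K \<nu>) L $$ (a, b) = ((c * complex_of_real (\<xi> \<bullet> \<eta>)) \<cdot>\<^sub>m 1\<^sub>m d) $$ (a, b)"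
      using ab by simp
  qed (use msum_carrier[OF fin, of "\<lambda>\<nu>. f \<nu> \<cdot>\<^sub>m ?K \<nu>" d d] sym in auto)
qed

section \<open>Spectral calculus on the decomposition\<close>

lemma acts_cong:
  "\<lbrakk>acts N X A; \<And>v. v \<in> carrier_vec N \<Longrightarrow> app X (vfun v) = app Y (vfun v)\<rbrakk> \<Longrightarrow> acts N Y A"
  by (simp add: acts_def)

lemma block_acts_app_cong:
  assumes "block_acts d n X M"
    and "\<And>i j v. \<lbrakk>i < n; j < n; v \<in> carrier_vec d\<rbrakk> \<Longrightarrow> app (X i j) (vfun v) = app (Y i j) (vfun v)"
  shows "block_acts d n Y M"
  using assms(1) acts_cong[OF _ assms(2)] by (simp add: block_acts_def)

locale clifford_setting =
  fixes n d :: nat and \<pi> :: "real mat \<Rightarrow> complex mat" and \<rho> :: "real vec"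
    and L :: "real vec set" and W :: "real vec \<Rightarrow> complex vec set"
  assumes rep: "so_rep n d \<pi>" and irr: "so_irreducible n d \<pi> (carrier_vec d)"
    and hw: "so_highest_weight n d \<pi> (carrier_vec d) \<rho>"
    and dec: "irreducible_decomposition n (d * n) (tensor_rep n d \<pi>) L W"
begin

sublocale so_family n "gen n \<pi>" by (rule so_family_gen[OF rep])

abbreviation "T \<equiv> tensor_rep n d \<pi>"

lemma repT: "so_rep n (d * n) T"
  by (rule so_rep_tensor[OF rep])

lemma summand: "\<nu> \<in> L \<Longrightarrow> so_irreducible n (d * n) T (W \<nu>)" "\<nu> \<in> L \<Longrightarrow> so_highest_weight n (d * n) T (W \<nu>) \<nu>"
  using dec by (auto simp: irreducible_decomposition_def)

lemma summand_carrier: "\<lbrakk>\<nu> \<in> L; w \<in> W \<nu>\<rbrakk> \<Longrightarrow> w \<in> carrier_vec (d * n)"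
  using irreducible_nonzero(1)[OF summand(1)] subspace_carrier by blast

text \<open>\<open>X\<close> consists of the blocks of an operator that acts on \<open>W \<nu>\<close> as the scalar \<open>f \<nu>\<close>.  The pairs
  \<open>(X, f)\<close> are closed under sums and products, so that the symbols of all operators in the theorem can
  be built from those of the generator matrix and of the Pfaffian.\<close>

definition symbol :: "(nat \<Rightarrow> nat \<Rightarrow> lin_op) \<Rightarrow> (real vec \<Rightarrow> complex) \<Rightarrow> bool" where
  "symbol X f \<longleftrightarrow> (\<exists>M. block_acts d n X M \<and> (\<forall>\<nu> \<in> L. \<forall>w \<in> W \<nu>. M *\<^sub>v w = f \<nu> \<cdot>\<^sub>v w))"

lemma symbol_one: "symbol (\<lambda>i j. if i = j then 1 else 0) (\<lambda>\<nu>. 1)"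
  unfolding symbol_def
  by (rule exI[of _ "1\<^sub>m (d * n)"]) (auto intro: block_acts_one dest: summand_carrier)

lemma symbol_cscale: "symbol X f \<Longrightarrow> symbol (\<lambda>i j. cscale c * X i j) (\<lambda>\<nu>. c * f \<nu>)"
  unfolding symbol_def
proof (elim exE conjE)
  fix M assume M: "block_acts d n X M" "\<forall>\<nu> \<in> L. \<forall>w \<in> W \<nu>. M *\<^sub>v w = f \<nu> \<cdot>\<^sub>v w"
  then have "M \<in> carrier_mat (d * n) (d * n)" by (simp add: block_acts_def)
  then have "(c \<cdot>\<^sub>m M) *\<^sub>v w = (c * f \<nu>) \<cdot>\<^sub>v w" if "\<nu> \<in> L" "w \<in> W \<nu>" for \<nu> w
    using M(2) that by (simp add: smult_mat_vec[OF _ summand_carrier[OF that]] smult_smult_assoc)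
  then show "\<exists>M. block_acts d n (\<lambda>i j. cscale c * X i j) M \<and> (\<forall>\<nu> \<in> L. \<forall>w \<in> W \<nu>. M *\<^sub>v w = (c * f \<nu>) \<cdot>\<^sub>v w)"
    using block_acts_cscale[OF M(1)] by blast
qed

lemma symbol_add: "\<lbrakk>symbol X f; symbol Y g\<rbrakk> \<Longrightarrow> symbol (\<lambda>i j. X i j + Y i j) (\<lambda>\<nu>. f \<nu> + g \<nu>)"
  unfolding symbol_def
proof (elim exE conjE)
  fix M M' assume M: "block_acts d n X M" "\<forall>\<nu> \<in> L. \<forall>w \<in> W \<nu>. M *\<^sub>v w = f \<nu> \<cdot>\<^sub>v w"
    and M': "block_acts d n Y M'" "\<forall>\<nu> \<in> L. \<forall>w \<in> W \<nu>. M' *\<^sub>v w = g \<nu> \<cdot>\<^sub>v w"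
  have C: "M \<in> carrier_mat (d * n) (d * n)" "M' \<in> carrier_mat (d * n) (d * n)" using M M' by (auto simp: block_acts_def)
  have "(M + M') *\<^sub>v w = (f \<nu> + g \<nu>) \<cdot>\<^sub>v w" if "\<nu> \<in> L" "w \<in> W \<nu>" for \<nu> w
    using M(2) M'(2) that by (simp add: add_mult_distrib_mat_vec[OF C summand_carrier[OF that]] add_smult_distrib_vec)
  then show "\<exists>M. block_acts d n (\<lambda>i j. X i j + Y i j) M \<and> (\<forall>\<nu> \<in> L. \<forall>w \<in> W \<nu>. M *\<^sub>v w = (f \<nu> + g \<nu>) \<cdot>\<^sub>v w)"
    using block_acts_add[OF M(1) M'(1)] by blast
qed

lemma symbol_mult: "\<lbrakk>symbol X f; symbol Y g\<rbrakk> \<Longrightarrow> symbol (\<lambda>i j. \<Sum>k=0..<n. X i k * Y k j) (\<lambda>\<nu>. f \<nu> * g \<nu>)"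
  unfolding symbol_def
proof (elim exE conjE)
  fix M M' assume M: "block_acts d n X M" "\<forall>\<nu> \<in> L. \<forall>w \<in> W \<nu>. M *\<^sub>v w = f \<nu> \<cdot>\<^sub>v w"
    and M': "block_acts d n Y M'" "\<forall>\<nu> \<in> L. \<forall>w \<in> W \<nu>. M' *\<^sub>v w = g \<nu> \<cdot>\<^sub>v w"
  have C: "M \<in> carrier_mat (d * n) (d * n)" "M' \<in> carrier_mat (d * n) (d * n)" using M M' by (auto simp: block_acts_def)
  have "(M * M') *\<^sub>v w = (f \<nu> * g \<nu>) \<cdot>\<^sub>v w" if "\<nu> \<in> L" "w \<in> W \<nu>" for \<nu> w
  proof -
    note wc = summand_carrier[OF that]
    have "(M * M') *\<^sub>v w = M *\<^sub>v (g \<nu> \<cdot>\<^sub>v w)" using M'(2) that by (simp add: assoc_mult_mat_vec[OF C wc])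
    also have "\<dots> = g \<nu> \<cdot>\<^sub>v (M *\<^sub>v w)" by (rule mult_mat_vec[OF C(1) wc])
    finally show ?thesis using M(2) that by (simp add: smult_smult_assoc mult.commute)
  qed
  then show "\<exists>M. block_acts d n (\<lambda>i j. \<Sum>k=0..<n. X i k * Y k j) M \<and> (\<forall>\<nu> \<in> L. \<forall>w \<in> W \<nu>. M *\<^sub>v w = (f \<nu> * g \<nu>) \<cdot>\<^sub>v w)"
    using block_acts_mult[OF M(1) M'(1)] by blast
qed

lemma symbol_cong:
  "\<lbrakk>symbol X f; \<And>i j. \<lbrakk>i < n; j < n\<rbrakk> \<Longrightarrow> X i j = Y i j; \<And>\<nu>. \<nu> \<in> L \<Longrightarrow> f \<nu> = g \<nu>\<rbrakk> \<Longrightarrow> symbol Y g"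
  unfolding symbol_def using block_acts_cong[of d n X _ Y] by fastforce

lemma symbol_sum: "(\<And>p. p < k \<Longrightarrow> symbol (X p) (f p)) \<Longrightarrow> symbol (\<lambda>i j. \<Sum>p<k. X p i j) (\<lambda>\<nu>. \<Sum>p<k. f p \<nu>)"
  for k :: nat
proof (induction k)
  case 0
  show ?case by (rule symbol_cong[OF symbol_cscale[OF symbol_one, of 0]]) (auto simp: cscale_hom)
next
  case (Suc k)
  then show ?case using symbol_add by simp
qed

theorem symbol_clifford_sym:
  assumes X: "symbol X f"
    and sym: "\<And>i j v. \<lbrakk>i < n; j < n; v \<in> carrier_vec d\<rbrakk> \<Longrightarrow>
      app (X i j + X j i) (vfun v) = (\<lambda>k. (if i = j then c else 0) * vfun v k)"
    and \<xi>: "\<xi> \<in> carrier_vec n" and \<eta>: "\<eta> \<in> carrier_vec n"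
  shows "msum d d (\<lambda>\<nu>. f \<nu> \<cdot>\<^sub>m clifford_sym n d (W \<nu>) \<xi> \<eta>) L = (c * complex_of_real (\<xi> \<bullet> \<eta>)) \<cdot>\<^sub>m 1\<^sub>m d"
proof -
  obtain M where M: "block_acts d n X M" "\<And>\<nu> w. \<lbrakk>\<nu> \<in> L; w \<in> W \<nu>\<rbrakk> \<Longrightarrow> M *\<^sub>v w = f \<nu> \<cdot>\<^sub>v w"
    using X unfolding symbol_def by blast
  show ?thesis
  proof (rule clifford_sym_sum[OF dec _ M(2) _ \<xi> \<eta>])
    fix i j assume ij: "i < n" "j < n"
    have "acts d (X i j + X j i) (mat_block d n M i j + mat_block d n M j i)"
      using M(1) ij by (intro acts_add) (auto simp: block_acts_def)
    moreover have "acts d (X i j + X j i) ((if i = j then c else 0) \<cdot>\<^sub>m 1\<^sub>m d)"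
      by (rule acts_cong[OF acts_cscale]) (simp only: sym[OF ij] app_simps(7))
    ultimately show "mat_block d n M i j + mat_block d n M j i = (if i = j then c else 0) \<cdot>\<^sub>m 1\<^sub>m d" by (rule acts_unique)
  qed (use M in \<open>auto simp: block_acts_def\<close>)
qed

text \<open>An operator that commutes with the representation may be replaced by its scalar.\<close>

lemma scalar_on_full:
  assumes X: "acts d X A" and comm: "\<And>a b. \<lbrakk>a < n; b < n\<rbrakk> \<Longrightarrow> gen n \<pi> a b * X = X * gen n \<pi> a b"
    and v: "v \<in> carrier_vec d"
  shows "app X (vfun v) = (\<lambda>k. scalar_on (carrier_vec d) A * vfun v k)"
proof -
  have P: "preserves (carrier_vec d) X"
    unfolding preserves_def using acts_app[OF X] acts_carrier[OF X] by (auto intro!: imageI mult_mat_vec_carrier)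
  obtain c where c: "\<And>w. w \<in> carrier_vec d \<Longrightarrow> A *\<^sub>v w = c \<cdot>\<^sub>v w"
    using so_irreducible_schur[OF rep irr X P comm] by blast
  obtain w :: "complex vec" where "w \<in> carrier_vec d" "w \<noteq> 0\<^sub>v d" using irreducible_nonzero(2)[OF irr] by auto
  then have "scalar_on (carrier_vec d) A = c" using c by (intro scalar_on_eq[of w]) auto
  then show ?thesis using acts_app[OF X v] c[OF v] by (simp add: vfun_smult)
qed

lemma acts_casimir:
  assumes "so_rep n N \<tau>"
  shows "acts N (so_family.casimir n (gen n \<tau>))
    (msum N N (\<lambda>a. msum N N (\<lambda>b. \<tau> (so_basis n a b) * \<tau> (so_basis n a b)) {0..<n}) {0..<n})"
  unfolding so_family.casimir_def[OF so_family_gen[OF assms]]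
  by (intro acts_msum acts_mult acts_gen[OF assms]) auto

lemma conf_weight_casimir:
  assumes "\<mu> \<in> carrier_vec (n div 2)" "\<mu>' \<in> carrier_vec (n div 2)"
  shows "conf_weight n \<mu> \<mu>' = (casimir_value n \<mu>' - casimir_value n \<mu> - real n + 1) / 2"
proof -
  have "(so_delta n + x) \<bullet> (so_delta n + x) = so_delta n \<bullet> so_delta n + casimir_value n x"
    if x: "x \<in> carrier_vec (n div 2)" for x
  proof -
    have e: "(so_delta n + x) $ j * (so_delta n + x) $ j = so_delta n $ j * so_delta n $ j
        + (x $ j * x $ j + (real n - 2 * real j - 2) * x $ j)" if j: "j < n div 2" for j
    proof -
      have "2 * so_delta n $ j = real n - 2 * real j - 2"
      proof (cases "even n")
        case True
        then have "real n = 2 * real (n div 2)" by (metis dvd_mult_div_cancel of_nat_mult of_nat_numeral)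
        then show ?thesis using j True by (simp add: so_delta_def)
      next
        case False
        then have "n = 2 * (n div 2) + 1" by presburger
        then have "real n = 2 * real (n div 2) + 1" by (metis of_nat_mult of_nat_numeral of_nat_add of_nat_1)
        then show ?thesis using j False by (simp add: so_delta_def)
      qed
      moreover have "(so_delta n + x) $ j = so_delta n $ j + x $ j" using j x by simp
      moreover have "(s + y) * (s + y) = s * s + (y * y + 2 * s * y)" for s y :: real by (simp add: algebra_simps)
      ultimately show ?thesis by (simp only:)
    qed
    have D: "so_delta n \<in> carrier_vec (n div 2)" by (simp add: so_delta_def)
    have "(so_delta n + x) \<bullet> (so_delta n + x) = (\<Sum>j=0..<n div 2. (so_delta n + x) $ j * (so_delta n + x) $ j)"
      using x unfolding scalar_prod_def by simp
    also have "\<dots> = (\<Sum>j=0..<n div 2. so_delta n $ j * so_delta n $ j) + casimir_value n x"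
      unfolding casimir_value_def sum.distrib[symmetric] by (rule sum.cong[OF refl]) (use e in auto)
    also have "(\<Sum>j=0..<n div 2. so_delta n $ j * so_delta n $ j) = so_delta n \<bullet> so_delta n"
      using D unfolding scalar_prod_def by simp
    finally show ?thesis .
  qed
  then show ?thesis using assms by (simp add: conf_weight_def)
qed

text \<open>Solving the formula for the blocks of the Casimir element on \<open>V \<otimes> \<complex>\<^sup>n\<close> for the mixed term expresses the
  generator matrix by operators which are known to act by scalars on the summands.\<close>

theorem symbol_gen: "symbol (gen n \<pi>) (\<lambda>\<nu>. of_real (conf_weight n \<rho> \<nu>))"
proof -
  let ?S = "\<lambda>i j. \<Sum>a=0..<n. \<Sum>b=0..<n. \<Sum>l=0..<n. tensor_block a b i l * tensor_block a b l j"
  let ?C = "msum (d * n) (d * n) (\<lambda>a. msum (d * n) (d * n) (\<lambda>b. T (so_basis n a b) * T (so_basis n a b)) {0..<n}) {0..<n}"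
  have inv: "so_invariant n d \<pi> (carrier_vec d)" using irr by (simp add: so_irreducible_def)
  have cas: "app casimir (vfun v) = (\<lambda>k. of_real (- 2 * casimir_value n \<rho>) * vfun v k)" if v: "v \<in> carrier_vec d" for v
    using casimir_scalar[OF rep inv hw irr acts_casimir[OF rep] v] acts_app[OF acts_casimir[OF rep] v]
    by (simp only: vfun_smult)
  have blocks: "block_acts d n ?S ?C"
    by (intro block_acts_msum block_acts_mult block_acts_tensor_gen[OF rep]) auto
  have "symbol ?S
      (\<lambda>\<nu>. of_real (- 2 * casimir_value n \<nu>))"
    unfolding symbol_def
  proof (rule exI, intro conjI ballI)
    show "block_acts d n ?S ?C" by (rule blocks)
    fix \<nu> w assume \<nu>: "\<nu> \<in> L" and w: "w \<in> W \<nu>"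
    have "so_invariant n (d * n) T (W \<nu>)" using summand(1)[OF \<nu>] by (simp add: so_irreducible_def)
    from casimir_scalar[OF repT this summand(2)[OF \<nu>] summand(1)[OF \<nu>] acts_casimir[OF repT] w]
    show "?C *\<^sub>v w = of_real (- 2 * casimir_value n \<nu>) \<cdot>\<^sub>v w" .
  qed
  from symbol_cscale[OF symbol_add[OF this symbol_cscale[OF symbol_one, of "of_real (2 * casimir_value n \<rho> + 2 * (real n - 1))"]], of "- 1 / 4"]
  obtain M where M: "block_acts d n (\<lambda>i j. cscale (- 1 / 4) * (?S i j
        + cscale (of_real (2 * casimir_value n \<rho> + 2 * (real n - 1))) * (if i = j then 1 else 0))) M"
    "\<And>\<nu> w. \<lbrakk>\<nu> \<in> L; w \<in> W \<nu>\<rbrakk> \<Longrightarrow> M *\<^sub>v w = (- 1 / 4 * (of_real (- 2 * casimir_value n \<nu>)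
        + of_real (2 * casimir_value n \<rho> + 2 * (real n - 1)) * 1)) \<cdot>\<^sub>v w"
    unfolding symbol_def by blast
  have "block_acts d n (gen n \<pi>) M"
  proof (rule block_acts_app_cong[OF M(1)])
    fix i j and v :: "complex vec" assume ij: "i < n" "j < n" and v: "v \<in> carrier_vec d"
    have four: "app 4 f = (\<lambda>k. 4 * f k)" for f
    proof -
      have "(4 :: lin_op) = 1 + 1 + (1 + 1)" by (simp only: numeral_Bit0 numeral_One)
      then show ?thesis by (simp only: app_simps) simp
    qed
    have or: "app (of_real r) f = (\<lambda>k. of_real r * f k)" for r f
      unfolding cscale_hom(6)[symmetric] by simp
    define r where "r = 2 * (real n - 1)"
    let ?f = "vfun v"
    have "app (cscale (- 1 / 4) * (((if i = j then casimir - of_real r else 0) - 4 * gen n \<pi> i j)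
        + cscale (of_real (2 * casimir_value n \<rho> + r)) * (if i = j then 1 else 0))) ?f = app (gen n \<pi> i j) ?f"
    proof (cases "i = j")
      case True
      show ?thesis unfolding if_P[OF True]
        by (simp only: app_simps cas[OF v] four or) (simp add: fun_eq_iff algebra_simps)
    next
      case False
      show ?thesis unfolding if_not_P[OF False] by (simp only: app_simps four) (simp add: fun_eq_iff)
    qed
    then show "app (cscale (- 1 / 4) * (?S i j
        + cscale (of_real (2 * casimir_value n \<rho> + 2 * (real n - 1))) * (if i = j then 1 else 0))) ?f = app (gen n \<pi> i j) ?f"
      unfolding tensor_casimir[OF ij] r_def .
  qed
  moreover have "- 1 / 4 * (of_real (- 2 * casimir_value n \<nu>) + of_real (2 * casimir_value n \<rho> + 2 * (real n - 1)) * 1)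
     = complex_of_real (conf_weight n \<rho> \<nu>)" if \<nu>: "\<nu> \<in> L" for \<nu>
  proof -
    have "\<rho> \<in> carrier_vec (n div 2)" "\<nu> \<in> carrier_vec (n div 2)"
      using hw summand(2)[OF \<nu>] by (auto simp: so_highest_weight_def so_weights_def)
    note cw = conf_weight_casimir[OF this]
    show ?thesis unfolding cw by (simp add: field_simps)
  qed
  ultimately show ?thesis unfolding symbol_def using M(2) by (intro exI[of _ M]) simp
qed

lemma symbol_ehat: "symbol ehat (\<lambda>\<nu>. of_real (conf_weight_hat n \<rho> \<nu>))"
proof (rule symbol_cong[OF symbol_add[OF symbol_gen symbol_cscale[OF symbol_one, of "of_real ((real n - 1) / 2)"]]])
  show "gen n \<pi> i j + cscale (of_real ((real n - 1) / 2)) * (if i = j then 1 else 0) = ehat i j" for i j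
    unfolding ehat_def cscale_hom(6) by simp
qed (simp add: conf_weight_hat_def)

lemma symbol_ehat_pow: "symbol (ehat_pow p) (\<lambda>\<nu>. of_real (conf_weight_hat n \<rho> \<nu> ^ p))"
proof (induction p)
  case 0
  show ?case by (rule symbol_cong[OF symbol_one]) auto
next
  case (Suc p)
  show ?case by (rule symbol_cong[OF symbol_mult[OF symbol_ehat Suc]]) auto
qed

theorem clifford_identity_one:
  assumes "\<xi> \<in> carrier_vec n" "\<eta> \<in> carrier_vec n"
  shows "msum d d (\<lambda>\<nu>. 1 \<cdot>\<^sub>m clifford_sym n d (W \<nu>) \<xi> \<eta>) L = (2 * complex_of_real (\<xi> \<bullet> \<eta>)) \<cdot>\<^sub>m 1\<^sub>m d"
  by (rule symbol_clifford_sym[OF symbol_one _ assms]) auto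

text \<open>Once the traces are replaced by their scalars, the blocks are the alternating sums that were shown
  to be antisymmetric.\<close>

theorem clifford_identity_odd:
  assumes \<xi>: "\<xi> \<in> carrier_vec n" and \<eta>: "\<eta> \<in> carrier_vec n"
  shows "msum d d (\<lambda>\<nu>. (\<Sum>p<2 * q. complex_of_real ((- conf_weight_hat n \<rho> \<nu>) ^ p)
            * scalar_on (carrier_vec d) (c_hat n d \<pi> (2 * q - 1 - p))) \<cdot>\<^sub>m clifford_sym n d (W \<nu>) \<xi> \<eta>) L = 0\<^sub>m d d"
proof -
  let ?s = "\<lambda>p. scalar_on (carrier_vec d) (c_hat n d \<pi> (2 * q - 1 - p))"
  let ?X = "\<lambda>i j. \<Sum>p<2 * q. cscale (?s p * (- 1) ^ p) * ehat_pow p i j"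
  have S: "symbol ?X (\<lambda>\<nu>. \<Sum>p<2 * q. complex_of_real ((- conf_weight_hat n \<rho> \<nu>) ^ p) * ?s p)"
  proof (rule symbol_cong[OF symbol_sum[OF symbol_cscale[OF symbol_ehat_pow]]])
    fix \<nu>
    show "(\<Sum>p<2 * q. ?s p * (- 1) ^ p * complex_of_real (conf_weight_hat n \<rho> \<nu> ^ p))
      = (\<Sum>p<2 * q. complex_of_real ((- conf_weight_hat n \<rho> \<nu>) ^ p) * ?s p)"
      unfolding power_minus[of "conf_weight_hat n \<rho> \<nu>"]
      by (intro sum.cong refl) (simp add: mult_ac del: power_minus_even power_minus_odd)
  qed auto
  have X: "app (?X i j) (vfun v) = app (\<Sum>p<2 * q. (- 1) ^ p * (ehat_trace (2 * q - 1 - p) * ehat_pow p i j)) (vfun v)"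
    if v: "v \<in> carrier_vec d" for i j v
    unfolding app_sum
  proof (rule ext, rule sum.cong[OF refl])
    fix k p
    let ?u = "e_hat_pow n d \<pi> p i j *\<^sub>v v"
    have u: "app (ehat_pow p i j) (vfun v) = vfun ?u" "?u \<in> carrier_vec d"
      using acts_app[OF acts_e_hat_pow[OF rep] v] mult_mat_vec_carrier[OF acts_carrier[OF acts_e_hat_pow[OF rep]] v]
      by blast+
    have c: "app (ehat_trace (2 * q - 1 - p)) (vfun ?u) = (\<lambda>k. ?s p * vfun ?u k)"
      by (rule scalar_on_full[OF acts_c_hat[OF rep] ehat_trace_central u(2)])
    have m: "(- 1) ^ p = cscale ((- 1) ^ p)"
      using cscale_of_int[of "(- 1) ^ p"] by simp
    show "app (cscale (?s p * (- 1) ^ p) * ehat_pow p i j) (vfun v) k = app ((- 1) ^ p * (ehat_trace (2 * q - 1 - p) * ehat_pow p i j)) (vfun v) k"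
      unfolding m app_simps(6) u(1) c by (simp add: mult_ac)
  qed
  have "msum d d (\<lambda>\<nu>. (\<Sum>p<2 * q. complex_of_real ((- conf_weight_hat n \<rho> \<nu>) ^ p) * ?s p)
      \<cdot>\<^sub>m clifford_sym n d (W \<nu>) \<xi> \<eta>) L = (0 * complex_of_real (\<xi> \<bullet> \<eta>)) \<cdot>\<^sub>m 1\<^sub>m d"
  proof (rule symbol_clifford_sym[OF S _ \<xi> \<eta>])
    fix i j and v :: "complex vec" assume ij: "i < n" "j < n" and v: "v \<in> carrier_vec d"
    let ?Y = "\<lambda>i j. \<Sum>p<2 * q. (- 1) ^ p * (ehat_trace (2 * q - 1 - p) * ehat_pow p i j)"
    have "app (?X i j + ?X j i) (vfun v) = app (?Y i j + ?Y j i) (vfun v)"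
      using X[OF v, of i j] X[OF v, of j i] by (simp only: app_simps(3))
    also have "?Y i j + ?Y j i = 0" by (rule ehat_pow_alternating_antisym[OF ij])
    finally show "app (?X i j + ?X j i) (vfun v) = (\<lambda>k. (if i = j then 0 else 0) * vfun v k)" by simp
  qed
  then show ?thesis by (simp add: zero_mat_def smult_mat_def map_mat_def one_mat_def)
qed

context
  fixes m assumes nm: "n = 2 * Suc m"
begin

abbreviation "pf_const \<equiv> 1 / (\<i> ^ Suc m * 2 ^ Suc m * fact (Suc m)) :: complex"

lemma block_acts_pf_block: "block_acts d n (\<lambda>i j. cscale pf_const * pf_block (Suc m) i j) (pf n (d * n) T)"
proof -
  have m: "n div 2 = Suc m" "{0..<n} = {0..<2 * Suc m}" using nm by auto
  have prods: "block_acts d n (pair_block \<sigma> ks) (foldr (*) (map (\<lambda>k. T (so_basis n (\<sigma> (2 * k)) (\<sigma> (2 * k + 1)))) ks) (1\<^sub>m (d * n)))"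
    if \<sigma>: "\<sigma> permutes {0..<n}" and ks: "set ks \<subseteq> {0..<Suc m}" for \<sigma> ks
    using ks
  proof (induction ks)
    case Nil
    show ?case unfolding list.map foldr.simps id_apply by (rule block_acts_cong[OF block_acts_one]) simp
  next
    case (Cons k ks)
    then have "2 * k < n" "2 * k + 1 < n" using nm by auto
    then have "\<sigma> (2 * k) < n" "\<sigma> (2 * k + 1) < n" using permutes_in_image[OF \<sigma>] by fastforce+
    from block_acts_mult[OF block_acts_tensor_gen[OF rep this] Cons.IH] Cons.prems show ?case
      by (intro block_acts_cong[OF _ pair_block.simps(2)[symmetric]]) auto
  qed
  show ?thesis
    unfolding pf_def Let_def m pf_block_def alt_sum_def
  proof (intro block_acts_cscale block_acts_msum finite_permutations)
    fix \<sigma> assume "\<sigma> \<in> {\<sigma>. \<sigma> permutes {0..<2 * Suc m}}"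
    then have "\<sigma> permutes {0..<n}" using nm by simp
    from block_acts_cscale[OF prods[OF this, of "[0..<Suc m]"], of "of_int (sign \<sigma>)"]
    show "block_acts d n (\<lambda>i j. of_int (sign \<sigma>) * pair_block \<sigma> [0..<Suc m] i j)
      (of_int (sign \<sigma>) \<cdot>\<^sub>m foldr (*) (map (\<lambda>k. T (so_basis n (\<sigma> (2 * k)) (\<sigma> (2 * k + 1)))) [0..<Suc m]) (1\<^sub>m (d * n)))"
      by (simp only: cscale_of_int set_upt subset_refl)
  qed auto
qed

lemma symbol_pf_block:
  "symbol (\<lambda>i j. cscale pf_const * pf_block (Suc m) i j) (\<lambda>\<nu>. scalar_on (W \<nu>) (pf n (d * n) T))"
  unfolding symbol_def
proof (rule exI, intro conjI ballI)
  show "block_acts d n (\<lambda>i j. cscale pf_const * pf_block (Suc m) i j) (pf n (d * n) T)" by (rule block_acts_pf_block)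
  fix \<nu> w assume \<nu>: "\<nu> \<in> L" and w: "w \<in> W \<nu>"
  interpret G: so_family n "gen n T" by (rule so_family_gen[OF repT])
  note irrT = summand(1)[OF \<nu>]
  have inv: "so_invariant n (d * n) T (W \<nu>)" using irrT by (simp add: so_irreducible_def)
  note sub = irreducible_nonzero(1)[OF irrT]
  have P: "preserves (W \<nu>) (cscale pf_const * G.pfaff (Suc m))"
    unfolding G.pfaff_def alt_sum_def G.pair_prod_def
    by (intro preserves_mult[OF sub] preserves_cscale[OF sub] preserves_sum[OF sub] preserves_of_int[OF sub] preserves_prod_list[OF sub])
       (auto intro: preserves_gen[OF repT inv summand(2)[OF \<nu>]])
  have comm: "gen n T a b * (cscale pf_const * G.pfaff (Suc m)) = cscale pf_const * G.pfaff (Suc m) * gen n T a b"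
    if "a < n" "b < n" for a b
    using G.pfaff_central[OF nm that] by (simp only: cscale_left_commute mult.assoc)
  obtain c where c: "\<And>w. w \<in> W \<nu> \<Longrightarrow> pf n (d * n) T *\<^sub>v w = c \<cdot>\<^sub>v w"
    using so_irreducible_schur[OF repT irrT acts_pf[OF repT nm] P comm] by blast
  obtain u where "u \<in> W \<nu>" "u \<in> carrier_vec (d * n)" "u \<noteq> 0\<^sub>v (d * n)" using irreducible_nonzero(2)[OF irrT] by blast
  then have "scalar_on (W \<nu>) (pf n (d * n) T) = c" by (rule scalar_on_eq) (rule c)
  then show "pf n (d * n) T *\<^sub>v w = scalar_on (W \<nu>) (pf n (d * n) T) \<cdot>\<^sub>v w" using c[OF w] by simp
qed

theorem clifford_identity_pf:
  assumes \<xi>: "\<xi> \<in> carrier_vec n" and \<eta>: "\<eta> \<in> carrier_vec n"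
  shows "msum d d (\<lambda>\<nu>. scalar_on (W \<nu>) (pf n (d * n) T) \<cdot>\<^sub>m clifford_sym n d (W \<nu>) \<xi> \<eta>) L
     = (2 * scalar_on (carrier_vec d) (pf n d \<pi>) * complex_of_real (\<xi> \<bullet> \<eta>)) \<cdot>\<^sub>m 1\<^sub>m d"
proof (rule symbol_clifford_sym[OF symbol_pf_block _ \<xi> \<eta>])
  fix i j and v :: "complex vec" assume ij: "i < n" "j < n" and v: "v \<in> carrier_vec d"
  have comm: "gen n \<pi> a b * (cscale pf_const * pfaff (Suc m)) = cscale pf_const * pfaff (Suc m) * gen n \<pi> a b"
    if "a < n" "b < n" for a b
    using pfaff_central[OF nm that] by (simp only: cscale_left_commute mult.assoc)
  have s: "app (cscale pf_const * pfaff (Suc m)) (vfun v) = (\<lambda>k. scalar_on (carrier_vec d) (pf n d \<pi>) * vfun v k)"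
    by (rule scalar_on_full[OF acts_pf[OF rep nm] comm v])
  have "cscale pf_const * pf_block (Suc m) i j + cscale pf_const * pf_block (Suc m) j i = cscale pf_const * (pf_block (Suc m) i j + pf_block (Suc m) j i)"
    by (rule distrib_left[symmetric])
  also have "\<dots> = (if i = j then cscale pf_const * pfaff (Suc m) + cscale pf_const * pfaff (Suc m) else 0)"
    unfolding pf_block_sym[OF nm ij] mult_2 by (cases "i = j") (simp_all add: distrib_left)
  finally have F: "cscale pf_const * pf_block (Suc m) i j + cscale pf_const * pf_block (Suc m) j i = \<dots>" .
  show "app (cscale pf_const * pf_block (Suc m) i j + cscale pf_const * pf_block (Suc m) j i) (vfun v)
      = (\<lambda>k. (if i = j then 2 * scalar_on (carrier_vec d) (pf n d \<pi>) else 0) * vfun v k)"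
  proof (cases "i = j")
    case True
    show ?thesis unfolding F if_P[OF True] app_simps(3) s by (simp add: mult_ac)
  next
    case False
    show ?thesis unfolding F if_not_P[OF False] by simp
  qed
qed

theorem clifford_identity_pf_weight:
  assumes \<xi>: "\<xi> \<in> carrier_vec n" and \<eta>: "\<eta> \<in> carrier_vec n"
  shows "msum d d (\<lambda>\<nu>. (scalar_on (W \<nu>) (pf n (d * n) T) * complex_of_real (conf_weight n \<rho> \<nu> - 1))
     \<cdot>\<^sub>m clifford_sym n d (W \<nu>) \<xi> \<eta>) L = 0\<^sub>m d d"
proof -
  let ?X = "\<lambda>i j. cscale pf_const * ((\<Sum>k=0..<n. pf_block (Suc m) i k * gen n \<pi> k j) - pf_block (Suc m) i j)"
  have "symbol ?X (\<lambda>\<nu>. scalar_on (W \<nu>) (pf n (d * n) T) * complex_of_real (conf_weight n \<rho> \<nu> - 1))"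
  proof (rule symbol_cong[OF symbol_add[OF symbol_mult[OF symbol_pf_block symbol_gen] symbol_cscale[OF symbol_pf_block, of "- 1"]]])
    show "(\<Sum>k=0..<n. cscale pf_const * pf_block (Suc m) i k * gen n \<pi> k j) + cscale (- 1) * (cscale pf_const * pf_block (Suc m) i j) = ?X i j" for i j
      by (simp add: cscale_hom right_diff_distrib sum_distrib_left mult.assoc)
  qed (simp add: algebra_simps)
  then have "msum d d (\<lambda>\<nu>. (scalar_on (W \<nu>) (pf n (d * n) T) * complex_of_real (conf_weight n \<rho> \<nu> - 1))
     \<cdot>\<^sub>m clifford_sym n d (W \<nu>) \<xi> \<eta>) L = (0 * complex_of_real (\<xi> \<bullet> \<eta>)) \<cdot>\<^sub>m 1\<^sub>m d"
  proof (rule symbol_clifford_sym[OF _ _ \<xi> \<eta>])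
    fix i j and v :: "complex vec" assume ij: "i < n" "j < n"
    have "?X i j + ?X j i = 0"
      unfolding distrib_left[symmetric] pf_block_mult_e_antisym[OF nm ij] by (rule mult_zero_right)
    then show "app (?X i j + ?X j i) (vfun v) = (\<lambda>k. (if i = j then 0 else 0) * vfun v k)"
      by (simp only: app_simps(1)) simp
  qed
  then show ?thesis by (simp add: zero_mat_def smult_mat_def map_mat_def one_mat_def)
qed

end

end

theorem theorem4p9:
  fixes n d :: nat
    and \<pi> :: "real mat \<Rightarrow> complex mat"
    and \<rho> :: "real vec"
    and L :: "real vec set"
    and W :: "real vec \<Rightarrow> complex vec set"
    and \<xi> \<eta> :: "real vec"
  assumes n: "2 \<le> n"
    and rep: "unitary_so_rep n d \<pi>"
    and irreducible: "so_irreducible n d \<pi> (carrier_vec d)"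
    and highest_weight: "so_highest_weight n d \<pi> (carrier_vec d) \<rho>"
    and spin: "spin_highest_weight n \<rho>"
    and decomposition: "irreducible_decomposition n (d * n) (tensor_rep n d \<pi>) L W"
    and \<xi>: "\<xi> \<in> carrier_vec n"
    and \<eta>: "\<eta> \<in> carrier_vec n"
  shows
    "msum d d (\<lambda>\<nu>. clifford_sym n d (W \<nu>) \<xi> \<eta>) L
       = complex_of_real (2 * (\<xi> \<bullet> \<eta>)) \<cdot>\<^sub>m 1\<^sub>m d
     \<and> (\<forall>q::nat. 1 \<le> q \<longrightarrow>
         msum d d
           (\<lambda>\<nu>. (\<Sum>p = 0..2 * q - 1.
                   complex_of_real ((- conf_weight_hat n \<rho> \<nu>) ^ p)
                     * scalar_on (carrier_vec d) (c_hat n d \<pi> (2 * q - 1 - p)))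
                 \<cdot>\<^sub>m clifford_sym n d (W \<nu>) \<xi> \<eta>) L
         = 0\<^sub>m d d)
     \<and> (even n \<longrightarrow>
         msum d d
           (\<lambda>\<nu>. scalar_on (W \<nu>) (pf n (d * n) (tensor_rep n d \<pi>))
                 \<cdot>\<^sub>m clifford_sym n d (W \<nu>) \<xi> \<eta>) L
         = (2 * scalar_on (carrier_vec d) (pf n d \<pi>) * complex_of_real (\<xi> \<bullet> \<eta>)) \<cdot>\<^sub>m 1\<^sub>m d)
     \<and> (even n \<longrightarrow>
         msum d d
           (\<lambda>\<nu>. (scalar_on (W \<nu>) (pf n (d * n) (tensor_rep n d \<pi>))
                   * complex_of_real (conf_weight n \<rho> \<nu> - 1))
                 \<cdot>\<^sub>m clifford_sym n d (W \<nu>) \<xi> \<eta>) L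
         = 0\<^sub>m d d)"
proof -
  interpret clifford_setting n d \<pi> \<rho> L W
    by (unfold_locales) (use unitary_so_rep_so_rep[OF rep] irreducible highest_weight decomposition in auto)
  have one: "1 \<cdot>\<^sub>m A = A" for A :: "complex mat" by (rule eq_matI) auto
  have 1: "msum d d (\<lambda>\<nu>. clifford_sym n d (W \<nu>) \<xi> \<eta>) L = complex_of_real (2 * (\<xi> \<bullet> \<eta>)) \<cdot>\<^sub>m 1\<^sub>m d"
    using clifford_identity_one[OF \<xi> \<eta>] by (simp add: one)
  have 2: "msum d d (\<lambda>\<nu>. (\<Sum>p = 0..2 * q - 1. complex_of_real ((- conf_weight_hat n \<rho> \<nu>) ^ p)
      * scalar_on (carrier_vec d) (c_hat n d \<pi> (2 * q - 1 - p))) \<cdot>\<^sub>m clifford_sym n d (W \<nu>) \<xi> \<eta>) L = 0\<^sub>m d d"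
    if "1 \<le> q" for q
  proof -
    have "{0..2 * q - 1} = {..<2 * q}" using that by auto
    then show ?thesis using clifford_identity_odd[OF \<xi> \<eta>, of q] by simp
  qed
  have "\<exists>m. n = 2 * Suc m" if "even n"
    using that n by (metis evenE le_zero_eq mult_0_right not0_implies_Suc zero_neq_numeral)
  then show ?thesis using 1 2 clifford_identity_pf[OF _ \<xi> \<eta>] clifford_identity_pf_weight[OF _ \<xi> \<eta>] by blast
qed

end
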